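(* Let $a\ge 0$ with $a\neq 1/2$, and put $\lambda^{\pm}=\frac12\pm a$. Let $S=\{z=axy\}\subset\mathbb{H}$ be the hyperbolic paraboloid in the Heisenberg group, and let $$\Delta_x=\partial_x^2+\frac{1}{\lambda^- x}\partial_x,\qquad \Delta_y=\partial_y^2+\frac{1}{\lambda^+ y}\partial_y$$ be the operators induced on the positive $x$- and $y$-half-axes (which are leaves of the characteristic foliation of $S$), both with domain $\mathcal{C}^\infty_0(\mathbb{R}_+)$, $\mathbb{R}_+=(0,+\infty)$, acting respectively in $L^2(\mathbb{R}_+,x^{1/\lambda^-}dx)$ and $L^2(\mathbb{R}_+,y^{1/\lambda^+}dy)$. Then $\Delta_y$ is not essentially self-adjoint. Moreover: 1. for $a=0$ the origin is of star node type and $\Delta_x$ is not essentially self-adjoint; 2. for $0<a<1/6$ the origin is of proper node type and $\Delta_x$ is not essentially self-adjoint; 3. for $1/6\le a<1/2$ the origin is of (proper) node type and $\Delta_x$ is essentially self-adjoint; 4. for $1/2<a\le 3/2$ the origin is of saddle type and $\Delta_x$ is essentially self-adjoint; 5. for $a>3/2$ the origin is of saddle type and $\Delta_x$ is not essentially self-adjoint.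
   Context: The Heisenberg group is $\mathbb{H}\cong\mathbb{R}^3$ with distribution $D=\operatorname{span}\{X_1,X_2\}$, $X_1=\partial_x-\frac y2\partial_z$, $X_2=\partial_y+\frac x2\partial_z$, metric $g$ on $D$ making $\{X_1,X_2\}$ orthonormal, and volume $dx\wedge dy\wedge dz$. The only point of $S=\{z=axy\}$ ($a\ne1/2$) where $D$ is tangent to $S$ is the origin. The direction field $q\mapsto D_q\cap T_qS$ on $S\setminus\{0\}$ is spanned by the vector field $X=\lambda^- x\,X_1+\lambda^+ y\,X_2$, which in the coordinates $(x,y)$ on $S$ is the linear field $\lambda^-x\partial_x+\lambda^+y\partial_y$; its integral curves are the leaves of the characteristic foliation. The type of the origin is that of this linear field: saddle if its eigenvalues $\lambda^\pm$ have opposite signs, proper node if they are distinct and have the same sign, star node if they coincide. $\mathcal{C}^\infty_0(\mathbb{R}_+)$ is the space of smooth functions with compact support in $(0,+\infty)$. The weighted measures $x^{1/\lambda^-}dx$ and $y^{1/\lambda^+}dy$ are (up to constants) those making $\Delta_x$, $\Delta_y$ symmetric. A symmetric operator is essentially self-adjoint if it has exactly one self-adjoint extension. *)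

theory Defs
  imports "HOL-Analysis.Analysis"
begin

definition lam_minus :: "real \<Rightarrow> real"
  where "lam_minus a = 1/2 - a"

definition lam_plus :: "real \<Rightarrow> real"
  where "lam_plus a = 1/2 + a"


section \<open>The paraboloid in the Heisenberg group\<close>

type_synonym R3 = "real \<times> real \<times> real"

fun X1 :: "R3 \<Rightarrow> R3"
  where "X1 (x, y, z) = (1, 0, - (y/2))"

fun X2 :: "R3 \<Rightarrow> R3"
  where "X2 (x, y, z) = (0, 1, x/2)"

definition distribution :: "R3 \<Rightarrow> R3 set"
  where "distribution q = span {X1 q, X2 q}"

definition paraboloid :: "real \<Rightarrow> R3 set"
  where "paraboloid a = {(x, y, z). z = a * x * y}"

text \<open>The tangent plane is the kernel of the differential of \<open>z - a x y\<close>.\<close>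

fun tangent_plane :: "real \<Rightarrow> R3 \<Rightarrow> R3 set"
  where "tangent_plane a (x, y, z) = {(u, v, w). w = a * y * u + a * x * v}"

fun char_field :: "real \<Rightarrow> R3 \<Rightarrow> R3"
  where "char_field a (x, y, z) =
    (lam_minus a * x) *\<^sub>R X1 (x, y, z) + (lam_plus a * y) *\<^sub>R X2 (x, y, z)"

lemma distribution_eq:
  "distribution (x, y, z) = {(u, v, w). w = - (y/2) * u + (x/2) * v}"
proof -
  have "p \<in> span {X1 (x, y, z), X2 (x, y, z)} \<longleftrightarrow>
      (case p of (u, v, w) \<Rightarrow> w = - (y/2) * u + (x/2) * v)" for p
    by (cases p) (auto simp: span_insert span_singleton algebra_simps)
  then show ?thesis
    by (auto simp: distribution_def)
qed

lemma characteristic_point_iff: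
  assumes "0 \<le> a" "a \<noteq> 1/2" "q \<in> paraboloid a"
  shows "distribution q = tangent_plane a q \<longleftrightarrow> q = 0"
proof -
  obtain x y z where q: "q = (x, y, z)" by (cases q)
  have z: "z = a * x * y" using assms(3) by (simp add: q paraboloid_def)
  show ?thesis
  proof
    assume eq: "distribution q = tangent_plane a q"
    have "(1, 0, - (y/2)) \<in> tangent_plane a q" "(0, 1, x/2) \<in> tangent_plane a q"
      unfolding eq[symmetric] unfolding q distribution_eq by simp_all
    then have "- (y/2) = a * y" "x/2 = a * x"
      by (simp_all add: q)
    then have "y * (a + 1/2) = 0" "x * (a - 1/2) = 0"
      by (simp_all add: algebra_simps)
    then show "q = 0" using assms z by (simp add: q zero_prod_def)
  next
    assume "q = 0"
    then show "distribution q = tangent_plane a q"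
      by (simp add: q zero_prod_def distribution_eq)
  qed
qed

lemma distribution_inter_tangent_plane:
  assumes "0 \<le> a" "a \<noteq> 1/2" "q \<in> paraboloid a" "q \<noteq> 0"
  shows "distribution q \<inter> tangent_plane a q = span {char_field a q}"
proof -
  obtain x y z where q: "q = (x, y, z)" by (cases q)
  define m p where "m = lam_minus a" and "p = lam_plus a"
  have mp: "m \<noteq> 0" "p \<noteq> 0"
    using assms by (auto simp: m_def p_def lam_minus_def lam_plus_def)
  have z: "z = a * x * y" using assms(3) by (simp add: q paraboloid_def)
  then have nz: "x \<noteq> 0 \<or> y \<noteq> 0" using assms(4) by (auto simp: q zero_prod_def)
  have iff: "w = a * y * u + a * x * v \<longleftrightarrow> m * x * v = p * y * u"
    if "w = - (y/2) * u + (x/2) * v" for u v w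
    unfolding that by (auto simp: m_def p_def lam_minus_def lam_plus_def algebra_simps)
  have ex: "\<exists>k. u = k * (m * x) \<and> v = k * (p * y)" if h: "m * x * v = p * y * u" for u v
  proof (cases "x = 0")
    case False
    then show ?thesis using h mp
      by (intro exI[of _ "u / (m * x)"]) (simp add: field_simps)
  next
    case True
    then show ?thesis using h mp nz
      by (intro exI[of _ "v / (p * y)"]) (auto simp: field_simps)
  qed
  have "distribution q \<inter> tangent_plane a q =
      {(u, v, w). w = - (y/2) * u + (x/2) * v \<and> m * x * v = p * y * u}"
    unfolding q distribution_eq tangent_plane.simps
  proof (intro equalityI subsetI)
    fix r assume "r \<in> {(u, v, w). w = - (y/2) * u + (x/2) * v} \<inter> {(u, v, w). w = a * y * u + a * x * v}"
    then show "r \<in> {(u, v, w). w = - (y/2) * u + (x/2) * v \<and> m * x * v = p * y * u}"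
      using iff by (cases r) blast
  next
    fix r assume "r \<in> {(u, v, w). w = - (y/2) * u + (x/2) * v \<and> m * x * v = p * y * u}"
    then show "r \<in> {(u, v, w). w = - (y/2) * u + (x/2) * v} \<inter> {(u, v, w). w = a * y * u + a * x * v}"
      using iff by (cases r) blast
  qed
  also have "\<dots> = range (\<lambda>k. k *\<^sub>R char_field a q)"
  proof (intro equalityI subsetI)
    fix r assume "r \<in> {(u, v, w). w = - (y/2) * u + (x/2) * v \<and> m * x * v = p * y * u}"
    then obtain u v w where r: "r = (u, v, w)" "w = - (y/2) * u + (x/2) * v"
      "m * x * v = p * y * u" by auto
    obtain k where "u = k * (m * x)" "v = k * (p * y)" using ex[OF r(3)] by blast
    then have "r = k *\<^sub>R char_field a q"
      by (simp add: r(1,2) q m_def p_def algebra_simps)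
    then show "r \<in> range (\<lambda>k. k *\<^sub>R char_field a q)" by blast
  qed (auto simp: q m_def p_def algebra_simps)
  finally show ?thesis by (simp add: span_singleton)
qed

text \<open>The field is complete, so its maximal integral curves are exactly those defined on all of
  \<open>\<real>\<close>.\<close>

definition characteristic_leaf :: "real \<Rightarrow> R3 set \<Rightarrow> bool"
  where "characteristic_leaf a L \<longleftrightarrow>
    (\<exists>\<gamma> :: real \<Rightarrow> R3.
      (\<forall>t. \<gamma> t \<in> paraboloid a - {0} \<and>
           (\<gamma> has_vector_derivative char_field a (\<gamma> t)) (at t)) \<and>
      L = range \<gamma>)"

definition positive_x_axis :: "R3 set"
  where "positive_x_axis = {(x, 0, 0) |x. 0 < x}"

definition positive_y_axis :: "R3 set"
  where "positive_y_axis = {(0, y, 0) |y. 0 < y}"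

text \<open>The characteristic field read in the global chart \<open>(x, y, a x y) \<mapsto> (x, y)\<close> of the surface.\<close>

definition char_field_xy :: "real \<Rightarrow> real \<times> real \<Rightarrow> real \<times> real"
  where "char_field_xy a = (\<lambda>(x, y). case char_field a (x, y, a * x * y) of (u, v, w) \<Rightarrow> (u, v))"

lemma char_field_xy_eq: "char_field_xy a (x, y) = (lam_minus a * x, lam_plus a * y)"
  by (simp add: char_field_xy_def)


section \<open>Type of a planar linear field\<close>

definition has_eigenvalues :: "(real \<times> real \<Rightarrow> real \<times> real) \<Rightarrow> real \<Rightarrow> real \<Rightarrow> bool"
  where "has_eigenvalues A \<mu> \<nu> \<longleftrightarrow> linear A \<and>
    (\<exists>v w. v \<noteq> w \<and> independent {v, w} \<and> A v = \<mu> *\<^sub>R v \<and> A w = \<nu> *\<^sub>R w)"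

definition saddle :: "(real \<times> real \<Rightarrow> real \<times> real) \<Rightarrow> bool"
  where "saddle A \<longleftrightarrow> (\<exists>\<mu> \<nu>. has_eigenvalues A \<mu> \<nu> \<and> \<mu> * \<nu> < 0)"

definition proper_node :: "(real \<times> real \<Rightarrow> real \<times> real) \<Rightarrow> bool"
  where "proper_node A \<longleftrightarrow> (\<exists>\<mu> \<nu>. has_eigenvalues A \<mu> \<nu> \<and> \<mu> \<noteq> \<nu> \<and> \<mu> * \<nu> > 0)"

definition star_node :: "(real \<times> real \<Rightarrow> real \<times> real) \<Rightarrow> bool"
  where "star_node A \<longleftrightarrow> (\<exists>\<mu>. has_eigenvalues A \<mu> \<mu> \<and> \<mu> \<noteq> 0)"


section \<open>Unbounded operators on complex \<open>L\<^sup>2\<close> spaces\<close>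

text \<open>Elements of \<open>L\<^sup>2(M)\<close> are represented by functions modulo equality almost everywhere.
  An operator is given by its graph, which is closed under changing either component on a null set;
  hence equality and inclusion of graphs are equality and extension of operators.\<close>

definition square_int :: "'a measure \<Rightarrow> ('a \<Rightarrow> complex) set"
  where "square_int M = {f \<in> borel_measurable M. integrable M (\<lambda>x. (cmod (f x))\<^sup>2)}"

definition l2_inner :: "'a measure \<Rightarrow> ('a \<Rightarrow> complex) \<Rightarrow> ('a \<Rightarrow> complex) \<Rightarrow> complex"
  where "l2_inner M f g = (LINT x|M. f x * cnj (g x))"

type_synonym 'a graph = "(('a \<Rightarrow> complex) \<times> ('a \<Rightarrow> complex)) set"

definition l2_operator :: "'a measure \<Rightarrow> 'a graph \<Rightarrow> bool"
  where "l2_operator M T \<longleftrightarrow>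
    T \<subseteq> square_int M \<times> square_int M \<and>
    (\<forall>f g f' g'. (f, g) \<in> T \<and> f' \<in> square_int M \<and> g' \<in> square_int M \<and>
       (AE x in M. f' x = f x) \<and> (AE x in M. g' x = g x) \<longrightarrow> (f', g') \<in> T) \<and>
    (\<lambda>x. 0, \<lambda>x. 0) \<in> T \<and>
    (\<forall>f g f' g'. (f, g) \<in> T \<and> (f', g') \<in> T \<longrightarrow> (\<lambda>x. f x + f' x, \<lambda>x. g x + g' x) \<in> T) \<and>
    (\<forall>c f g. (f, g) \<in> T \<longrightarrow> (\<lambda>x. c * f x, \<lambda>x. c * g x) \<in> T) \<and>
    (\<forall>f g f' g'. (f, g) \<in> T \<and> (f', g') \<in> T \<and> (AE x in M. f x = f' x) \<longrightarrow>
       (AE x in M. g x = g' x))"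

definition densely_defined :: "'a measure \<Rightarrow> 'a graph \<Rightarrow> bool"
  where "densely_defined M T \<longleftrightarrow>
    (\<forall>f \<in> square_int M. \<forall>\<epsilon> > 0. \<exists>(u, v) \<in> T. (LINT x|M. (cmod (f x - u x))\<^sup>2) < \<epsilon>)"

definition l2_adjoint :: "'a measure \<Rightarrow> 'a graph \<Rightarrow> 'a graph"
  where "l2_adjoint M T = {(u, v) \<in> square_int M \<times> square_int M.
    \<forall>(f, g) \<in> T. l2_inner M g u = l2_inner M f v}"

definition self_adjoint :: "'a measure \<Rightarrow> 'a graph \<Rightarrow> bool"
  where "self_adjoint M T \<longleftrightarrow>
    l2_operator M T \<and> densely_defined M T \<and> l2_adjoint M T = T"

definition essentially_self_adjoint :: "'a measure \<Rightarrow> 'a graph \<Rightarrow> bool"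
  where "essentially_self_adjoint M T \<longleftrightarrow> (\<exists>!H. self_adjoint M H \<and> T \<subseteq> H)"


section \<open>The operators on the half-axes\<close>

definition smooth :: "(real \<Rightarrow> complex) \<Rightarrow> bool"
  where "smooth \<phi> \<longleftrightarrow>
    (\<forall>n t. ((\<lambda>f t. vector_derivative f (at t)) ^^ n) \<phi> differentiable (at t))"

text \<open>Test functions on \<open>(0, \<infinity>)\<close> are extended by zero to \<open>\<real>\<close>.\<close>

definition test_functions :: "(real \<Rightarrow> complex) set"
  where "test_functions = {\<phi>. smooth \<phi> \<and>
    compact (closure {t. \<phi> t \<noteq> 0}) \<and> closure {t. \<phi> t \<noteq> 0} \<subseteq> {0<..}}"

definition leaf_laplacian :: "real \<Rightarrow> (real \<Rightarrow> complex) \<Rightarrow> real \<Rightarrow> complex"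
  where "leaf_laplacian lam \<phi> t =
    vector_derivative (\<lambda>s. vector_derivative \<phi> (at s)) (at t) +
    complex_of_real (1 / (lam * t)) * vector_derivative \<phi> (at t)"

definition leaf_measure :: "real \<Rightarrow> real measure"
  where "leaf_measure lam =
    density (restrict_space lborel {0<..}) (\<lambda>t. ennreal (t powr (1 / lam)))"

lemma leaf_measure_integral:
  fixes h :: "real \<Rightarrow> complex"
  assumes l: "0 < l" and cont: "continuous_on {l..u} h" and zero: "\<And>t. t \<notin> {l..u} \<Longrightarrow> h t = 0"
  shows "integrable (leaf_measure lam) h"
    and "(LINT t|leaf_measure lam. h t) = (LBINT t:{l..u}. (t powr (1/lam)) *\<^sub>R h t)"
proof -
  let ?w = "\<lambda>t::real. t powr (1/lam)"
  have eq: "(\<lambda>t. indicator {0<..} t *\<^sub>R (?w t *\<^sub>R h t)) = (\<lambda>t. indicator {l..u} t *\<^sub>R (?w t *\<^sub>R h t))"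
    by (rule ext) (use l zero in \<open>auto simp: indicator_def\<close>)
  have eqh: "h = (\<lambda>t. indicator {l..u} t *\<^sub>R h t)"
    by (rule ext) (use zero in \<open>auto simp: indicator_def\<close>)
  have "(\<lambda>t. indicator {l..u} t *\<^sub>R h t) \<in> borel_measurable borel"
    by (rule borel_measurable_continuous_on_indicator[OF _ cont]) simp
  then have hm: "h \<in> borel_measurable borel" by (subst eqh)
  then have hm': "h \<in> borel_measurable (restrict_space lborel {0<..})"
    by (simp add: measurable_restrict_space1)
  have "set_integrable lborel {l..u} (\<lambda>t. ?w t *\<^sub>R h t)"
    using l by (intro borel_integrable_atLeastAtMost' continuous_intros cont) auto
  then have int: "integrable lborel (\<lambda>t. indicator {0<..} t *\<^sub>R (?w t *\<^sub>R h t))"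
    unfolding eq by (simp add: set_integrable_def)
  have wm: "?w \<in> borel_measurable (restrict_space lborel {0<..})"
    by (simp add: measurable_restrict_space1)
  show "integrable (leaf_measure lam) h"
    unfolding leaf_measure_def
    by (subst integrable_density[OF hm' wm]) (use int in \<open>simp_all add: integrable_restrict_space\<close>)
  show "(LINT t|leaf_measure lam. h t) = (LBINT t:{l..u}. ?w t *\<^sub>R h t)"
    unfolding leaf_measure_def
    by (subst integral_density[OF hm' wm])
      (use eq in \<open>simp_all add: integral_restrict_space set_lebesgue_integral_def\<close>)
qed

lemma test_function_deriv:
  assumes "smooth \<phi>"
  defines "D \<equiv> \<lambda>f t. vector_derivative f (at t)"
  shows "(\<phi> has_vector_derivative D \<phi> t) (at t)"
    and "(D \<phi> has_vector_derivative D (D \<phi>) t) (at t)"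
    and "continuous_on A \<phi>" "continuous_on A (D \<phi>)" "continuous_on A (D (D \<phi>))"
proof -
  have d: "(D ^^ n) \<phi> differentiable (at t)" for n t
    using assms(1) unfolding smooth_def D_def by blast
  have d0: "\<phi> differentiable (at t)" and d1: "D \<phi> differentiable (at t)"
    and d2: "D (D \<phi>) differentiable (at t)" for t
    using d[of 0 t] d[of 1 t] d[of 2 t] by (simp_all add: numeral_2_eq_2)
  show "(\<phi> has_vector_derivative D \<phi> t) (at t)"
    using d0 unfolding D_def by (simp add: vector_derivative_works)
  show "(D \<phi> has_vector_derivative D (D \<phi>) t) (at t)"
    using d1 unfolding D_def by (simp add: vector_derivative_works)
  show "continuous_on A \<phi>" "continuous_on A (D \<phi>)" "continuous_on A (D (D \<phi>))"
    by (rule continuous_at_imp_continuous_on; rule ballI;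
        rule differentiable_imp_continuous_within; rule d0 d1 d2)+
qed

lemma test_function_support:
  assumes "\<phi> \<in> test_functions"
  obtains l u where "0 < l" "\<And>t. t \<le> l \<or> u \<le> t \<Longrightarrow> \<phi> t = 0"
proof (cases "closure {t. \<phi> t \<noteq> 0} = {}")
  case True
  then have "\<phi> t = 0" for t unfolding closure_eq_empty by blast
  from that[OF zero_less_one this] show ?thesis .
next
  case False
  define K where "K = closure {t. \<phi> t \<noteq> 0}"
  have K: "compact K" "K \<subseteq> {0<..}" "K \<noteq> {}"
    using assms False unfolding test_functions_def K_def by blast+
  obtain m where m: "m \<in> K" "\<forall>t\<in>K. m \<le> t" by (rule bexE[OF compact_attains_inf[OF K(1,3)]])
  obtain n where n: "n \<in> K" "\<forall>t\<in>K. t \<le> n" by (rule bexE[OF compact_attains_sup[OF K(1,3)]])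
  have m0: "0 < m" using subsetD[OF K(2) m(1)] by simp
  have *: "\<phi> t = 0" if "t \<le> m/2 \<or> n + 1 \<le> t" for t
  proof (rule ccontr)
    assume "\<phi> t \<noteq> 0"
    then have "t \<in> K" unfolding K_def by (intro subsetD[OF closure_subset] CollectI)
    then have "m \<le> t" "t \<le> n" using m(2) n(2) by blast+
    then show False using that m0 by linarith
  qed
  have "0 < m/2" using m0 by simp
  from that[OF this *] show ?thesis .
qed

lemma leaf_laplacian_symmetric:
  assumes "\<phi> \<in> test_functions" "\<psi> \<in> test_functions"
  shows "l2_inner (leaf_measure lam) (leaf_laplacian lam \<phi>) \<psi> =
    l2_inner (leaf_measure lam) \<phi> (leaf_laplacian lam \<psi>)"
proof -
  let ?D = "\<lambda>(f :: real \<Rightarrow> complex) t. vector_derivative f (at t)"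
  let ?w = "\<lambda>t::real. t powr (1/lam)"
  obtain l1 u1 where 1: "0 < l1" "\<And>t. t \<le> l1 \<or> u1 \<le> t \<Longrightarrow> \<phi> t = 0"
    using test_function_support[OF assms(1)] by metis
  obtain l2 u2 where 2: "0 < l2" "\<And>t. t \<le> l2 \<or> u2 \<le> t \<Longrightarrow> \<psi> t = 0"
    using test_function_support[OF assms(2)] by metis
  define l u where "l = min l1 l2" and "u = max l (max u1 u2)"
  have lu: "0 < l" "l \<le> u" using 1 2 by (auto simp: l_def u_def)
  have z: "\<phi> t = 0" "\<psi> t = 0" if "t \<le> l \<or> u \<le> t" for t
    using that 1(2)[of t] 2(2)[of t] by (auto simp: l_def u_def)
  have sm: "smooth \<phi>" "smooth \<psi>" using assms by (auto simp: test_functions_def)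
  note d = test_function_deriv[OF sm(1)] test_function_deriv[OF sm(2)]
  let ?f = "\<lambda>t. leaf_laplacian lam \<phi> t * cnj (\<psi> t)"
  let ?g = "\<lambda>t. \<phi> t * cnj (leaf_laplacian lam \<psi> t)"
  let ?F = "\<lambda>t. of_real (?w t) * (?D \<phi> t * cnj (\<psi> t) - \<phi> t * cnj (?D \<psi> t))"
  have cL: "continuous_on {l..u} (leaf_laplacian lam \<theta>)" if "smooth \<theta>" for \<theta>
  proof (cases "lam = 0")
    case True
    then have "leaf_laplacian lam \<theta> = ?D (?D \<theta>)"
      by (simp add: fun_eq_iff leaf_laplacian_def)
    then show ?thesis using test_function_deriv(5)[OF that] by simp
  next
    case False
    show ?thesis unfolding leaf_laplacian_def using False lu
      by (intro continuous_intros test_function_deriv[OF that]) auto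
  qed
  have cf: "continuous_on {l..u} ?f" and cg: "continuous_on {l..u} ?g"
    by (intro continuous_intros cL sm d)+
  note F = leaf_measure_integral[OF lu(1) cf, of lam]
  note G = leaf_measure_integral[OF lu(1) cg, of lam]
  have der: "(?F has_vector_derivative ?w t *\<^sub>R (?f t - ?g t)) (at t within {l..u})"
    if t: "t \<in> {l..u}" for t
  proof -
    have t0: "t > 0" using t lu by simp
    have "((\<lambda>t. ?w t) has_real_derivative (1/lam) * t powr (1/lam - 1)) (at t)"
      using t0 by (auto intro!: derivative_eq_intros)
    then have "((\<lambda>t. of_real (?w t)) has_vector_derivative
        complex_of_real ((1/lam) * t powr (1/lam - 1))) (at t)"
      by (intro has_vector_derivative_of_real)
        (simp add: has_real_derivative_iff_has_vector_derivative)
    then have wd: "((\<lambda>t. of_real (?w t)) has_vector_derivative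
        complex_of_real (?w t * (1 / (lam * t)))) (at t)"
      using t0 by (simp add: powr_diff)
    have "(?F has_vector_derivative
       of_real (?w t) * ((?D \<phi> t * cnj (?D \<psi> t) + ?D (?D \<phi>) t * cnj (\<psi> t)) -
          (\<phi> t * cnj (?D (?D \<psi>) t) + ?D \<phi> t * cnj (?D \<psi> t))) +
       complex_of_real (?w t * (1 / (lam * t))) * (?D \<phi> t * cnj (\<psi> t) - \<phi> t * cnj (?D \<psi> t))) (at t)"
      by (intro has_vector_derivative_mult wd has_vector_derivative_diff
          has_vector_derivative_cnj d)
    also have "of_real (?w t) * ((?D \<phi> t * cnj (?D \<psi> t) + ?D (?D \<phi>) t * cnj (\<psi> t)) -
          (\<phi> t * cnj (?D (?D \<psi>) t) + ?D \<phi> t * cnj (?D \<psi> t))) +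
       complex_of_real (?w t * (1 / (lam * t))) * (?D \<phi> t * cnj (\<psi> t) - \<phi> t * cnj (?D \<psi> t)) =
       ?w t *\<^sub>R (?f t - ?g t)"
      by (simp add: leaf_laplacian_def scaleR_conv_of_real algebra_simps)
    finally show ?thesis by (rule has_vector_derivative_at_within)
  qed
  have zfg: "?f t - ?g t = 0" if "t \<notin> {l..u}" for t
  proof -
    have "t \<le> l \<or> u \<le> t" using that by auto
    from z[OF this] show ?thesis by simp
  qed
  have "(LINT t|leaf_measure lam. ?f t) - (LINT t|leaf_measure lam. ?g t) =
      (LINT t|leaf_measure lam. ?f t - ?g t)"
    by (rule Bochner_Integration.integral_diff[symmetric]; rule F(1) G(1)) (auto intro: z)
  also have "\<dots> = (LBINT t:{l..u}. ?w t *\<^sub>R (?f t - ?g t))"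
    by (rule leaf_measure_integral(2)[OF lu(1) continuous_on_diff[OF cf cg] zfg])
  also have "\<dots> = ?F u - ?F l"
    unfolding set_lebesgue_integral_def
  proof (rule integral_FTC_Icc[OF lu(2)])
    show "continuous_on {l..u} (\<lambda>t. ?w t *\<^sub>R (?f t - ?g t))"
      using lu(1) by (intro continuous_on_scaleR continuous_on_diff cf cg continuous_on_powr
          continuous_on_id continuous_on_const) auto
  qed (rule der, simp)
  also have "\<dots> = 0" by (simp add: z)
  finally show ?thesis by (simp add: l2_inner_def)
qed

definition leaf_operator :: "real \<Rightarrow> real graph"
  where "leaf_operator lam =
    {(f, g) \<in> square_int (leaf_measure lam) \<times> square_int (leaf_measure lam).
      \<exists>\<phi> \<in> test_functions. (AE t in leaf_measure lam. f t = \<phi> t) \<and>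
        (AE t in leaf_measure lam. g t = leaf_laplacian lam \<phi> t)}"

definition ess_sa_x :: "real \<Rightarrow> bool"
  where "ess_sa_x a \<longleftrightarrow>
    essentially_self_adjoint (leaf_measure (lam_minus a)) (leaf_operator (lam_minus a))"

definition ess_sa_y :: "real \<Rightarrow> bool"
  where "ess_sa_y a \<longleftrightarrow>
    essentially_self_adjoint (leaf_measure (lam_plus a)) (leaf_operator (lam_plus a))"

end

theory Submission
  imports Defs
begin

text \<open>
  With \<open>c = 1 / lam\<close> the operator is \<open>t powr (- c) * (t powr c * u')'\<close>, and an element \<open>(u, v)\<close> of the
  graph of its adjoint is, after a change on a null set, a locally absolutely continuous solution of
  \<open>U' = t powr (- c) * P\<close>, \<open>P' = t powr c * v\<close>. By Green's formula the form that measures the failure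
  of symmetry of the adjoint is the limit of the Wronskian \<open>U * cnj P' - P * cnj U'\<close> at \<open>0\<close>, since the
  Wronskian always tends to \<open>0\<close> at infinity. Multiplication by \<open>t powr (c - 1)\<close> exchanges \<open>c\<close> and
  \<open>2 - c\<close>. The homogeneous solutions are \<open>1\<close> and \<open>t powr (1 - c)\<close>. If \<open>c \<ge> 3\<close> or \<open>c \<le> - 1\<close>, one of
  them is not square integrable near \<open>0\<close>; this forces the limit to vanish, so the adjoint is symmetric
  and is the only self-adjoint extension. If \<open>- 1 < c < 3\<close>, both are square integrable, and each of
  them, cut off near \<open>0\<close>, serves as a boundary condition that defines a self-adjoint extension; the
  two extensions differ. The threshold \<open>c = 3\<close> is \<open>a = 1/6\<close> and \<open>c = - 1\<close> is \<open>a = 3/2\<close>.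
\<close>

section \<open>Smooth functions and test functions\<close>

text \<open>Essential self-adjointness is stated as uniqueness of a self-adjoint extension, so the
  proof compares graphs with their adjoints and uses no deficiency indices. The main obstacle is
  regularity: an element of the adjoint is a priori only a pair of square integrable functions that
  satisfies an identity against test functions. It is tested with solutions \<open>\<phi>\<close> of
  (t^c \<phi>')' = \<psi>. Compact support of \<open>\<phi>\<close> costs two moment conditions on
  \<open>\<psi>\<close>, and their multipliers are exactly the homogeneous solutions 1 and t^(1-c),
  which therefore are the only ambiguity. They must be independent, whence c \<noteq> 1; on the
  x-axis c = 1 would mean a = -1/2, on the y-axis a = 1/2. At infinity square integrability of
  \<open>U\<close> alone does not control the Wronskian; the flux \<open>P\<close> is bounded by an
  energy estimate for c \<ge> 0, and the exchange of c and 2 - c covers c < 0. At the origin the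
  number 3 arises because t^(1-c) has weighted square t^(2-c), which is not integrable at 0 exactly
  if c \<ge> 3.\<close>

lemma smooth_coinduct:
  assumes "f \<in> F"
    and step: "\<And>f. f \<in> F \<Longrightarrow> \<exists>g\<in>F. \<forall>t. (f has_vector_derivative g t) (at t)"
  shows "smooth f"
proof -
  let ?D = "\<lambda>f t. vector_derivative f (at t)"
  \<comment> \<open>Every iterated derivative stays in the family, so only one differentiation of a
    general member has to be computed; this replaces explicit formulas for higher
    derivatives.\<close>
  have "(?D ^^ n) f \<in> F" for n
  proof (induction n)
    case 0
    then show ?case using assms(1) by simp
  next
    case (Suc n)
    obtain g where g: "g \<in> F" "\<And>t. ((?D ^^ n) f has_vector_derivative g t) (at t)"
      using step[OF Suc] by blast
    have "?D ((?D ^^ n) f) = g"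
      by (rule ext) (rule vector_derivative_at[OF g(2)])
    then show ?case using g(1) by simp
  qed
  then show ?thesis
    unfolding smooth_def using step differentiableI_vector by blast
qed

lemma smooth_deriv:
  assumes "smooth f"
  obtains g where "smooth g" "\<And>t. (f has_vector_derivative g t) (at t)"
proof
  let ?D = "\<lambda>f t. vector_derivative f (at t)"
  show "smooth (?D f)"
    unfolding smooth_def
  proof (intro allI)
    fix n t
    have "(?D ^^ Suc n) f differentiable (at t)"
      using assms unfolding smooth_def by blast
    then show "(?D ^^ n) (?D f) differentiable (at t)"
      by (simp only: funpow_Suc_right o_apply)
  qed
  show "(f has_vector_derivative ?D f t) (at t)" for t
    by (rule test_function_deriv(1)[OF assms])
qed

lemma smooth_primitive:
  assumes "smooth g" "\<And>t. (f has_vector_derivative g t) (at t)"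
  shows "smooth f"
proof (rule smooth_coinduct[where F = "insert f {h. smooth h}"])
  fix h assume "h \<in> insert f {h. smooth h}"
  then show "\<exists>g\<in>insert f {h. smooth h}. \<forall>t. (h has_vector_derivative g t) (at t)"
    using assms smooth_deriv by (metis insert_iff mem_Collect_eq)
qed simp

lemma smooth_continuous: "smooth f \<Longrightarrow> continuous_on A f"
  by (rule test_function_deriv(3))

lemma smooth_add:
  assumes "smooth f" "smooth g"
  shows "smooth (\<lambda>t. f t + g t)"
proof (rule smooth_coinduct[where F = "{\<lambda>t. f t + g t | f g. smooth f \<and> smooth g}"])
  fix h assume "h \<in> {\<lambda>t. f t + g t | f g. smooth f \<and> smooth g}"
  then obtain f g where h: "h = (\<lambda>t. f t + g t)" "smooth f" "smooth g" by blast
  obtain f' where f': "smooth f'" "\<And>t. (f has_vector_derivative f' t) (at t)"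
    using smooth_deriv[OF h(2)] by blast
  obtain g' where g': "smooth g'" "\<And>t. (g has_vector_derivative g' t) (at t)"
    using smooth_deriv[OF h(3)] by blast
  have "(h has_vector_derivative f' t + g' t) (at t)" for t
    unfolding h by (intro derivative_intros f' g')
  then show "\<exists>g\<in>{\<lambda>t. f t + g t | f g. smooth f \<and> smooth g}. \<forall>t. (h has_vector_derivative g t) (at t)"
    using f'(1) g'(1) by (intro bexI[of _ "\<lambda>t. f' t + g' t"]) auto
qed (use assms in auto)

text \<open>The derivative of one product is a sum of two, so a family closed under differentiation
  must also admit sums. Coinduction over it avoids the higher Leibniz rule.\<close>

inductive_set smooth_products :: "(real \<Rightarrow> complex) set" where
  prod: "smooth f \<Longrightarrow> smooth g \<Longrightarrow> (\<lambda>t. f t * g t) \<in> smooth_products"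
| add: "f \<in> smooth_products \<Longrightarrow> g \<in> smooth_products \<Longrightarrow> (\<lambda>t. f t + g t) \<in> smooth_products"

lemma smooth_mult:
  assumes "smooth f" "smooth g"
  shows "smooth (\<lambda>t. f t * g t)"
proof (rule smooth_coinduct[where F = smooth_products])
  fix h assume "h \<in> smooth_products"
  then show "\<exists>g\<in>smooth_products. \<forall>t. (h has_vector_derivative g t) (at t)"
  proof induction
    case (prod f g)
    obtain f' where f': "smooth f'" "\<And>t. (f has_vector_derivative f' t) (at t)"
      using smooth_deriv[OF prod(1)] by blast
    obtain g' where g': "smooth g'" "\<And>t. (g has_vector_derivative g' t) (at t)"
      using smooth_deriv[OF prod(2)] by blast
    show ?case
      using has_vector_derivative_mult[OF f'(2) g'(2)]
      by (intro bexI[of _ "\<lambda>t. f t * g' t + f' t * g t"] smooth_products.intros prod f' g') simp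
  next
    case (add f g)
    then obtain f' g' where "f' \<in> smooth_products" "\<And>t. (f has_vector_derivative f' t) (at t)"
      "g' \<in> smooth_products" "\<And>t. (g has_vector_derivative g' t) (at t)" by blast
    then show ?case
      by (intro bexI[of _ "\<lambda>t. f' t + g' t"] smooth_products.intros)
        (auto intro!: derivative_eq_intros)
  qed
qed (intro smooth_products.prod assms)

lemma smooth_polynomial_function:
  assumes "polynomial_function p"
  shows "smooth p"
proof (rule smooth_coinduct[where F = "Collect polynomial_function"])
  fix h :: "real \<Rightarrow> complex" assume "h \<in> Collect polynomial_function"
  then show "\<exists>g\<in>Collect polynomial_function. \<forall>t. (h has_vector_derivative g t) (at t)"
    using has_vector_derivative_polynomial_function[of h] by (metis mem_Collect_eq)
qed (use assms in auto)

lemma smooth_const: "smooth (\<lambda>t. k)"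
  by (intro smooth_polynomial_function) auto

lemma smooth_affine:
  assumes "smooth f"
  shows "smooth (\<lambda>t. f (a * t + b))"
\<comment> \<open>The free factor \<open>k\<close> absorbs the \<open>a\<close> that the chain rule
  produces at each differentiation.\<close>
proof (rule smooth_coinduct[where F = "{\<lambda>t. k * f (a * t + b) | k f. smooth f}"])
  show "(\<lambda>t. f (a * t + b)) \<in> {\<lambda>t. k * f (a * t + b) | k f. smooth f}"
    using assms by (auto intro!: exI[of _ 1] exI[of _ f])
  fix h assume "h \<in> {\<lambda>t. k * f (a * t + b) | k f. smooth f}"
  then obtain k f where h: "h = (\<lambda>t. k * f (a * t + b))" "smooth f" by blast
  obtain f' where f': "smooth f'" "\<And>t. (f has_vector_derivative f' t) (at t)"
    using smooth_deriv[OF h(2)] by blast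
  have "((\<lambda>t. f (a * t + b)) has_vector_derivative a *\<^sub>R f' (a * t + b)) (at t)" for t
  proof -
    have "((\<lambda>t. a * t + b) has_vector_derivative a) (at t)"
      by (auto intro!: derivative_eq_intros)
    from vector_diff_chain_at[OF this f'(2)] show ?thesis by (simp add: o_def)
  qed
  note affine = this
  have "(h has_vector_derivative k * (a *\<^sub>R f' (a * t + b))) (at t)" for t
    unfolding h by (rule has_vector_derivative_mult_right[OF affine])
  then have "(h has_vector_derivative (k * of_real a) * f' (a * t + b)) (at t)" for t
    by (simp add: scaleR_conv_of_real mult.assoc)
  then show "\<exists>g\<in>{\<lambda>t. k * f (a * t + b) | k f. smooth f}. \<forall>t. (h has_vector_derivative g t) (at t)"
    using f'(1) by (intro bexI[of _ "\<lambda>t. (k * of_real a) * f' (a * t + b)"]) auto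
qed

section \<open>The flat function exp(-1/t) and smooth bumps\<close>

lemma poly_times_exp_uminus_tendsto_0: "((\<lambda>x::real. poly p x * exp (- x)) \<longlongrightarrow> 0) at_top"
proof -
  have "((\<lambda>x. \<Sum>i\<le>degree p. coeff p i * (x ^ i / exp x)) \<longlongrightarrow> (\<Sum>i\<le>degree p. coeff p i * 0)) at_top"
    by (intro tendsto_intros tendsto_power_div_exp_0)
  then show ?thesis
    by (simp add: poly_altdef exp_minus field_simps sum_divide_distrib)
qed

text \<open>The polynomial parameter makes the family stable: differentiating p(1/t) exp(-1/t)
  multiplies by 1/t^2 and replaces p by p - p', that is, p becomes X^2 (p - p').\<close>

definition flat_exp :: "real poly \<Rightarrow> real \<Rightarrow> real" where
  "flat_exp p t = (if t > 0 then poly p (1 / t) * exp (- (1 / t)) else 0)"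

lemma flat_exp_deriv:
  "(flat_exp p has_real_derivative flat_exp ([:0, 0, 1:] * (p - pderiv p)) t) (at t)"
proof -
  consider "t > 0" | "t < 0" | "t = 0" by linarith
  then show ?thesis
  proof cases
    case 1
    have "((\<lambda>t. poly p (1 / t) * exp (- (1 / t))) has_real_derivative
      flat_exp ([:0, 0, 1:] * (p - pderiv p)) t) (at t)"
      using 1 by (auto intro!: derivative_eq_intros DERIV_chain'[where f="\<lambda>t. 1/t" and g="poly p"]
          simp: flat_exp_def field_simps power2_eq_square)
    then show ?thesis
      by (rule has_field_derivative_transform_within_open[of _ _ _ "{0<..}"])
        (use 1 in \<open>auto simp: flat_exp_def\<close>)
  next
    case 2
    have "((\<lambda>_. 0) has_real_derivative flat_exp ([:0, 0, 1:] * (p - pderiv p)) t) (at t)"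
      using 2 by (simp add: flat_exp_def)
    then show ?thesis
      by (rule has_field_derivative_transform_within_open[of _ _ _ "{..<0}"])
        (use 2 in \<open>auto simp: flat_exp_def\<close>)
  next
    case 3
    \<comment> \<open>\<open>pCons 0 p\<close> is X p: the difference quotient at 0 divides by t,
      which in the variable x = 1/t is one more factor x.\<close>
    have "((\<lambda>x. poly (pCons 0 p) x * exp (- x)) \<longlongrightarrow> 0) at_top"
      by (rule poly_times_exp_uminus_tendsto_0)
    from filterlim_compose[OF this filterlim_inverse_at_top_right]
    have "((\<lambda>t. flat_exp p t / t) \<longlongrightarrow> 0) (at_right 0)"
      by (rule Lim_transform_eventually)
        (auto simp: eventually_at_right_field flat_exp_def field_simps intro!: exI[of _ 1])
    moreover have "((\<lambda>t. flat_exp p t / t) \<longlongrightarrow> 0) (at_left 0)"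
      by (rule Lim_transform_eventually[of "\<lambda>_. 0"])
        (auto simp: eventually_at_left_field flat_exp_def intro!: exI[of _ "-1"])
    ultimately have "((\<lambda>t. flat_exp p t / t) \<longlongrightarrow> 0) (at 0)"
      by (simp add: filterlim_at_split)
    then show ?thesis
      using 3 by (simp add: has_field_derivative_iff flat_exp_def)
  qed
qed

lemma smooth_flat_exp: "smooth (\<lambda>t. of_real (flat_exp p t))"
proof (rule smooth_coinduct[where F = "range (\<lambda>p t. of_real (flat_exp p t))"])
  fix h :: "real \<Rightarrow> complex" assume "h \<in> range (\<lambda>p t. of_real (flat_exp p t))"
  then obtain p where h: "h = (\<lambda>t. of_real (flat_exp p t))" by blast
  have "(h has_vector_derivative of_real (flat_exp ([:0, 0, 1:] * (p - pderiv p)) t)) (at t)" for t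
    unfolding h
    by (intro has_vector_derivative_of_real flat_exp_deriv)
  then show "\<exists>g\<in>range (\<lambda>p t. of_real (flat_exp p t)). \<forall>t. (h has_vector_derivative g t) (at t)"
    by (intro bexI[of _ "\<lambda>t. of_real (flat_exp ([:0, 0, 1:] * (p - pderiv p)) t)"]) auto
qed simp

text \<open>Since exp(-1/s) tends to 1 as s grows, the steepness \<open>n\<close> lets these
  functions converge pointwise to the indicator of the open interval; no plateau and no mollifier is
  used.\<close>

definition bump :: "real \<Rightarrow> real \<Rightarrow> nat \<Rightarrow> real \<Rightarrow> real" where
  "bump l u n t = flat_exp 1 (real n * (t - l)) * flat_exp 1 (real n * (u - t))"

lemma smooth_bump: "smooth (\<lambda>t. of_real (bump l u n t))"
proof -
  have "smooth (\<lambda>t. of_real (flat_exp 1 (real n * t + (- real n * l))))"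
    "smooth (\<lambda>t. of_real (flat_exp 1 ((- real n) * t + real n * u)))"
    by (rule smooth_affine[OF smooth_flat_exp])+
  from smooth_mult[OF this] show ?thesis
    by (simp add: bump_def algebra_simps)
qed

lemma bump_bounds: "0 \<le> bump l u n t" "bump l u n t \<le> 1"
proof -
  have "0 \<le> flat_exp 1 s \<and> flat_exp 1 s \<le> 1" for s
    by (simp add: flat_exp_def)
  then show "0 \<le> bump l u n t" "bump l u n t \<le> 1"
    by (simp_all add: bump_def mult_le_one)
qed

lemma bump_eq_0: "t \<notin> {l<..<u} \<Longrightarrow> bump l u n t = 0"
  by (auto simp: bump_def flat_exp_def zero_less_mult_iff)

lemma bump_tendsto_1:
  assumes "t \<in> {l<..<u}"
  shows "(\<lambda>n. bump l u n t) \<longlonglongrightarrow> 1"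
proof -
  have *: "(\<lambda>n. flat_exp 1 (real n * d)) \<longlonglongrightarrow> 1" if "d > 0" for d
  proof -
    have "(\<lambda>n. exp (- ((1 / real n) / d))) \<longlonglongrightarrow> exp (- (0 / d))"
      using that by (intro tendsto_intros lim_const_over_n) auto
    then have "(\<lambda>n. exp (- ((1 / real n) / d))) \<longlonglongrightarrow> 1" by simp
    then show ?thesis
      by (rule Lim_transform_eventually)
        (use that in \<open>auto simp: flat_exp_def eventually_sequentially intro!: exI[of _ 1]\<close>)
  qed
  have "(\<lambda>n. bump l u n t) \<longlonglongrightarrow> 1 * 1"
    unfolding bump_def using assms by (intro tendsto_mult *) auto
  then show ?thesis by simp
qed

section \<open>Test functions: powers as multipliers, primitives\<close>

lemma test_functionI:
  assumes "smooth \<phi>" "0 < l" "\<And>t. t \<notin> {l..u} \<Longrightarrow> \<phi> t = 0"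
  shows "\<phi> \<in> test_functions"
proof -
  have "closure {t. \<phi> t \<noteq> 0} \<subseteq> {l..u}"
    by (rule closure_minimal) (use assms(3) in fastforce)+
  moreover from this have "bounded (closure {t. \<phi> t \<noteq> 0})"
    by (rule bounded_subset[rotated]) (rule bounded_closed_interval)
  ultimately show ?thesis
    unfolding test_functions_def using assms(1,2)
    by (force simp: compact_eq_bounded_closed)
qed

lemma test_functions_smooth: "\<phi> \<in> test_functions \<Longrightarrow> smooth \<phi>"
  by (simp add: test_functions_def)


lemma test_function_cases:
  assumes "\<phi> \<in> test_functions"
  obtains l u where "0 < l" "l < u" "\<And>t. t \<notin> {l..u} \<Longrightarrow> \<phi> t = 0"
proof -
  obtain l u where lu: "0 < l" "\<And>t. t \<le> l \<or> u \<le> t \<Longrightarrow> \<phi> t = 0"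
    using test_function_support[OF assms] by metis
  show ?thesis
    by (rule that[of l "max u (l + 1)"]) (use lu in \<open>auto simp: less_max_iff_disj not_le\<close>)
qed

lemma test_function_deriv_test:
  assumes "\<phi> \<in> test_functions"
  obtains \<phi>' where "\<phi>' \<in> test_functions" "\<And>t. (\<phi> has_vector_derivative \<phi>' t) (at t)"
proof -
  obtain l u where lu: "0 < l" "l < u" "\<And>t. t \<notin> {l..u} \<Longrightarrow> \<phi> t = 0"
    using test_function_cases[OF assms] by metis
  obtain \<phi>' where \<phi>': "smooth \<phi>'" "\<And>t. (\<phi> has_vector_derivative \<phi>' t) (at t)"
    using smooth_deriv test_functions_smooth[OF assms] by metis
  have "\<phi>' t = 0" if "t \<notin> {l..u}" for t
  proof -
    have "(\<phi> has_vector_derivative 0) (at t)"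
      by (rule has_vector_derivative_transform_within_open[of "\<lambda>_. 0" _ _ "- {l..u}"])
        (use that lu(3) in \<open>auto intro!: open_Compl\<close>)
    with \<phi>'(2) show ?thesis by (rule vector_derivative_unique_at)
  qed
  then show ?thesis
    using that[of \<phi>'] test_functionI[OF \<phi>'(1) lu(1)] \<phi>'(2) by blast
qed

lemma test_functions_add:
  assumes "\<phi> \<in> test_functions" "\<psi> \<in> test_functions"
  shows "(\<lambda>t. \<phi> t + \<psi> t) \<in> test_functions"
proof -
  obtain l u where 1: "0 < l" "l < u" "\<And>t. t \<notin> {l..u} \<Longrightarrow> \<phi> t = 0"
    using test_function_cases[OF assms(1)] by metis
  obtain l' u' where 2: "0 < l'" "l' < u'" "\<And>t. t \<notin> {l'..u'} \<Longrightarrow> \<psi> t = 0"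
    using test_function_cases[OF assms(2)] by metis
  have "\<phi> t + \<psi> t = 0" if "t \<notin> {min l l'..max u u'}" for t
    using that 1(3)[of t] 2(3)[of t] by (auto simp: min_le_iff_disj le_max_iff_disj)
  then show ?thesis
    using 1 2 by (intro test_functionI[OF smooth_add[OF assms[THEN test_functions_smooth]],
          of "min l l'" "max u u'"]) auto
qed

lemma test_functions_mult:
  assumes "smooth f" "\<phi> \<in> test_functions"
  shows "(\<lambda>t. f t * \<phi> t) \<in> test_functions"
proof -
  obtain l u where 1: "0 < l" "l < u" "\<And>t. t \<notin> {l..u} \<Longrightarrow> \<phi> t = 0"
    using test_function_cases[OF assms(2)] by metis
  show ?thesis
    by (rule test_functionI[of _ l u])
      (use 1 assms in \<open>simp_all add: smooth_mult test_functions_smooth\<close>)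
qed

lemma test_functions_cmult: "\<phi> \<in> test_functions \<Longrightarrow> (\<lambda>t. k * \<phi> t) \<in> test_functions"
  by (rule test_functions_mult[OF smooth_const])

text \<open>The product rule lowers the exponent in one term and differentiates the test function in
  the other; real factors and sums close the family.\<close>

inductive_set powr_test_functions :: "(real \<Rightarrow> complex) set" where
  powr: "\<phi> \<in> test_functions \<Longrightarrow> (\<lambda>t. of_real (k * t powr \<alpha>) * \<phi> t) \<in> powr_test_functions"
| add: "f \<in> powr_test_functions \<Longrightarrow> g \<in> powr_test_functions \<Longrightarrow>
    (\<lambda>t. f t + g t) \<in> powr_test_functions"

text \<open>Powers are singular only at the origin, where a test function already vanishes on a
  neighbourhood. This permits passing between \<phi>', the flux t^c \<phi>' and t^(-c) \<psi> inside
  the class.\<close>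

lemma test_functions_powr:
  assumes "\<phi> \<in> test_functions"
  shows "(\<lambda>t. of_real (t powr \<alpha>) * \<phi> t) \<in> test_functions"
proof -
  have "smooth (\<lambda>t. of_real (1 * t powr \<alpha>) * \<phi> t)"
  proof (rule smooth_coinduct[where F = powr_test_functions])
    show "(\<lambda>t. of_real (1 * t powr \<alpha>) * \<phi> t) \<in> powr_test_functions"
      by (rule powr_test_functions.powr[OF assms])
    fix h assume "h \<in> powr_test_functions"
    then show "\<exists>g\<in>powr_test_functions. \<forall>t. (h has_vector_derivative g t) (at t)"
    proof induction
      case (powr \<phi> k \<alpha>)
      obtain l u where lu: "0 < l" "l < u" "\<And>t. t \<notin> {l..u} \<Longrightarrow> \<phi> t = 0"
        using test_function_cases[OF powr] by metis
      obtain \<phi>' where \<phi>': "\<phi>' \<in> test_functions" "\<And>t. (\<phi> has_vector_derivative \<phi>' t) (at t)"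
        using test_function_deriv_test[OF powr] by blast
      let ?g = "\<lambda>t. of_real (k * t powr \<alpha>) * \<phi>' t + of_real (k * \<alpha> * t powr (\<alpha> - 1)) * \<phi> t"
      have "((\<lambda>t. of_real (k * t powr \<alpha>) * \<phi> t) has_vector_derivative ?g t) (at t)" for t
      proof (cases "t > 0")
        case True
        then have "((\<lambda>t. k * t powr \<alpha>) has_real_derivative k * \<alpha> * t powr (\<alpha> - 1)) (at t)"
          by (auto intro!: derivative_eq_intros)
        then show ?thesis
          by (intro has_vector_derivative_mult has_vector_derivative_of_real \<phi>')
      next
        case False
        have "\<phi>' t = 0"
        proof -
          have "(\<phi> has_vector_derivative 0) (at t)"
            by (rule has_vector_derivative_transform_within_open[of "\<lambda>_. 0" _ _ "{..<l}"])
              (use False lu in auto)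
          with \<phi>'(2) show ?thesis by (rule vector_derivative_unique_at)
        qed
        moreover have "\<phi> t = 0" using lu False by auto
        ultimately have "((\<lambda>_. 0) has_vector_derivative ?g t) (at t)"
          by simp
        then show ?thesis
          by (rule has_vector_derivative_transform_within_open[of _ _ _ "{..<l}"])
            (use False lu in auto)
      qed
      moreover have "?g \<in> powr_test_functions"
        by (rule powr_test_functions.add[OF powr_test_functions.powr[OF \<phi>'(1)]
              powr_test_functions.powr[OF powr]])
      ultimately show ?case by (rule_tac bexI[of _ ?g]) auto
    next
      case (add f g)
      then obtain f' g' where "f' \<in> powr_test_functions" "\<And>t. (f has_vector_derivative f' t) (at t)"
        "g' \<in> powr_test_functions" "\<And>t. (g has_vector_derivative g' t) (at t)" by blast
      then show ?case
        by (intro bexI[of _ "\<lambda>t. f' t + g' t"] powr_test_functions.intros)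
          (auto intro!: derivative_eq_intros)
    qed
  qed
  moreover obtain l u where "0 < l" "l < u" "\<And>t. t \<notin> {l..u} \<Longrightarrow> \<phi> t = 0"
    using test_function_cases[OF assms] by metis
  ultimately show ?thesis
    by (intro test_functionI[of _ l u]) auto
qed

lemma integrable_test_function:
  assumes "\<phi> \<in> test_functions"
  shows "integrable lborel \<phi>"
proof -
  obtain l u where lu: "0 < l" "l < u" "\<And>t. t \<notin> {l..u} \<Longrightarrow> \<phi> t = 0"
    using test_function_cases[OF assms] by metis
  have "integrable lborel (\<lambda>t. indicator {l..u} t *\<^sub>R \<phi> t)"
    by (intro borel_integrable_compact smooth_continuous test_functions_smooth assms) auto
  also have "(\<lambda>t. indicator {l..u} t *\<^sub>R \<phi> t) = \<phi>"
    using lu(3) by (auto simp: indicator_def)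
  finally show ?thesis .
qed

text \<open>Vanishing total integral is what makes the primitive zero to the right of the
  support.\<close>

lemma test_function_primitive:
  assumes "\<psi> \<in> test_functions" and int0: "(LINT t|lborel. \<psi> t) = 0"
  obtains \<Psi> where "\<Psi> \<in> test_functions" "\<And>t. (\<Psi> has_vector_derivative \<psi> t) (at t)"
proof -
  obtain l u where lu: "0 < l" "l < u" "\<And>t. t \<notin> {l..u} \<Longrightarrow> \<psi> t = 0"
    using test_function_cases[OF assms(1)] by metis
  \<comment> \<open>The base point 0 lies left of the support. For t < 0 the interval is empty and
    the integral is 0, the value required there.\<close>
  define \<Psi> where "\<Psi> t = integral {0..t} \<psi>" for t
  have cont: "continuous_on A \<psi>" for A
    by (intro smooth_continuous test_functions_smooth assms)
  have left: "\<Psi> t = 0" if "t < l" for t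
  proof -
    have "integral {0..t} \<psi> = integral {0..t} (\<lambda>_. 0)"
      by (rule integral_cong) (use that lu in auto)
    then show ?thesis by (simp add: \<Psi>_def)
  qed
  have right: "\<Psi> t = 0" if "u < t" for t
  proof -
    have "(\<psi> has_integral 0) UNIV"
      using has_integral_integral_lborel[OF integrable_test_function[OF assms(1)]] int0 by simp
    then have "((\<lambda>t. if t \<in> {l..u} then \<psi> t else 0) has_integral 0) UNIV"
      by (rule has_integral_eq[rotated]) (use lu(3) in auto)
    then have "(\<psi> has_integral 0) {l..u}"
      by (rule has_integral_restrict_UNIV[THEN iffD1])
    then have "(\<psi> has_integral 0) {0..t}"
      by (rule has_integral_on_superset) (use lu that in auto)
    then show ?thesis by (simp add: \<Psi>_def integral_unique)
  qed
  have deriv: "(\<Psi> has_vector_derivative \<psi> t) (at t)" for t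
  proof (cases "t > 0")
    case True
    have "(\<Psi> has_vector_derivative \<psi> t) (at t within {0..t+1})"
      unfolding \<Psi>_def by (rule integral_has_vector_derivative[OF cont]) (use True in auto)
    then have "(\<Psi> has_vector_derivative \<psi> t) (at t within {0<..<t+1})"
      by (rule has_vector_derivative_within_subset) auto
    then show ?thesis using True at_within_open[of t "{0<..<t+1}"] by simp
  next
    case False
    have "((\<lambda>_. 0) has_vector_derivative \<psi> t) (at t)"
      using lu False by auto
    then show ?thesis
      by (rule has_vector_derivative_transform_within_open[of _ _ _ "{..<l}"])
        (use False lu left in auto)
  qed
  moreover have "\<Psi> \<in> test_functions"
  proof (rule test_functionI)
    show "smooth \<Psi>"
      by (rule smooth_primitive[OF test_functions_smooth[OF assms(1)] deriv])
    show "\<Psi> t = 0" if "t \<notin> {l..u}" for t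
      using that left[of t] right[of t] by auto
  qed (rule lu)
  ultimately show ?thesis using that by blast
qed


section \<open>Density of the test functions\<close>

lemma le_one_plus_square: "x \<le> 1 + x\<^sup>2" for x :: real
proof -
  have "2 * x \<le> x\<^sup>2 + 1" using sum_squares_bound[of x 1] by simp
  then show ?thesis using zero_le_power2[of x] by linarith
qed

lemma mult_le_half_squares: "x * y \<le> (x\<^sup>2 + y\<^sup>2) / 2" for x y :: real
  using sum_squares_bound[of x y] by simp

lemma continuous_on_Icc_bounded:
  fixes f :: "real \<Rightarrow> 'a::real_normed_vector"
  assumes "continuous_on {s..t} f"
  obtains B where "\<And>r. r \<in> {s..t} \<Longrightarrow> norm (f r) \<le> B"
  using compact_imp_bounded[OF compact_continuous_image[OF assms compact_Icc]]
  unfolding bounded_iff by blast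

lemma borel_measurable_cnj:
  assumes "f \<in> borel_measurable M"
  shows "(\<lambda>x. cnj (f x)) \<in> borel_measurable M"
  by (rule measurable_compose[OF assms borel_measurable_continuous_onI]) (intro continuous_intros)

lemma cmod_add_power2_le: "(cmod (z + w))\<^sup>2 \<le> 2 * (cmod z)\<^sup>2 + 2 * (cmod w)\<^sup>2"
proof -
  have "(cmod (z + w))\<^sup>2 \<le> (cmod z + cmod w)\<^sup>2"
    by (intro power_mono norm_triangle_ineq) auto
  also have "\<dots> \<le> 2 * (cmod z)\<^sup>2 + 2 * (cmod w)\<^sup>2"
    using sum_squares_bound[of "cmod z" "cmod w"] by (simp add: power2_sum)
  finally show ?thesis .
qed

lemma set_integral_cmod_add_power2_le:
  assumes f: "f \<in> borel_measurable borel" "set_integrable lborel A (\<lambda>t. (cmod (f t))\<^sup>2)"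
    and g: "g \<in> borel_measurable borel" "set_integrable lborel A (\<lambda>t. (cmod (g t))\<^sup>2)"
    and A: "A \<in> sets borel"
  shows "(LBINT t:A. (cmod (f t + g t))\<^sup>2) \<le>
    2 * (LBINT t:A. (cmod (f t))\<^sup>2) + 2 * (LBINT t:A. (cmod (g t))\<^sup>2)"
proof -
  note [measurable] = f(1) g(1) A
  have fg: "set_integrable lborel A (\<lambda>t. 2 * (cmod (f t))\<^sup>2 + 2 * (cmod (g t))\<^sup>2)"
    using f(2) g(2) by auto
  have "set_integrable lborel A (\<lambda>t. (cmod (f t + g t))\<^sup>2)"
    by (rule set_integrable_bound[OF fg])
      (auto simp: set_borel_measurable_def cmod_add_power2_le abs_of_nonneg)
  then have "(LBINT t:A. (cmod (f t + g t))\<^sup>2) \<le>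
      (LBINT t:A. 2 * (cmod (f t))\<^sup>2 + 2 * (cmod (g t))\<^sup>2)"
    by (intro set_integral_mono fg cmod_add_power2_le)
  also have "\<dots> = 2 * (LBINT t:A. (cmod (f t))\<^sup>2) + 2 * (LBINT t:A. (cmod (g t))\<^sup>2)"
    using f(2) g(2) by (subst set_integral_add) auto
  finally show ?thesis .
qed

lemma set_integrable_bounded_Icc:
  fixes f :: "real \<Rightarrow> 'a::{banach, second_countable_topology}"
  assumes "f \<in> borel_measurable borel" "\<And>t. t \<in> {l..u} \<Longrightarrow> norm (f t) \<le> B"
  shows "set_integrable lborel {l..u} f"
proof (rule set_integrable_bound)
  show "set_integrable lborel {l..u} (\<lambda>t. B)"
    by (rule borel_integrable_atLeastAtMost') simp
  show "set_borel_measurable lborel {l..u} f"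
    using assms(1) by (simp add: set_borel_measurable_def)
  show "AE t in lborel. t \<in> {l..u} \<longrightarrow> norm (f t) \<le> norm B"
    using assms(2) by (intro AE_I2) fastforce
qed

text \<open>A measurable function is an almost everywhere limit of continuous ones. A bump forces
  the support into the interval, and dominated convergence fixes one index; Stone-Weierstrass then
  replaces the continuous factor by a polynomial, so bump times polynomial is smooth.\<close>

lemma test_functions_dense_bounded:
  fixes k :: "real \<Rightarrow> complex"
  assumes k[measurable]: "k \<in> borel_measurable borel" and N: "\<And>t. cmod (k t) \<le> N"
    and lu: "0 < l" "l < u" and "0 < e"
  obtains \<phi> where "\<phi> \<in> test_functions" "\<And>t. t \<notin> {l..u} \<Longrightarrow> \<phi> t = 0"
    "(LBINT t:{l..u}. (cmod (k t - \<phi> t))\<^sup>2) < e"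
proof -
  have N0: "0 \<le> N" using N[of 0] norm_ge_zero order_trans by blast
  have "k \<in> borel_measurable (lebesgue_on UNIV)"
    using k by (simp add: lebesgue_on_UNIV_eq measurable_completion)
  then have "k measurable_on UNIV"
    by (simp add: measurable_on_iff_borel_measurable)
  then obtain Z g where Z: "negligible Z" and g: "\<And>n. continuous_on UNIV (g n)"
    and lim: "\<And>t. t \<notin> Z \<Longrightarrow> (\<lambda>n. g n t) \<longlonglongrightarrow> k t"
    unfolding measurable_on_def by auto
  \<comment> \<open>Projection onto the ball of radius \<open>N\<close> keeps the limit, since
    \<open>k\<close> has values in that ball, and supplies the uniform bound that the dominated
    convergence needs.\<close>
  define G where "G n t = closest_point (cball 0 N) (g n t)" for n t
  have cp: "continuous_on UNIV (closest_point (cball (0::complex) N))"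
    using N0 by (intro continuous_on_closest_point) auto
  have G: "continuous_on UNIV (G n)" for n
    unfolding G_def using continuous_on_compose2[OF cp g] by auto
  have GN: "cmod (G n t) \<le> N" for n t
    using closest_point_in_set[of "cball (0::complex) N" "g n t"] N0 by (auto simp: G_def)
  have Glim: "(\<lambda>n. G n t) \<longlonglongrightarrow> k t" if "t \<notin> Z" for t
  proof -
    have "(\<lambda>n. closest_point (cball 0 N) (g n t)) \<longlonglongrightarrow> closest_point (cball 0 N) (k t)"
      using continuous_on_tendsto_compose[OF cp lim[OF that]] by auto
    then show ?thesis
      using N by (simp add: G_def closest_point_self)
  qed
  have bm[measurable]: "bump l u n \<in> borel_measurable borel" for n
  proof -
    have "(\<lambda>t. Re (of_real (bump l u n t))) \<in> borel_measurable borel"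
      by (intro borel_measurable_continuous_onI continuous_intros smooth_continuous smooth_bump)
    then show ?thesis by simp
  qed
  have Gm[measurable]: "G n \<in> borel_measurable borel" for n
    by (intro borel_measurable_continuous_onI G)
  define h where "h n t = of_real (bump l u n t) * G n t" for n t
  have hm[measurable]: "h n \<in> borel_measurable borel" for n
    unfolding h_def by measurable
  have hN: "cmod (h n t) \<le> N" for n t
  proof -
    have "cmod (h n t) = bump l u n t * cmod (G n t)"
      by (simp add: h_def norm_mult bump_bounds)
    also have "\<dots> \<le> 1 * N"
      by (intro mult_mono bump_bounds GN) auto
    finally show ?thesis by simp
  qed
  have "(\<lambda>n. LBINT t:{l..u}. (cmod (k t - h n t))\<^sup>2) \<longlonglongrightarrow> (LBINT t:{l..u}. 0)"
    unfolding set_lebesgue_integral_def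
  proof (rule integral_dominated_convergence)
    show "integrable lborel (\<lambda>t. indicator {l..u} t *\<^sub>R (2 * N)\<^sup>2)"
      by (intro borel_integrable_compact) auto
    have "AE t in lborel. t \<noteq> l" "AE t in lborel. t \<noteq> u"
      by (rule AE_lborel_singleton)+
    moreover have "AE t in lborel. t \<notin> Z"
      using AE_not_in[of Z lebesgue] Z by (simp add: negligible_iff_null_sets AE_completion_iff)
    ultimately show "AE t in lborel. (\<lambda>n. indicator {l..u} t *\<^sub>R (cmod (k t - h n t))\<^sup>2)
      \<longlonglongrightarrow> indicator {l..u} t *\<^sub>R 0"
    proof eventually_elim
      case (elim t)
      show ?case
      proof (cases "t \<in> {l..u}")
        case True
        then have "t \<in> {l<..<u}" using elim by auto
        then have "(\<lambda>n. h n t) \<longlonglongrightarrow> of_real 1 * k t"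
          unfolding h_def by (intro tendsto_intros bump_tendsto_1 Glim elim)
        then have "(\<lambda>n. (cmod (k t - h n t))\<^sup>2) \<longlonglongrightarrow> (cmod (k t - of_real 1 * k t))\<^sup>2"
          by (intro tendsto_intros)
        then show ?thesis using True by simp
      qed simp
    qed
    show "AE t in lborel. norm (indicator {l..u} t *\<^sub>R (cmod (k t - h n t))\<^sup>2)
      \<le> indicator {l..u} t *\<^sub>R (2 * N)\<^sup>2" for n
    proof (intro AE_I2)
      fix t
      have "cmod (k t - h n t) \<le> 2 * N"
        unfolding mult_2 by (intro norm_triangle_le_diff add_mono N hN)
      then have "(cmod (k t - h n t))\<^sup>2 \<le> (2 * N)\<^sup>2"
        by (intro power_mono) auto
      then show "norm (indicator {l..u} t *\<^sub>R (cmod (k t - h n t))\<^sup>2)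
        \<le> indicator {l..u} t *\<^sub>R (2 * N)\<^sup>2"
        by (auto simp: indicator_def)
    qed
  qed (auto simp: set_borel_measurable_def)
  \<comment> \<open>Each of the two errors may cost e/4, since the square of a sum is at most twice
    the sum of the squares.\<close>
  then have "eventually (\<lambda>n. (LBINT t:{l..u}. (cmod (k t - h n t))\<^sup>2) < e/4) sequentially"
    using \<open>0 < e\<close> by (intro order_tendstoD) auto
  then obtain n where n: "(LBINT t:{l..u}. (cmod (k t - h n t))\<^sup>2) < e/4"
    by (auto simp: eventually_sequentially)
  define w where "w = u - l"
  have w: "w > 0" using lu by (simp add: w_def)
  \<comment> \<open>The constant d^2 integrates to exactly e/4 over an interval of length
    \<open>w\<close>.\<close>
  define d where "d = sqrt (e / (4 * w))"
  have d: "d > 0" "d\<^sup>2 * w = e / 4"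
    using w \<open>0 < e\<close> by (auto simp: d_def)
  obtain p where p: "polynomial_function p" "\<And>t. t \<in> {l..u} \<Longrightarrow> cmod (G n t - p t) < d"
    using Stone_Weierstrass_polynomial_function[of "{l..u}" "G n" d] d(1)
      continuous_on_subset[OF G subset_UNIV] by auto
  define \<phi> where "\<phi> t = of_real (bump l u n t) * p t" for t
  have sm: "smooth \<phi>"
    unfolding \<phi>_def by (intro smooth_mult smooth_bump smooth_polynomial_function p)
  have \<phi>0: "\<phi> t = 0" if "t \<notin> {l..u}" for t
    using that bump_eq_0[of t l u n] by (auto simp: \<phi>_def)
  have \<phi>t: "\<phi> \<in> test_functions"
    by (rule test_functionI[OF sm lu(1) \<phi>0])
  have \<phi>m[measurable]: "\<phi> \<in> borel_measurable borel"
    by (intro borel_measurable_continuous_onI smooth_continuous sm)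
  have h\<phi>: "cmod (h n t - \<phi> t) \<le> d" if "t \<in> {l..u}" for t
  proof -
    have "cmod (h n t - \<phi> t) = bump l u n t * cmod (G n t - p t)"
      by (simp add: h_def \<phi>_def norm_mult bump_bounds flip: right_diff_distrib)
    also have "\<dots> \<le> 1 * d"
      using p(2)[OF that] by (intro mult_mono bump_bounds) auto
    finally show ?thesis by simp
  qed
  have i1: "set_integrable lborel {l..u} (\<lambda>t. (cmod (k t - h n t))\<^sup>2)"
  proof (rule set_integrable_bounded_Icc)
    fix t
    have "cmod (k t - h n t) \<le> N + N"
      by (intro norm_triangle_le_diff add_mono N hN)
    from power_mono[OF this, of 2] show "norm ((cmod (k t - h n t))\<^sup>2) \<le> (N + N)\<^sup>2"
      by simp
  qed auto
  have i2: "set_integrable lborel {l..u} (\<lambda>t. (cmod (h n t - \<phi> t))\<^sup>2)"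
    by (rule set_integrable_bounded_Icc[where B = "d\<^sup>2"]) (auto intro!: power_mono h\<phi>)
  have "(LBINT t:{l..u}. (cmod (h n t - \<phi> t))\<^sup>2) \<le> (LBINT t:{l..u}. d\<^sup>2)"
    by (intro set_integral_mono i2 borel_integrable_atLeastAtMost' power_mono h\<phi>) auto
  also have "\<dots> = e / 4"
    using lu d(2)[unfolded w_def] by (simp add: set_lebesgue_integral_def mult.commute)
  finally have h\<phi>_le: "(LBINT t:{l..u}. (cmod (h n t - \<phi> t))\<^sup>2) \<le> e / 4" .
  have "(LBINT t:{l..u}. (cmod ((k t - h n t) + (h n t - \<phi> t)))\<^sup>2) \<le>
    2 * (LBINT t:{l..u}. (cmod (k t - h n t))\<^sup>2) + 2 * (LBINT t:{l..u}. (cmod (h n t - \<phi> t))\<^sup>2)"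
    by (intro set_integral_cmod_add_power2_le i1 i2) auto
  also have "\<dots> < e" using n h\<phi>_le by linarith
  finally show ?thesis using that[OF \<phi>t \<phi>0] by simp
qed

text \<open>Replacing \<open>k\<close> by 0 where it exceeds n in modulus reduces the claim to
  bounded functions; the error is at most |k|, so |k|^2 dominates its square.\<close>

lemma test_functions_dense_Icc:
  fixes k :: "real \<Rightarrow> complex"
  assumes k[measurable]: "k \<in> borel_measurable borel"
    and int: "set_integrable lborel {l..u} (\<lambda>t. (cmod (k t))\<^sup>2)"
    and lu: "0 < l" "l < u" and "0 < e"
  obtains \<phi> where "\<phi> \<in> test_functions" "\<And>t. t \<notin> {l..u} \<Longrightarrow> \<phi> t = 0"
    "(LBINT t:{l..u}. (cmod (k t - \<phi> t))\<^sup>2) < e"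
proof -
  define K where "K n t = (if cmod (k t) \<le> real n then k t else 0)" for n t
  have Km[measurable]: "K n \<in> borel_measurable borel" for n
    unfolding K_def by measurable
  have "(\<lambda>n. LBINT t:{l..u}. (cmod (k t - K n t))\<^sup>2) \<longlonglongrightarrow> (LBINT t:{l..u}. 0)"
    unfolding set_lebesgue_integral_def
  proof (rule integral_dominated_convergence)
    show "integrable lborel (\<lambda>t. indicator {l..u} t *\<^sub>R (cmod (k t))\<^sup>2)"
      using int by (simp add: set_integrable_def)
    show "AE t in lborel. (\<lambda>n. indicator {l..u} t *\<^sub>R (cmod (k t - K n t))\<^sup>2)
      \<longlonglongrightarrow> indicator {l..u} t *\<^sub>R 0"
    proof (intro AE_I2)
      fix t
      obtain n where "cmod (k t) \<le> real n" using real_arch_simple by blast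
      then have "eventually (\<lambda>n. indicator {l..u} t *\<^sub>R 0 =
          indicator {l..u} t *\<^sub>R (cmod (k t - K n t))\<^sup>2) sequentially"
        by (auto simp: K_def eventually_sequentially intro!: exI[of _ n])
      then show "(\<lambda>n. indicator {l..u} t *\<^sub>R (cmod (k t - K n t))\<^sup>2) \<longlonglongrightarrow> indicator {l..u} t *\<^sub>R 0"
        by (rule Lim_transform_eventually[OF tendsto_const])
    qed
    show "AE t in lborel. norm (indicator {l..u} t *\<^sub>R (cmod (k t - K n t))\<^sup>2)
      \<le> indicator {l..u} t *\<^sub>R (cmod (k t))\<^sup>2" for n
      by (intro AE_I2) (auto simp: K_def indicator_def)
  qed auto
  then have "eventually (\<lambda>n. (LBINT t:{l..u}. (cmod (k t - K n t))\<^sup>2) < e/4) sequentially"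
    using \<open>0 < e\<close> by (intro order_tendstoD) auto
  then obtain n where n: "(LBINT t:{l..u}. (cmod (k t - K n t))\<^sup>2) < e/4"
    by (auto simp: eventually_sequentially)
  have Kn: "cmod (K n t) \<le> real n" for t by (simp add: K_def)
  obtain \<phi> where \<phi>: "\<phi> \<in> test_functions" "\<And>t. t \<notin> {l..u} \<Longrightarrow> \<phi> t = 0"
    and \<phi>n: "(LBINT t:{l..u}. (cmod (K n t - \<phi> t))\<^sup>2) < e/4"
    using test_functions_dense_bounded[OF Km Kn lu, of "e/4"] \<open>0 < e\<close>
    by (metis zero_less_divide_iff zero_less_numeral)
  have \<phi>c: "continuous_on A \<phi>" for A
    by (intro smooth_continuous test_functions_smooth \<phi>)
  have \<phi>m[measurable]: "\<phi> \<in> borel_measurable borel"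
    by (intro borel_measurable_continuous_onI \<phi>c)
  have i1: "set_integrable lborel {l..u} (\<lambda>t. (cmod (k t - K n t))\<^sup>2)"
    by (rule set_integrable_bound[OF int]) (auto simp: set_borel_measurable_def K_def)
  obtain B where B: "\<And>t. t \<in> {l..u} \<Longrightarrow> cmod (\<phi> t) \<le> B"
    using continuous_on_Icc_bounded[OF \<phi>c] by blast
  have i2: "set_integrable lborel {l..u} (\<lambda>t. (cmod (K n t - \<phi> t))\<^sup>2)"
  proof (rule set_integrable_bounded_Icc)
    fix t assume "t \<in> {l..u}"
    then have "cmod (K n t - \<phi> t) \<le> real n + B"
      by (intro norm_triangle_le_diff add_mono Kn B)
    then show "norm ((cmod (K n t - \<phi> t))\<^sup>2) \<le> (real n + B)\<^sup>2"
      by (auto intro: power_mono)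
  qed auto
  have "(LBINT t:{l..u}. (cmod ((k t - K n t) + (K n t - \<phi> t)))\<^sup>2) \<le>
    2 * (LBINT t:{l..u}. (cmod (k t - K n t))\<^sup>2) + 2 * (LBINT t:{l..u}. (cmod (K n t - \<phi> t))\<^sup>2)"
    by (intro set_integral_cmod_add_power2_le i1 i2) auto
  also have "\<dots> < e" using n \<phi>n by linarith
  finally show ?thesis using that[OF \<phi>] by simp
qed

text \<open>A locally square integrable \<open>k\<close> suffices here, since approximating \<open>k\<close> itself on an interval
  turns the orthogonality into \<open>\<parallel>k\<parallel>\<^sup>2 \<le> \<parallel>k - \<phi>\<parallel>\<^sup>2\<close>.\<close>

lemma AE_zero_if_orthogonal_test_functions:
  fixes k :: "real \<Rightarrow> complex"
  assumes k[measurable]: "k \<in> borel_measurable borel"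
    and int: "\<And>l u. 0 < l \<Longrightarrow> l < u \<Longrightarrow> set_integrable lborel {l..u} (\<lambda>t. (cmod (k t))\<^sup>2)"
    and orth: "\<And>\<phi>. \<phi> \<in> test_functions \<Longrightarrow> (LINT t|lborel. k t * \<phi> t) = 0"
  shows "AE t in lborel. 0 < t \<longrightarrow> k t = 0"
proof -
  have Icc: "(LBINT t:{l..u}. (cmod (k t))\<^sup>2) = 0" if lu: "0 < l" "l < u" for l u
  proof -
    have le: "(LBINT t:{l..u}. (cmod (k t))\<^sup>2) < e" if "e > 0" for e
    proof -
      \<comment> \<open>The hypothesis integrates \<open>k * \<phi>\<close> without a conjugate, so
        the function orthogonal to the test functions in L2, and hence the one to approximate, is
        the conjugate of \<open>k\<close>.\<close>
      have ckm: "(\<lambda>t. cnj (k t)) \<in> borel_measurable borel"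
        by (rule borel_measurable_cnj[OF k])
      have icnj: "set_integrable lborel {l..u} (\<lambda>t. (cmod (cnj (k t)))\<^sup>2)"
        using int[OF lu] by simp
      obtain \<phi> where \<phi>: "\<phi> \<in> test_functions" "\<And>t. t \<notin> {l..u} \<Longrightarrow> \<phi> t = 0"
        and \<phi>e: "(LBINT t:{l..u}. (cmod (cnj (k t) - \<phi> t))\<^sup>2) < e"
        using test_functions_dense_Icc[OF ckm icnj lu \<open>e > 0\<close>] by metis
      have \<phi>c: "continuous_on A \<phi>" for A
        by (intro smooth_continuous test_functions_smooth \<phi>)
      have \<phi>m[measurable]: "\<phi> \<in> borel_measurable borel"
        by (intro borel_measurable_continuous_onI \<phi>c)
      have i\<phi>: "set_integrable lborel {l..u} (\<lambda>t. (cmod (\<phi> t))\<^sup>2)"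
        by (intro borel_integrable_atLeastAtMost' continuous_intros \<phi>c)
      have ik\<phi>: "set_integrable lborel {l..u} (\<lambda>t. k t * \<phi> t)"
      proof (rule set_integrable_bound)
        show "set_integrable lborel {l..u} (\<lambda>t. (cmod (k t))\<^sup>2 + (cmod (\<phi> t))\<^sup>2)"
          using int[OF lu] i\<phi> by auto
        show "AE t in lborel. t \<in> {l..u} \<longrightarrow>
          norm (k t * \<phi> t) \<le> norm ((cmod (k t))\<^sup>2 + (cmod (\<phi> t))\<^sup>2)"
        proof (intro AE_I2 impI)
          fix t
          have "2 * (cmod (k t) * cmod (\<phi> t)) \<le> (cmod (k t))\<^sup>2 + (cmod (\<phi> t))\<^sup>2"
            using sum_squares_bound[of "cmod (k t)" "cmod (\<phi> t)"] by simp
          moreover have "0 \<le> cmod (k t) * cmod (\<phi> t)" by simp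
          ultimately have "cmod (k t) * cmod (\<phi> t) \<le> (cmod (k t))\<^sup>2 + (cmod (\<phi> t))\<^sup>2"
            by linarith
          then show "norm (k t * \<phi> t) \<le> norm ((cmod (k t))\<^sup>2 + (cmod (\<phi> t))\<^sup>2)"
            by (simp add: norm_mult)
        qed
      qed (simp add: set_borel_measurable_def)
      have z: "(LBINT t:{l..u}. k t * \<phi> t) = 0"
      proof -
        have "(\<lambda>t. indicator {l..u} t *\<^sub>R (k t * \<phi> t)) = (\<lambda>t. k t * \<phi> t)"
          using \<phi>(2) by (auto simp: indicator_def)
        then show ?thesis using orth[OF \<phi>(1)] by (simp add: set_lebesgue_integral_def)
      qed
      have expand: "(cmod (cnj (k t) - \<phi> t))\<^sup>2 =
          ((cmod (k t))\<^sup>2 + (cmod (\<phi> t))\<^sup>2) - 2 * Re (k t * \<phi> t)" for t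
        unfolding cmod_power2 by (simp add: power2_eq_square algebra_simps)
      have iRe: "set_integrable lborel {l..u} (\<lambda>t. Re (k t * \<phi> t))"
        using ik\<phi> integrable_Re[of lborel "\<lambda>t. indicator {l..u} t *\<^sub>R (k t * \<phi> t)"]
        by (simp add: set_integrable_def)
      have "(LBINT t:{l..u}. Re (k t * \<phi> t)) = Re (LBINT t:{l..u}. k t * \<phi> t)"
        using ik\<phi> integral_Re[of lborel "\<lambda>t. indicator {l..u} t *\<^sub>R (k t * \<phi> t)"]
        by (simp add: set_integrable_def set_lebesgue_integral_def)
      also have "\<dots> = 0"
        unfolding z by (rule zero_complex.sel)
      finally have Re0: "(LBINT t:{l..u}. 2 * Re (k t * \<phi> t)) = 0"
        using set_integral_mult_right[of lborel "{l..u}" 2 "\<lambda>t. Re (k t * \<phi> t)"] by linarith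
      have "(LBINT t:{l..u}. (cmod (cnj (k t) - \<phi> t))\<^sup>2) =
          (LBINT t:{l..u}. (cmod (k t))\<^sup>2 + (cmod (\<phi> t))\<^sup>2) - (LBINT t:{l..u}. 2 * Re (k t * \<phi> t))"
        unfolding expand
        by (rule set_integral_diff(2)[OF set_integral_add(1)[OF int[OF lu] i\<phi>]
              set_integrable_mult_right[OF iRe]])
      also have "\<dots> = (LBINT t:{l..u}. (cmod (k t))\<^sup>2) + (LBINT t:{l..u}. (cmod (\<phi> t))\<^sup>2)"
        unfolding Re0 by (simp only: set_integral_add(2)[OF int[OF lu] i\<phi>] diff_zero)
      finally have "(LBINT t:{l..u}. (cmod (cnj (k t) - \<phi> t))\<^sup>2) =
          (LBINT t:{l..u}. (cmod (k t))\<^sup>2) + (LBINT t:{l..u}. (cmod (\<phi> t))\<^sup>2)" .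
      moreover have "0 \<le> (LBINT t:{l..u}. (cmod (\<phi> t))\<^sup>2)"
        by (auto simp: set_lebesgue_integral_def)
      ultimately show ?thesis using \<phi>e by linarith
    qed
    have "0 \<le> (LBINT t:{l..u}. (cmod (k t))\<^sup>2)"
      by (auto simp: set_lebesgue_integral_def)
    then show ?thesis using le[of "LBINT t:{l..u}. (cmod (k t))\<^sup>2"] by linarith
  qed
  \<comment> \<open>Countably many intervals exhaust the half-line; n + 2 rather than n + 1 keeps
    the left endpoint strictly below the right one even for n = 0.\<close>
  have "AE t in lborel. t \<in> {1 / real (n + 2)..real (n + 2)} \<longrightarrow> k t = 0" for n
  proof -
    let ?l = "1 / real (n + 2)" and ?u = "real (n + 2)"
    have "?l \<le> 1" by simp
    moreover have "1 < ?u" by simp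
    ultimately have lu: "0 < ?l" "?l < ?u" by (simp, linarith)
    have "AE t in lborel. indicator {?l..?u} t *\<^sub>R (cmod (k t))\<^sup>2 = 0"
      using Icc[OF lu] int[OF lu] unfolding set_integrable_def set_lebesgue_integral_def
      by (subst (asm) integral_nonneg_eq_0_iff_AE) auto
    then show ?thesis by eventually_elim (auto simp: indicator_def)
  qed
  then have "AE t in lborel. \<forall>n. t \<in> {1 / real (n + 2)..real (n + 2)} \<longrightarrow> k t = 0"
    unfolding AE_all_countable by blast
  then show ?thesis
  proof eventually_elim
    case (elim t)
    show ?case
    proof
      assume t: "0 < t"
      obtain n where n: "max t (1 / t) \<le> real n" using real_arch_simple by blast
      then have "1 / t \<le> real (n + 2)" by simp
      then have "1 / real (n + 2) \<le> t"
        using t by (simp add: divide_le_eq mult.commute)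
      moreover have "t \<le> real (n + 2)" using n by auto
      ultimately show "k t = 0" using elim by auto
    qed
  qed
qed


section \<open>Locally absolutely continuous functions\<close>

text \<open>Local absolute continuity on (0, \<infinity>), encoded by its integral formula on
  compact intervals. The density matters only up to null sets, and no pointwise derivative of
  \<open>F\<close> ever has to be produced.\<close>

definition ac_deriv :: "(real \<Rightarrow> complex) \<Rightarrow> (real \<Rightarrow> complex) \<Rightarrow> bool" where
  "ac_deriv F f \<longleftrightarrow> (\<forall>s t. 0 < s \<longrightarrow> s \<le> t \<longrightarrow>
    set_integrable lborel {s..t} f \<and> F t - F s = (LBINT r:{s..t}. f r))"

lemma ac_derivD:
  assumes "ac_deriv F f" "0 < s" "s \<le> t"
  shows "set_integrable lborel {s..t} f" "F t - F s = (LBINT r:{s..t}. f r)"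
    "F t = F s + (LBINT r:{s..t}. f r)"
proof -
  show "set_integrable lborel {s..t} f" and *: "F t - F s = (LBINT r:{s..t}. f r)"
    using assms unfolding ac_deriv_def by blast+
  show "F t = F s + (LBINT r:{s..t}. f r)"
    using * by (simp add: diff_eq_eq add.commute)
qed

lemma ac_deriv_cong:
  assumes "ac_deriv F f" "\<And>t. 0 < t \<Longrightarrow> F t = G t" "\<And>t. 0 < t \<Longrightarrow> f t = g t"
  shows "ac_deriv G g"
  unfolding ac_deriv_def
proof (intro allI impI conjI)
  fix s t :: real assume st: "0 < s" "s \<le> t"
  show "set_integrable lborel {s..t} g"
  proof -
    have "(\<lambda>r. indicator {s..t} r *\<^sub>R f r) = (\<lambda>r. indicator {s..t} r *\<^sub>R g r)"
      using st(1) assms(3) by (auto simp: indicator_def)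
    then show ?thesis
      using ac_derivD(1)[OF assms(1) st] by (simp add: set_integrable_def)
  qed
  have "(LBINT r:{s..t}. f r) = (LBINT r:{s..t}. g r)"
    by (rule set_lebesgue_integral_cong) (use st assms(3) in auto)
  then show "G t - G s = (LBINT r:{s..t}. g r)"
    using ac_derivD(2)[OF assms(1) st] assms(2) st by auto
qed

lemma ac_deriv_continuous:
  assumes "ac_deriv F f"
  shows "continuous_on {0<..} F"
proof (rule continuous_at_imp_continuous_on, rule ballI)
  fix x :: real assume "x \<in> {0<..}"
  then have x: "0 < x" by simp
  have int: "f integrable_on {x/2..2*x}"
    using set_borel_integral_eq_integral(1)[OF ac_derivD(1)[OF assms]] x by auto
  have "continuous_on {x/2..2*x} (\<lambda>t. F (x/2) + integral {x/2..t} f)"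
    by (intro continuous_intros indefinite_integral_continuous_1 int)
  moreover have "F (x/2) + integral {x/2..t} f = F t" if "t \<in> {x/2..2*x}" for t
    using ac_derivD(3)[OF assms, of "x/2" t]
      set_borel_integral_eq_integral(2)[OF ac_derivD(1)[OF assms, of "x/2" t]] x that by auto
  ultimately have "continuous_on {x/2..2*x} F"
    by (rule continuous_on_eq)
  then show "isCont F x"
    by (rule continuous_on_interior) (use x in auto)
qed

lemma ac_deriv_C1:
  assumes "\<And>t. 0 < t \<Longrightarrow> (F has_vector_derivative f t) (at t)" "continuous_on {0<..} f"
  shows "ac_deriv F f"
  unfolding ac_deriv_def
proof (intro allI impI conjI)
  fix s t :: real assume st: "0 < s" "s \<le> t"
  have c: "continuous_on {s..t} f"
    by (rule continuous_on_subset[OF assms(2)]) (use st in auto)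
  then show "set_integrable lborel {s..t} f"
    by (rule borel_integrable_atLeastAtMost')
  show "F t - F s = (LBINT r:{s..t}. f r)"
    unfolding set_lebesgue_integral_def
  proof (rule integral_FTC_Icc[symmetric, OF st(2) _ c])
    fix x assume "s \<le> x" "x \<le> t"
    then have "0 < x" using st by linarith
    then show "(F has_vector_derivative f x) (at x within {s..t})"
      by (rule has_vector_derivative_at_within[OF assms(1)])
  qed
qed

lemma ac_deriv_powr: "ac_deriv (\<lambda>t. of_real (t powr \<alpha>)) (\<lambda>t. of_real (\<alpha> * t powr (\<alpha> - 1)))"
proof (rule ac_deriv_C1)
  show "((\<lambda>t. complex_of_real (t powr \<alpha>)) has_vector_derivative of_real (\<alpha> * t powr (\<alpha> - 1))) (at t)"
    if "0 < t" for t
    using that by (intro has_vector_derivative_of_real) (auto intro!: derivative_eq_intros)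
  show "continuous_on {0<..} (\<lambda>t. complex_of_real (\<alpha> * t powr (\<alpha> - 1)))"
    by (intro continuous_intros) auto
qed

lemma ac_deriv_add:
  assumes "ac_deriv F f" "ac_deriv G g"
  shows "ac_deriv (\<lambda>t. F t + G t) (\<lambda>t. f t + g t)"
  unfolding ac_deriv_def
proof (intro allI impI)
  fix s t :: real assume st: "0 < s" "s \<le> t"
  note D = ac_derivD(1,2)[OF assms(1) st] ac_derivD(1,2)[OF assms(2) st]
  show "set_integrable lborel {s..t} (\<lambda>r. f r + g r) \<and>
      F t + G t - (F s + G s) = (LBINT r:{s..t}. f r + g r)"
    using D(1,3) by (simp add: set_integral_add add_diff_add flip: D(2,4))
qed

lemma ac_deriv_cmult:
  assumes "ac_deriv F f"
  shows "ac_deriv (\<lambda>t. k * F t) (\<lambda>t. k * f t)"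
  unfolding ac_deriv_def
proof (intro allI impI)
  fix s t :: real assume st: "0 < s" "s \<le> t"
  note D = ac_derivD(1,2)[OF assms(1) st]
  show "set_integrable lborel {s..t} (\<lambda>r. k * f r) \<and> k * F t - k * F s = (LBINT r:{s..t}. k * f r)"
    using D(1) by (simp add: right_diff_distrib flip: D(2))
qed

lemma ac_deriv_diff:
  assumes "ac_deriv F f" "ac_deriv G g"
  shows "ac_deriv (\<lambda>t. F t - G t) (\<lambda>t. f t - g t)"
  using ac_deriv_add[OF assms(1) ac_deriv_cmult[OF assms(2), of "-1"]] by simp

lemma ac_deriv_const: "ac_deriv (\<lambda>t. k) (\<lambda>t. 0)"
  by (simp add: ac_deriv_def set_integrable_def)

lemma ac_deriv_cnj:
  assumes "ac_deriv F f"
  shows "ac_deriv (\<lambda>t. cnj (F t)) (\<lambda>t. cnj (f t))"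
  unfolding ac_deriv_def
proof (intro allI impI)
  fix s t :: real assume st: "0 < s" "s \<le> t"
  have eq: "(\<lambda>r. indicator {s..t} r *\<^sub>R cnj (f r)) = (\<lambda>r. cnj (indicator {s..t} r *\<^sub>R f r))"
    by auto
  show "set_integrable lborel {s..t} (\<lambda>r. cnj (f r)) \<and>
      cnj (F t) - cnj (F s) = (LBINT r:{s..t}. cnj (f r))"
    using ac_derivD(1,2)[OF assms st]
    unfolding set_integrable_def set_lebesgue_integral_def eq
    by (simp del: complex_cnj_scaleR complex_cnj_diff flip: complex_cnj_diff)
qed

text \<open>Integration by parts, by Fubini on the two triangles of \<open>{s..t} \<times> {s..t}\<close>.\<close>

lemma ac_deriv_mult:
  assumes F: "ac_deriv F f" and G: "ac_deriv G g"
  shows "ac_deriv (\<lambda>t. F t * G t) (\<lambda>t. F t * g t + f t * G t)"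
  unfolding ac_deriv_def
proof (intro allI impI)
  fix s t :: real assume st: "0 < s" "s \<le> t"
  define f' where "f' = (\<lambda>q. indicator {s..t} q *\<^sub>R f q)"
  define g' where "g' = (\<lambda>r. indicator {s..t} r *\<^sub>R g r)"
  have f': "integrable lborel f'" and g': "integrable lborel g'"
    using ac_derivD(1)[OF F st] ac_derivD(1)[OF G st] by (auto simp: set_integrable_def f'_def g'_def)
  note [measurable] = borel_measurable_integrable[OF f'] borel_measurable_integrable[OF g']
  have Ir: "integral\<^sup>L lborel f' = F t - F s" "integral\<^sup>L lborel g' = G t - G s"
    using ac_derivD(2)[OF F st] ac_derivD(2)[OF G st]
    by (simp_all add: set_lebesgue_integral_def f'_def g'_def)
  have Fr: "F r = F s + (LINT q|lborel. indicator {..r} q *\<^sub>R f' q)" if "r \<in> {s..t}" for r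
  proof -
    have "(\<lambda>q. indicator {..r} q *\<^sub>R f' q) = (\<lambda>q. indicator {s..r} q *\<^sub>R f q)"
      using that by (auto simp: f'_def indicator_def)
    then show ?thesis
      using ac_derivD(3)[OF F, of s r] st that by (simp add: set_lebesgue_integral_def)
  qed
  have Gq: "G q = G s + (LINT r|lborel. indicator {..<q} r *\<^sub>R g' r)" if "q \<in> {s..t}" for q
  proof -
    have "(LINT r|lborel. indicator {..<q} r *\<^sub>R g' r) = (LINT r|lborel. indicator {s..q} r *\<^sub>R g r)"
    proof (rule integral_cong_AE)
      show "AE r in lborel. indicator {..<q} r *\<^sub>R g' r = indicator {s..q} r *\<^sub>R g r"
        using AE_lborel_singleton[of q] by eventually_elim (use that in \<open>auto simp: g'_def indicator_def\<close>)
      show "(\<lambda>r. indicator {s..q} r *\<^sub>R g r) \<in> borel_measurable lborel"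
        using ac_derivD(1)[OF G, of s q] st that
        by (auto simp: set_integrable_def dest: borel_measurable_integrable)
    qed measurable
    then show ?thesis
      using ac_derivD(3)[OF G, of s q] st that by (simp add: set_lebesgue_integral_def)
  qed
  define H where "H = (\<lambda>q r. f' q * g' r)"
  have H: "integrable (lborel \<Otimes>\<^sub>M lborel) (case_prod H)"
  proof (rule lborel_pair.Fubini_integrable)
    show "case_prod H \<in> borel_measurable (lborel \<Otimes>\<^sub>M lborel)"
      unfolding H_def by measurable
    have "(\<lambda>q. LINT r|lborel. norm (case_prod H (q, r))) = (\<lambda>q. norm (f' q) * (LINT r|lborel. norm (g' r)))"
      by (simp add: H_def norm_mult)
    then show "integrable lborel (\<lambda>q. LINT r|lborel. norm (case_prod H (q, r)))"
      using f' by simp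
    show "AE q in lborel. integrable lborel (\<lambda>r. case_prod H (q, r))"
      using g' by (simp add: H_def)
  qed
  \<comment> \<open>\<open>H1\<close> keeps the triangle q \<le> r and \<open>H2\<close> the
    triangle r < q, so the diagonal is counted once and \<open>H1\<close> and \<open>H2\<close> add
    up to \<open>H\<close> everywhere.\<close>
  define H1 where "H1 = (\<lambda>q r. indicator {..r} q *\<^sub>R H q r)"
  define H2 where "H2 = (\<lambda>q r. indicator {..<q} r *\<^sub>R H q r)"
  have H1: "integrable (lborel \<Otimes>\<^sub>M lborel) (case_prod H1)"
  proof (rule Bochner_Integration.integrable_bound[OF H])
    have "case_prod H1 = (\<lambda>p. if fst p \<le> snd p then f' (fst p) * g' (snd p) else 0)"
      by (auto simp: H1_def H_def indicator_def)
    also have "\<dots> \<in> borel_measurable (lborel \<Otimes>\<^sub>M lborel)"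
      by measurable
    finally show "case_prod H1 \<in> borel_measurable (lborel \<Otimes>\<^sub>M lborel)" .
  qed (auto simp: H1_def indicator_def)
  have H2eq: "case_prod H2 = (\<lambda>p. case_prod H p - case_prod H1 p)"
    by (auto simp: H1_def H2_def indicator_def)
  have H2: "integrable (lborel \<Otimes>\<^sub>M lborel) (case_prod H2)"
    unfolding H2eq by (rule Bochner_Integration.integrable_diff[OF H H1])
  have H2': "integral\<^sup>L (lborel \<Otimes>\<^sub>M lborel) (case_prod H2) =
      integral\<^sup>L (lborel \<Otimes>\<^sub>M lborel) (case_prod H) - integral\<^sup>L (lborel \<Otimes>\<^sub>M lborel) (case_prod H1)"
    unfolding H2eq by (rule Bochner_Integration.integral_diff[OF H H1])
  have HI: "integral\<^sup>L (lborel \<Otimes>\<^sub>M lborel) (case_prod H) = (F t - F s) * (G t - G s)"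
    using lborel_pair.integral_fst[OF H] by (simp add: H_def Ir)
  have i1: "integrable lborel (\<lambda>r. LINT q|lborel. H1 q r)"
    by (rule lborel_pair.integrable_snd[OF H1])
  have i2: "integrable lborel (\<lambda>q. LINT r|lborel. H2 q r)"
    by (rule lborel_pair.integrable_fst[OF H2])
  have e1: "indicator {s..t} r *\<^sub>R (F r * g r) = F s * g' r + (LINT q|lborel. H1 q r)" for r
  proof -
    have "(LINT q|lborel. H1 q r) = (LINT q|lborel. (indicator {..r} q *\<^sub>R f' q) * g' r)"
      by (simp add: H1_def H_def)
    also have "\<dots> = (LINT q|lborel. indicator {..r} q *\<^sub>R f' q) * g' r"
      by (rule integral_mult_left_zero)
    finally show ?thesis
      using Fr[of r] by (auto simp: g'_def indicator_def algebra_simps)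
  qed
  have e2: "indicator {s..t} q *\<^sub>R (f q * G q) = f' q * G s + (LINT r|lborel. H2 q r)" for q
  proof -
    have "(LINT r|lborel. H2 q r) = (LINT r|lborel. f' q * (indicator {..<q} r *\<^sub>R g' r))"
      by (simp add: H2_def H_def)
    also have "\<dots> = f' q * (LINT r|lborel. indicator {..<q} r *\<^sub>R g' r)"
      by (rule integral_mult_right_zero)
    finally show ?thesis
      using Gq[of q] by (auto simp: f'_def indicator_def algebra_simps)
  qed
  have s1: "set_integrable lborel {s..t} (\<lambda>r. F r * g r)"
    unfolding set_integrable_def e1 using i1 g' by auto
  have s2: "set_integrable lborel {s..t} (\<lambda>q. f q * G q)"
    unfolding set_integrable_def e2 using i2 f' by auto
  have v1: "(LBINT r:{s..t}. F r * g r) = F s * (G t - G s) + integral\<^sup>L (lborel \<Otimes>\<^sub>M lborel) (case_prod H1)"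
    unfolding set_lebesgue_integral_def e1 using i1 g' lborel_pair.integral_snd[OF H1] by (simp add: Ir)
  have v2: "(LBINT q:{s..t}. f q * G q) = (F t - F s) * G s + integral\<^sup>L (lborel \<Otimes>\<^sub>M lborel) (case_prod H2)"
    unfolding set_lebesgue_integral_def e2 using i2 f' lborel_pair.integral_fst[OF H2] by (simp add: Ir)
  show "set_integrable lborel {s..t} (\<lambda>r. F r * g r + f r * G r) \<and>
      F t * G t - F s * G s = (LBINT r:{s..t}. F r * g r + f r * G r)"
    \<comment> \<open>The two triangles together contribute (F t - F s) (G t - G s); with the terms
      in F s and G s this is F t G t - F s G s.\<close>
    unfolding set_integral_add(2)[OF s1 s2] v1 v2 H2' HI
    using set_integral_add(1)[OF s1 s2] by (simp add: algebra_simps)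
qed

text \<open>The primitive is based at 1 because \<open>f\<close> may fail to be integrable at the
  origin; the two branches express the oriented integral.\<close>

lemma ac_deriv_exists:
  assumes "\<And>s t. 0 < s \<Longrightarrow> s \<le> t \<Longrightarrow> set_integrable lborel {s..t} f"
  obtains F where "ac_deriv F f"
proof
  let ?I = "\<lambda>s t. LBINT r:{s..t}. f r"
  define F where "F t = (if 1 \<le> t then ?I 1 t else - ?I t 1)" for t :: real
  have split: "?I s t + ?I t u = ?I s u" if "0 < s" "s \<le> t" "t \<le> u" for s t u
  proof -
    have "?I s t + ?I t u = (LBINT r:{s..t} \<union> {t..u}. f r)"
      using that assms AE_lborel_singleton[of t]
      by (intro set_integral_Un_AE[symmetric]) auto
    then show ?thesis using that by (simp add: ivl_disj_un_two_touch(4))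
  qed
  show "ac_deriv F f"
    unfolding ac_deriv_def
  proof (intro allI impI conjI)
    fix s t :: real assume st: "0 < s" "s \<le> t"
    show "set_integrable lborel {s..t} f" by (rule assms[OF st])
    consider "1 \<le> s" | "s < 1" "1 \<le> t" | "t < 1" by linarith
    then show "F t - F s = ?I s t"
    proof cases
      case 1
      then show ?thesis using split[of 1 s t] st by (simp add: F_def algebra_simps)
    next
      case 2
      then show ?thesis using split[of s 1 t] st by (simp add: F_def add.commute)
    next
      case 3
      then show ?thesis using split[of s t 1] st by (simp add: F_def algebra_simps)
    qed
  qed
qed


section \<open>The Wronskian of two solutions\<close>

text \<open>A first-order system in \<open>U\<close> and the quasi-derivative P = t^c U': both
  components are absolutely continuous even if \<open>v\<close> is only locally integrable, so no
  second derivative of \<open>U\<close> is taken.\<close>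

definition leaf_sol :: "real \<Rightarrow> (real \<Rightarrow> complex) \<Rightarrow> (real \<Rightarrow> complex) \<Rightarrow> (real \<Rightarrow> complex) \<Rightarrow> bool"
  where "leaf_sol c U P v \<longleftrightarrow>
    ac_deriv U (\<lambda>t. of_real (t powr (- c)) * P t) \<and> ac_deriv P (\<lambda>t. of_real (t powr c) * v t)"

text \<open>Primes mark a second pair of functions, not derivatives. The conjugates make the
  expression sesquilinear, as \<open>l2_inner\<close> is.\<close>

definition wronskian where
  "wronskian U P U' P' t = U t * cnj (P' t) - P t * cnj (U' t)" for U :: "real \<Rightarrow> complex"

text \<open>Membership in the L2 space of \<open>leaf_measure lam\<close> for c = 1 / lam, rewritten
  over Lebesgue measure. The indicator in the measurability clause reflects that this measure lives
  on the open half-line.\<close>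

definition weighted_l2 :: "real \<Rightarrow> (real \<Rightarrow> complex) \<Rightarrow> bool" where
  "weighted_l2 c f \<longleftrightarrow> (\<lambda>t. indicator {0<..} t *\<^sub>R f t) \<in> borel_measurable borel \<and>
    set_integrable lborel {0<..} (\<lambda>t. t powr c * (cmod (f t))\<^sup>2)"

text \<open>Lagrange's identity: the product rule yields t^(-c) P cnj P' twice with opposite signs,
  so only the terms with \<open>v\<close> and v' survive.\<close>

lemma leaf_sol_wronskian:
  assumes "leaf_sol c U P v" "leaf_sol c U' P' v'"
  shows "ac_deriv (wronskian U P U' P')
    (\<lambda>t. of_real (t powr c) * (U t * cnj (v' t) - v t * cnj (U' t)))"
proof -
  note A = assms[unfolded leaf_sol_def]
  have "ac_deriv (\<lambda>t. U t * cnj (P' t) - P t * cnj (U' t))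
    (\<lambda>t. (U t * cnj (of_real (t powr c) * v' t) + of_real (t powr (- c)) * P t * cnj (P' t)) -
      (P t * cnj (of_real (t powr (- c)) * P' t) + of_real (t powr c) * v t * cnj (U' t)))"
    by (intro ac_deriv_diff ac_deriv_mult ac_deriv_cnj A[THEN conjunct1] A[THEN conjunct2])
  then show ?thesis
    by (rule ac_deriv_cong) (simp_all add: wronskian_def algebra_simps)
qed

lemma set_borel_measurable_restrict:
  fixes f :: "real \<Rightarrow> 'a::{real_normed_vector, second_countable_topology}"
  assumes "(\<lambda>t. indicator {0<..} t *\<^sub>R f t) \<in> borel_measurable borel" "A \<in> sets borel" "A \<subseteq> {0<..}"
  shows "set_borel_measurable lborel A f"
proof -
  have "(\<lambda>t. indicator A t *\<^sub>R (indicator {0<..} t *\<^sub>R f t)) \<in> borel_measurable borel"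
    by (rule borel_measurable_scaleR[OF borel_measurable_indicator[OF assms(2)] assms(1)])
  also have "(\<lambda>t. indicator A t *\<^sub>R (indicator {0<..} t *\<^sub>R f t)) = (\<lambda>t. indicator A t *\<^sub>R f t)"
    by (rule ext) (use assms(3) in \<open>auto simp: indicator_def\<close>)
  finally show ?thesis by (simp add: set_borel_measurable_def)
qed

lemma weighted_l2_mult:
  assumes f: "weighted_l2 c f" and g: "weighted_l2 c g"
  shows "set_integrable lborel {0<..} (\<lambda>t. of_real (t powr c) * (f t * cnj (g t)))"
proof (rule set_integrable_bound)
  show "set_integrable lborel {0<..} (\<lambda>t. t powr c * (cmod (f t))\<^sup>2 + t powr c * (cmod (g t))\<^sup>2)"
    using f g by (auto simp: weighted_l2_def)
  have "(\<lambda>t. of_real (t powr c) * ((indicator {0<..} t *\<^sub>R f t) * cnj (indicator {0<..} t *\<^sub>R g t)))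
    \<in> borel_measurable borel"
    using f g unfolding weighted_l2_def
    by (intro borel_measurable_times borel_measurable_cnj) auto
  also have "(\<lambda>t. of_real (t powr c) * ((indicator {0<..} t *\<^sub>R f t) * cnj (indicator {0<..} t *\<^sub>R g t))) =
      (\<lambda>t. indicator {0<..} t *\<^sub>R (of_real (t powr c) * (f t * cnj (g t))))"
    by (auto simp: indicator_def)
  finally show "set_borel_measurable lborel {0<..} (\<lambda>t. of_real (t powr c) * (f t * cnj (g t)))"
    by (simp add: set_borel_measurable_def)
  show "AE t in lborel. t \<in> {0<..} \<longrightarrow> norm (of_real (t powr c) * (f t * cnj (g t)))
    \<le> norm (t powr c * (cmod (f t))\<^sup>2 + t powr c * (cmod (g t))\<^sup>2)"
  proof (intro AE_I2 impI)
    fix t :: real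
    have "cmod (f t) * cmod (g t) \<le> ((cmod (f t))\<^sup>2 + (cmod (g t))\<^sup>2) / 2"
      by (rule mult_le_half_squares)
    also have "\<dots> \<le> (cmod (f t))\<^sup>2 + (cmod (g t))\<^sup>2" by simp
    finally have "t powr c * (cmod (f t) * cmod (g t)) \<le> t powr c * ((cmod (f t))\<^sup>2 + (cmod (g t))\<^sup>2)"
      by (intro mult_left_mono) auto
    then show "norm (of_real (t powr c) * (f t * cnj (g t)))
      \<le> norm (t powr c * (cmod (f t))\<^sup>2 + t powr c * (cmod (g t))\<^sup>2)"
      by (simp add: norm_mult distrib_left)
  qed
qed

lemma weighted_l2_wronskian_integrable:
  assumes "weighted_l2 c f" "weighted_l2 c g'" "weighted_l2 c g" "weighted_l2 c f'"
  shows "set_integrable lborel {0<..} (\<lambda>t. of_real (t powr c) * (f t * cnj (g' t) - g t * cnj (f' t)))"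
    "(LBINT t:{0<..}. of_real (t powr c) * (f t * cnj (g' t) - g t * cnj (f' t))) =
     (LBINT t:{0<..}. of_real (t powr c) * (f t * cnj (g' t))) -
     (LBINT t:{0<..}. of_real (t powr c) * (g t * cnj (f' t)))"
  using set_integral_diff[OF weighted_l2_mult[OF assms(1,2)] weighted_l2_mult[OF assms(3,4)]]
  by (simp_all add: right_diff_distrib)

lemma ac_deriv_tendsto_at_0:
  assumes F: "ac_deriv F f" and f: "set_integrable lborel {0<..1} f"
  shows "(F \<longlongrightarrow> F 1 - (LBINT t:{0<..1}. f t)) (at_right 0)"
proof -
  have "((\<lambda>t. LBINT r:{t..1}. f r) \<longlongrightarrow> (LBINT t:{0<..1}. f t)) (at_right 0)"
    by (rule tendsto_set_lebesgue_integral_at_right) (use f in auto)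
  then have "((\<lambda>t. F 1 - (LBINT r:{t..1}. f r)) \<longlongrightarrow> F 1 - (LBINT t:{0<..1}. f t)) (at_right 0)"
    by (intro tendsto_intros)
  then show ?thesis
  proof (rule Lim_transform_eventually)
    show "\<forall>\<^sub>F t in at_right 0. F 1 - (LBINT r:{t..1}. f r) = F t"
      unfolding eventually_at_right_field
    proof (intro exI[of _ 1] conjI allI impI)
      fix t :: real assume "0 < t" "t < 1"
      then show "F 1 - (LBINT r:{t..1}. f r) = F t"
        using ac_derivD(2)[OF F, of t 1] by (simp add: algebra_simps)
    qed simp
  qed
qed

lemma ac_deriv_tendsto_at_top:
  assumes F: "ac_deriv F f" and f: "set_integrable lborel {1..} f"
  shows "(F \<longlongrightarrow> F 1 + (LBINT t:{1..}. f t)) at_top"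
proof -
  have "((\<lambda>y. LINT x|lborel. indicator {..y} x *\<^sub>R (indicator {1..} x *\<^sub>R f x)) \<longlongrightarrow>
      (LINT x|lborel. indicator {1..} x *\<^sub>R f x)) at_top"
    by (rule tendsto_integral_at_top) (use f in \<open>auto simp: set_integrable_def\<close>)
  also have "(\<lambda>y. LINT x|lborel. indicator {..y} x *\<^sub>R (indicator {1..} x *\<^sub>R f x)) =
      (\<lambda>y. LBINT x:{1..y}. f x)"
    unfolding set_lebesgue_integral_def
    by (intro ext Bochner_Integration.integral_cong) (auto simp: indicator_def)
  finally have "((\<lambda>y. F 1 + (LBINT x:{1..y}. f x)) \<longlongrightarrow> F 1 + (LBINT t:{1..}. f t)) at_top"
    unfolding set_lebesgue_integral_def by (intro tendsto_intros)
  then show ?thesis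
  proof (rule Lim_transform_eventually)
    show "\<forall>\<^sub>F y in at_top. F 1 + (LBINT x:{1..y}. f x) = F y"
      using eventually_ge_at_top[of 1]
      by eventually_elim (rule ac_derivD(3)[OF F zero_less_one, symmetric])
  qed
qed

lemma set_integral_mono_set_nonneg:
  fixes f :: "real \<Rightarrow> real"
  assumes "set_integrable lborel B f" "A \<subseteq> B" "A \<in> sets borel" "\<And>t. t \<in> B \<Longrightarrow> 0 \<le> f t"
  shows "(LBINT t:A. f t) \<le> (LBINT t:B. f t)"
  unfolding set_lebesgue_integral_def
proof (rule integral_mono)
  show "integrable lborel (\<lambda>t. indicator A t *\<^sub>R f t)"
    using set_integrable_subset[OF assms(1) _ assms(2)] assms(3) by (simp add: set_integrable_def)
  show "integrable lborel (\<lambda>t. indicator B t *\<^sub>R f t)"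
    using assms(1) by (simp add: set_integrable_def)
qed (use assms(2,4) in \<open>auto simp: indicator_def\<close>)

lemma not_set_integrable_bounded_below:
  fixes f :: "real \<Rightarrow> real"
  assumes f: "set_integrable lborel {0<..} f" and nonneg: "\<And>t. 0 < t \<Longrightarrow> 0 \<le> f t"
    and d: "0 < d" "0 < T" "\<And>t. T \<le> t \<Longrightarrow> d \<le> f t"
  shows False
proof -
  have "real n * d \<le> (LBINT t:{0<..}. f t)" for n
  proof -
    have "real n * d = (LBINT t:{T..T + real n}. d)"
      by (simp add: set_lebesgue_integral_def)
    also have "\<dots> \<le> (LBINT t:{T..T + real n}. f t)"
      by (intro set_integral_mono borel_integrable_atLeastAtMost' set_integrable_subset[OF f])
        (use d in auto)
    also have "\<dots> \<le> (LBINT t:{0<..}. f t)"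
      by (rule set_integral_mono_set_nonneg[OF f]) (use d(2) nonneg in auto)
    finally show ?thesis .
  qed
  then show False using ex_less_of_nat_mult[OF d(1)] by (meson not_le)
qed

lemma set_integral_inverse: "0 < s \<Longrightarrow> s \<le> t \<Longrightarrow> (LBINT r:{s..t}. k / r) = k * (ln t - ln s)" for k :: real
proof -
  assume st: "0 < s" "s \<le> t"
  have "(LBINT r:{s..t}. k / r) = k * ln t - k * ln s"
    unfolding set_lebesgue_integral_def
  proof (rule integral_FTC_Icc[OF st(2)])
    fix x assume "s \<le> x" "x \<le> t"
    then have "((\<lambda>x. k * ln x) has_real_derivative k / x) (at x)"
      using st by (auto intro!: derivative_eq_intros)
    then show "((\<lambda>x. k * ln x) has_vector_derivative k / x) (at x within {s..t})"
      unfolding has_real_derivative_iff_has_vector_derivative by (rule has_vector_derivative_at_within)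
  qed (use st in \<open>auto intro!: continuous_intros\<close>)
  then show ?thesis by (simp add: algebra_simps)
qed

lemma not_set_integrable_inverse_bound:
  fixes f :: "real \<Rightarrow> real"
  assumes f: "set_integrable lborel {0<..} f" and nonneg: "\<And>t. 0 < t \<Longrightarrow> 0 \<le> f t"
    and d: "0 < d" "0 < \<tau>" "\<And>t. 0 < t \<Longrightarrow> t \<le> \<tau> \<Longrightarrow> d / t \<le> f t"
  shows False
proof -
  have "d * x \<le> (LBINT t:{0<..}. f t)" if "x \<ge> 0" for x
  proof -
    \<comment> \<open>With this left endpoint the integral of d/t up to \<open>\<tau>\<close> is
      exactly d x, which exceeds every bound as x grows.\<close>
    define s where "s = \<tau> * exp (- x)"
    have s: "0 < s" "s \<le> \<tau>" using d that by (auto simp: s_def mult_le_cancel_left1)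
    have "ln \<tau> - ln s = x" using d by (simp add: s_def ln_mult)
    then have "d * x = (LBINT t:{s..\<tau>}. d / t)"
      using set_integral_inverse[OF s] by simp
    also have "\<dots> \<le> (LBINT t:{s..\<tau>}. f t)"
      by (intro set_integral_mono borel_integrable_atLeastAtMost' set_integrable_subset[OF f])
        (use d s in \<open>auto intro!: continuous_intros\<close>)
    also have "\<dots> \<le> (LBINT t:{0<..}. f t)"
      by (rule set_integral_mono_set_nonneg[OF f]) (use s nonneg in auto)
    finally show ?thesis .
  qed
  from this[of "(\<bar>LBINT t:{0<..}. f t\<bar> + 1) / d"] d(1) show False by auto
qed


section \<open>Decay of the Wronskian at infinity\<close>

lemma leaf_solD:
  assumes "leaf_sol c U P v"
  shows "ac_deriv U (\<lambda>t. of_real (t powr (- c)) * P t)" "ac_deriv P (\<lambda>t. of_real (t powr c) * v t)"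
    "continuous_on {0<..} U" "continuous_on {0<..} P"
  using assms ac_deriv_continuous unfolding leaf_sol_def by blast+

lemma weighted_l2_integral_bound:
  assumes "weighted_l2 c f" "A \<in> sets borel" "A \<subseteq> {0<..}"
  shows "set_integrable lborel A (\<lambda>t. t powr c * (cmod (f t))\<^sup>2)"
    "(LBINT t:A. t powr c * (cmod (f t))\<^sup>2) \<le> (LBINT t:{0<..}. t powr c * (cmod (f t))\<^sup>2)"
proof -
  have f: "set_integrable lborel {0<..} (\<lambda>t. t powr c * (cmod (f t))\<^sup>2)"
    using assms(1) by (simp add: weighted_l2_def)
  show "set_integrable lborel A (\<lambda>t. t powr c * (cmod (f t))\<^sup>2)"
    by (rule set_integrable_subset[OF f]) (use assms in auto)
  show "(LBINT t:A. t powr c * (cmod (f t))\<^sup>2) \<le> (LBINT t:{0<..}. t powr c * (cmod (f t))\<^sup>2)"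
    by (rule set_integral_mono_set_nonneg[OF f]) (use assms in auto)
qed

lemma ac_deriv_Re:
  assumes F: "ac_deriv F f" and st: "0 < s" "s \<le> t"
  shows "set_integrable lborel {s..t} (\<lambda>r. Re (f r))" "Re (F t) - Re (F s) = (LBINT r:{s..t}. Re (f r))"
proof -
  have eq: "(\<lambda>r. indicator {s..t} r *\<^sub>R Re (f r)) = (\<lambda>r. Re (indicator {s..t} r *\<^sub>R f r))"
    by auto
  have f: "integrable lborel (\<lambda>r. indicator {s..t} r *\<^sub>R f r)"
    using ac_derivD(1)[OF F st] by (simp add: set_integrable_def)
  show "set_integrable lborel {s..t} (\<lambda>r. Re (f r))"
    unfolding set_integrable_def eq by (rule integrable_Re[OF f])
  show "Re (F t) - Re (F s) = (LBINT r:{s..t}. Re (f r))"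
    unfolding set_lebesgue_integral_def eq integral_Re[OF f]
    using ac_derivD(2)[OF F st] by (simp add: set_lebesgue_integral_def flip: minus_complex.sel)
qed

text \<open>If \<open>Re (P cnj U)\<close> stayed above \<open>1\<close>, then \<open>|U|\<^sup>2\<close> would be increasing and \<open>U\<close> could not be square
  integrable.\<close>

lemma leaf_sol_Re_frequently_small:
  assumes sol: "leaf_sol c U P v" and U: "weighted_l2 c U" and c: "0 \<le> c"
  shows "\<exists>t\<ge>T. Re (P t * cnj (U t)) < 1"
proof (rule ccontr)
  assume "\<not> ?thesis"
  then have ge: "1 \<le> Re (P t * cnj (U t))" if "T \<le> t" for t
    using that by (meson not_le)
  define S where "S = max 1 T"
  have S: "1 \<le> S" "T \<le> S" by (auto simp: S_def)
  \<comment> \<open>The derivative of |U|^2 is 2 t^(-c) Re (P cnj U). As t^(-c) decreases for c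
    \<ge> 0, it is at least \<open>d\<close> on [S, S + 1], and this single unit of growth already
    keeps |U|^2 above \<open>d\<close> afterwards.\<close>
  define d where "d = 2 * (S + 1) powr (- c)"
  have d: "0 < d" using S by (simp add: d_def)
  have N: "ac_deriv (\<lambda>t. U t * cnj (U t))
      (\<lambda>t. U t * cnj (of_real (t powr (- c)) * P t) + of_real (t powr (- c)) * P t * cnj (U t))"
    by (intro ac_deriv_mult ac_deriv_cnj leaf_solD[OF sol])
  have Re_eq: "Re (U t * cnj (of_real (t powr (- c)) * P t) + of_real (t powr (- c)) * P t * cnj (U t)) =
      2 * (t powr (- c) * Re (P t * cnj (U t)))" for t
    by (simp add: algebra_simps)
  have ReU: "Re (U t * cnj (U t)) = (cmod (U t))\<^sup>2" for t
    by (metis Re_complex_of_real complex_norm_square)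
  have low: "d \<le> (cmod (U t))\<^sup>2" if t: "S + 1 \<le> t" for t
  proof -
    have 0: "0 < S" "S \<le> t" using S t by auto
    note I = ac_deriv_Re[OF N 0, unfolded Re_eq ReU]
    have "d = (LBINT r:{S..S+1}. d)" by (simp add: set_lebesgue_integral_def)
    also have "\<dots> \<le> (LBINT r:{S..S+1}. 2 * (r powr (- c) * Re (P r * cnj (U r))))"
    proof (rule set_integral_mono)
      show "set_integrable lborel {S..S+1} (\<lambda>r. 2 * (r powr (- c) * Re (P r * cnj (U r))))"
        by (rule set_integrable_subset[OF I(1)]) (use t in auto)
      fix r assume r: "r \<in> {S..S+1}"
      have "(S + 1) powr (- c) \<le> r powr (- c)"
        by (rule powr_mono2') (use r S c in auto)
      moreover have "1 \<le> Re (P r * cnj (U r))"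
        by (rule ge) (use r S in auto)
      ultimately have "(S + 1) powr (- c) * 1 \<le> r powr (- c) * Re (P r * cnj (U r))"
        by (intro mult_mono) auto
      then show "d \<le> 2 * (r powr (- c) * Re (P r * cnj (U r)))" by (simp add: d_def)
    qed (auto intro: borel_integrable_atLeastAtMost')
    also have "\<dots> \<le> (LBINT r:{S..t}. 2 * (r powr (- c) * Re (P r * cnj (U r))))"
    proof (rule set_integral_mono_set_nonneg[OF I(1)])
      fix r assume "r \<in> {S..t}"
      then have "1 \<le> Re (P r * cnj (U r))" by (intro ge) (use S in auto)
      then show "0 \<le> 2 * (r powr (- c) * Re (P r * cnj (U r)))"
        by (metis mult_nonneg_nonneg order_trans powr_ge_zero zero_le_numeral zero_le_one)
    qed (use t in auto)
    also have "\<dots> = (cmod (U t))\<^sup>2 - (cmod (U S))\<^sup>2"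
      by (rule I(2)[symmetric])
    finally show ?thesis using zero_le_power2[of "cmod (U S)"] by linarith
  qed
  have "d \<le> t powr c * (cmod (U t))\<^sup>2" if "S + 1 \<le> t" for t
  proof -
    have "1 \<le> t powr c" using that S c by (simp add: ge_one_powr_ge_zero)
    then have "1 * d \<le> t powr c * (cmod (U t))\<^sup>2"
      using low[OF that] d by (intro mult_mono) auto
    then show ?thesis by simp
  qed
  then show False
    using not_set_integrable_bounded_below[of "\<lambda>t. t powr c * (cmod (U t))\<^sup>2" d "S + 1"] U d S
    by (auto simp: weighted_l2_def)
qed

text \<open>The derivative of P cnj U is t^(-c) |P|^2 + t^c v cnj U, and the last term is integrable
  by hypothesis. Hence the energy of \<open>P\<close> is bounded as soon as the real part of P cnj U
  is bounded above at the right endpoint.\<close>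

lemma leaf_sol_energy_bound:
  assumes sol: "leaf_sol c U P v" and U: "weighted_l2 c U" and v: "weighted_l2 c v" and c: "0 \<le> c"
  obtains K where "\<And>t. 1 \<le> t \<Longrightarrow> (LBINT r:{1..t}. r powr (- c) * (cmod (P r))\<^sup>2) \<le> K"
    "\<And>t. 1 \<le> t \<Longrightarrow> set_integrable lborel {1..t} (\<lambda>r. r powr (- c) * (cmod (P r))\<^sup>2)"
proof -
  let ?e = "\<lambda>r. r powr (- c) * (cmod (P r))\<^sup>2"
  let ?g = "\<lambda>r. of_real (r powr c) * (v r * cnj (U r))"
  have e: "set_integrable lborel {1..t} ?e" for t
    by (intro borel_integrable_atLeastAtMost' continuous_intros
        continuous_on_subset[OF leaf_solD(4)[OF sol]]) auto
  have g0: "set_integrable lborel {0<..} ?g"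
    by (rule weighted_l2_mult[OF v U])
  then have gn0: "set_integrable lborel {0<..} (\<lambda>r. norm (?g r))"
    by (rule set_integrable_norm)
  have Q: "ac_deriv (\<lambda>t. P t * cnj (U t))
      (\<lambda>t. P t * cnj (of_real (t powr (- c)) * P t) + of_real (t powr c) * v t * cnj (U t))"
    by (intro ac_deriv_mult ac_deriv_cnj leaf_solD[OF sol])
  have Re_eq: "Re (P t * cnj (of_real (t powr (- c)) * P t) + of_real (t powr c) * v t * cnj (U t)) =
      ?e t + Re (?g t)" for t
  proof -
    have "P t * cnj (of_real (t powr (- c)) * P t) = of_real (?e t)"
      using complex_norm_square[of "P t"] by (simp add: mult.left_commute)
    then show ?thesis by (simp only: plus_complex.sel Re_complex_of_real mult.assoc)
  qed
  define K where "K = 1 + (\<bar>Re (P 1 * cnj (U 1))\<bar> + (LBINT r:{0<..}. norm (?g r)))"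
  have bound: "(LBINT r:{1..t}. ?e r) \<le> K" if "1 \<le> t" for t
  proof -
    \<comment> \<open>An upper bound for the boundary term is available only at some later point;
      the energy density is nonnegative, so extending the integral from \<open>t\<close> to t' only
      increases it.\<close>
    obtain t' where t': "t' \<ge> t" "Re (P t' * cnj (U t')) < 1"
      using leaf_sol_Re_frequently_small[OF sol U c] by blast
    have 1: "(0::real) < 1" "1 \<le> t'" using t' that by auto
    have g: "set_integrable lborel {1..t'} ?g" "set_integrable lborel {1..t'} (\<lambda>r. norm (?g r))"
      by (rule set_integrable_subset[OF g0], auto) (rule set_integrable_subset[OF gn0], auto)
    then have gRe: "set_integrable lborel {1..t'} (\<lambda>r. Re (?g r))"
      using integrable_Re[of lborel "\<lambda>r. indicator {1..t'} r *\<^sub>R ?g r"] by (simp add: set_integrable_def)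
    have "(LBINT r:{1..t}. ?e r) \<le> (LBINT r:{1..t'}. ?e r)"
      by (rule set_integral_mono_set_nonneg[OF e]) (use t' in auto)
    also have "\<dots> = (LBINT r:{1..t'}. ?e r + Re (?g r)) - (LBINT r:{1..t'}. Re (?g r))"
      using set_integral_add(2)[OF e gRe] by simp
    also have "(LBINT r:{1..t'}. ?e r + Re (?g r)) = Re (P t' * cnj (U t')) - Re (P 1 * cnj (U 1))"
      using ac_deriv_Re(2)[OF Q 1, unfolded Re_eq] by simp
    also have "(\<dots> - (LBINT r:{1..t'}. Re (?g r))) \<le> K"
    proof -
      have "- (LBINT r:{1..t'}. Re (?g r)) = (LBINT r:{1..t'}. - Re (?g r))"
        using set_integral_uminus[OF gRe] by simp
      also have "\<dots> \<le> (LBINT r:{1..t'}. norm (?g r))"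
      proof (rule set_integral_mono)
        show "set_integrable lborel {1..t'} (\<lambda>r. - Re (?g r))"
          using gRe by (simp add: set_integrable_def)
        show "- Re (?g r) \<le> norm (?g r)" for r
          using abs_Re_le_cmod[of "?g r"] by linarith
      qed (rule g)
      also have "\<dots> \<le> (LBINT r:{0<..}. norm (?g r))"
        by (rule set_integral_mono_set_nonneg[OF gn0]) auto
      finally show ?thesis using t'(2) unfolding K_def by linarith
    qed
    finally show ?thesis .
  qed
  show ?thesis by (rule that[OF bound e])
qed

lemma mult_le_weighted_squares:
  fixes x y r :: real
  assumes "0 < r" "0 \<le> x" "0 \<le> y"
  shows "x * y \<le> r powr c * x\<^sup>2 + r powr (- c) * y\<^sup>2"
proof -
  have sq: "(r powr (c/2))\<^sup>2 = r powr c" "(r powr (- c/2))\<^sup>2 = r powr (- c)"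
    by (simp_all add: power2_eq_square flip: powr_add)
  have "r powr (c/2) * r powr (- c/2) = 1"
    using assms by (simp flip: powr_add)
  then have "x * y = (r powr (c/2) * x) * (r powr (- c/2) * y)"
    by (simp add: algebra_simps)
  also have "\<dots> \<le> ((r powr (c/2) * x)\<^sup>2 + (r powr (- c/2) * y)\<^sup>2) / 2"
    by (rule mult_le_half_squares)
  also have "\<dots> \<le> r powr c * x\<^sup>2 + r powr (- c) * y\<^sup>2"
  proof -
    have half: "(p + q) / 2 \<le> p + q" if "0 \<le> p" "0 \<le> q" for p q :: real
      using that by simp
    show ?thesis unfolding power_mult_distrib sq by (rule half) simp_all
  qed
  finally show ?thesis .
qed

text \<open>A limit exists because the derivative of the Wronskian is integrable. If it were
  \<open>L\<close> \<noteq> 0, the modulus would eventually exceed |L|/2 and its integral would grow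
  linearly; yet it is at most t^c (|U|^2 + |U'|^2) + t^(-c) (|P|^2 + |P'|^2), whose integrals stay
  bounded by square integrability and the energy estimate.\<close>

lemma wronskian_tendsto_at_top_nonneg:
  assumes sol: "leaf_sol c U P v" "leaf_sol c U' P' v'"
    and l2: "weighted_l2 c U" "weighted_l2 c v" "weighted_l2 c U'" "weighted_l2 c v'" and c: "0 \<le> c"
  shows "(wronskian U P U' P' \<longlongrightarrow> 0) at_top"
proof -
  let ?W = "wronskian U P U' P'"
  let ?w = "\<lambda>t. of_real (t powr c) * (U t * cnj (v' t) - v t * cnj (U' t))"
  note W = leaf_sol_wronskian[OF sol]
  have "set_integrable lborel {1..} ?w"
    by (rule set_integrable_subset[OF weighted_l2_wronskian_integrable(1)[OF l2(1,4,2,3)]]) auto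
  then obtain L where L: "(?W \<longlongrightarrow> L) at_top"
    using ac_deriv_tendsto_at_top[OF W] by blast
  have "L = 0"
  proof (rule ccontr)
    assume "L \<noteq> 0"
    then have d: "0 < cmod L / 2" "cmod L / 2 < cmod L" by auto
    have "\<forall>\<^sub>F t in at_top. cmod L / 2 < cmod (?W t)"
      by (rule order_tendstoD(1)[OF tendsto_norm[OF L] d(2)])
    then obtain T0 where T0: "\<And>t. T0 \<le> t \<Longrightarrow> cmod L / 2 < cmod (?W t)"
      by (auto simp: eventually_at_top_linorder)
    define T where "T = max 1 T0"
    have T: "1 \<le> T" "T0 \<le> T" by (auto simp: T_def)
    obtain K where K: "\<And>t. 1 \<le> t \<Longrightarrow> (LBINT r:{1..t}. r powr (- c) * (cmod (P r))\<^sup>2) \<le> K"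
      "\<And>t. 1 \<le> t \<Longrightarrow> set_integrable lborel {1..t} (\<lambda>r. r powr (- c) * (cmod (P r))\<^sup>2)"
      using leaf_sol_energy_bound[OF sol(1) l2(1,2) c] by blast
    obtain K' where K': "\<And>t. 1 \<le> t \<Longrightarrow> (LBINT r:{1..t}. r powr (- c) * (cmod (P' r))\<^sup>2) \<le> K'"
      "\<And>t. 1 \<le> t \<Longrightarrow> set_integrable lborel {1..t} (\<lambda>r. r powr (- c) * (cmod (P' r))\<^sup>2)"
      using leaf_sol_energy_bound[OF sol(2) l2(3,4) c] by blast
    define B where "B = ((LBINT r:{0<..}. r powr c * (cmod (U r))\<^sup>2) + K') +
      ((LBINT r:{0<..}. r powr c * (cmod (U' r))\<^sup>2) + K)"
    have "cmod L / 2 * real n \<le> B" for n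
    proof -
      let ?t = "T + real n"
      have t: "1 \<le> ?t" using T by auto
      have sub: "{1..?t} \<in> sets borel" "{1..?t} \<subseteq> {0<..}" by auto
      note u = weighted_l2_integral_bound[OF l2(1) sub] weighted_l2_integral_bound[OF l2(3) sub]
      let ?a = "\<lambda>r. r powr c * (cmod (U r))\<^sup>2 + r powr (- c) * (cmod (P' r))\<^sup>2"
      let ?b = "\<lambda>r. r powr c * (cmod (U' r))\<^sup>2 + r powr (- c) * (cmod (P r))\<^sup>2"
      note a = set_integral_add[OF u(1) K'(2)[OF t]]
      note b = set_integral_add[OF u(3) K(2)[OF t]]
      note ab = set_integral_add[OF a(1) b(1)]
      have "cmod L / 2 * real n = (LBINT r:{T..?t}. cmod L / 2)"
        by (simp add: set_lebesgue_integral_def)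
      also have "\<dots> \<le> (LBINT r:{T..?t}. ?a r + ?b r)"
      proof (rule set_integral_mono)
        show "set_integrable lborel {T..?t} (\<lambda>r. ?a r + ?b r)"
          by (rule set_integrable_subset[OF ab(1)]) (use T in auto)
        fix r assume r: "r \<in> {T..?t}"
        then have r0: "0 < r" using T by auto
        have "cmod L / 2 \<le> cmod (?W r)"
          by (rule less_imp_le, rule T0) (use r T in auto)
        also have "\<dots> \<le> cmod (U r * cnj (P' r)) + cmod (P r * cnj (U' r))"
          unfolding wronskian_def by (rule norm_triangle_ineq4)
        also have "\<dots> = cmod (U r) * cmod (P' r) + cmod (U' r) * cmod (P r)"
          by (simp add: norm_mult)
        also have "\<dots> \<le> ?a r + ?b r"
          by (intro add_mono mult_le_weighted_squares r0) auto
        finally show "cmod L / 2 \<le> ?a r + ?b r" .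
      qed (auto intro: borel_integrable_atLeastAtMost')
      also have "\<dots> \<le> (LBINT r:{1..?t}. ?a r + ?b r)"
        by (rule set_integral_mono_set_nonneg[OF ab(1)]) (use T in auto)
      also have "\<dots> \<le> B"
        unfolding ab(2) a(2) b(2) B_def
        by (intro add_mono u(2,4) K(1) K'(1) t)
      finally show ?thesis .
    qed
    then have "real n * (cmod L / 2) \<le> B" for n by (simp add: mult.commute)
    then show False using ex_less_of_nat_mult[OF d(1)] by (meson not_le)
  qed
  then show ?thesis using L by simp
qed


section \<open>Decay of the Wronskian at the origin\<close>

lemma powr_half_square: "0 < t \<Longrightarrow> (t powr (\<alpha> / 2))\<^sup>2 = t powr \<alpha>" for t :: real
  by (simp add: power2_eq_square flip: powr_add)

text \<open>For c > 0 the weight has finite mass on (0, 1], so t^c |v| \<le> t^c + t^c |v|^2 makes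
  the derivative of \<open>P\<close> integrable up to the origin.\<close>

lemma leaf_sol_flux_tendsto:
  assumes sol: "leaf_sol c U P v" and v: "weighted_l2 c v" and c: "0 < c"
  obtains A where "(P \<longlongrightarrow> A) (at_right 0)"
proof -
  have "set_integrable lborel {0<..1} (\<lambda>t. of_real (t powr c) * v t)"
  proof (rule set_integrable_bound)
    have "set_integrable lborel {0..1} (\<lambda>t. t powr c)"
      using c by (intro borel_integrable_atLeastAtMost' continuous_on_powr' continuous_intros) auto
    then have "set_integrable lborel {0<..1} (\<lambda>t. t powr c)"
      by (rule set_integrable_subset) auto
    then show "set_integrable lborel {0<..1} (\<lambda>t. t powr c + t powr c * (cmod (v t))\<^sup>2)"
      by (rule set_integral_add(1)) (rule weighted_l2_integral_bound(1)[OF v]; auto)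
    have "(\<lambda>t. of_real (t powr c) * (indicator {0<..} t *\<^sub>R v t)) \<in> borel_measurable borel"
      using v unfolding weighted_l2_def by (intro borel_measurable_times) auto
    then have "(\<lambda>t. indicator {0<..} t *\<^sub>R (of_real (t powr c) * v t)) \<in> borel_measurable borel"
      by simp
    then show "set_borel_measurable lborel {0<..1} (\<lambda>t. of_real (t powr c) * v t)"
      by (rule set_borel_measurable_restrict) auto
    have "t powr c * cmod (v t) \<le> t powr c * (1 + (cmod (v t))\<^sup>2)" for t
      by (intro mult_left_mono le_one_plus_square) auto
    then show "AE t in lborel. t \<in> {0<..1} \<longrightarrow> norm (of_real (t powr c) * v t)
      \<le> norm (t powr c + t powr c * (cmod (v t))\<^sup>2)"
      by (intro AE_I2) (simp add: norm_mult distrib_left)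
  qed
  then show ?thesis
    using that ac_deriv_tendsto_at_0[OF leaf_solD(2)[OF sol]] by blast
qed

text \<open>A nonzero limit of the flux \<open>P\<close> would force \<open>U\<close> to grow like \<open>t powr (1 - c)\<close> at \<open>0\<close>.\<close>

lemma leaf_sol_flux_tendsto_0:
  assumes sol: "leaf_sol c U P v" and U: "weighted_l2 c U" and c: "3 \<le> c"
    and A: "(P \<longlongrightarrow> A) (at_right 0)"
  shows "A = 0"
proof (rule ccontr)
  assume "A \<noteq> 0"
  \<comment> \<open>Half of |A|^2, the limit of Re (cnj A P): a lower bound for that real part close
    to 0.\<close>
  define a where "a = (cmod A)\<^sup>2 / 2"
  have a: "0 < a" using \<open>A \<noteq> 0\<close> by (simp add: a_def)
  have "((\<lambda>t. Re (cnj A * P t)) \<longlongrightarrow> Re (cnj A * A)) (at_right 0)"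
    by (intro tendsto_intros A)
  moreover have "Re (cnj A * A) = 2 * a"
    unfolding a_def by (metis Re_complex_of_real complex_norm_square mult.commute field_sum_of_halves mult_2)
  ultimately have "\<forall>\<^sub>F t in at_right 0. a < Re (cnj A * P t)"
    using a by (intro order_tendstoD(1)) auto
  then obtain b where b: "0 < b" "\<And>t. 0 < t \<Longrightarrow> t < b \<Longrightarrow> a < Re (cnj A * P t)"
    unfolding eventually_at_right_field by blast
  define \<tau> where "\<tau> = min 1 (b / 2)"
  have \<tau>: "0 < \<tau>" "\<tau> \<le> 1" "\<tau> < b" using b(1) by (auto simp: \<tau>_def)
  have AU: "ac_deriv (\<lambda>t. cnj A * U t) (\<lambda>t. cnj A * (of_real (t powr (- c)) * P t))"
    by (rule ac_deriv_cmult[OF leaf_solD(1)[OF sol]])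
  have pw: "ac_deriv (\<lambda>t. of_real (t powr (1 - c))) (\<lambda>t. of_real ((1 - c) * t powr (1 - c - 1)))"
    by (rule ac_deriv_powr)
  \<comment> \<open>A primitive of a t^(-c) is - C t^(1-c), so C t^(1-c) is the growth of
    \<open>U\<close> forced by the flux; \<open>D\<close> below collects the contributions of the
    endpoint \<open>\<tau>\<close>.\<close>
  define C where "C = a / (c - 1)"
  have C: "0 < C" using a c by (simp add: C_def)
  define D where "D = cmod A * cmod (U \<tau>) + C * \<tau> powr (1 - c)"
  have low: "C * t powr (1 - c) - D \<le> cmod A * cmod (U t)" if t: "0 < t" "t \<le> \<tau>" for t
  proof -
    note I = ac_deriv_Re[OF AU t] and J = ac_deriv_Re[OF pw t]
    have "C * (t powr (1 - c) - \<tau> powr (1 - c)) = - C * (\<tau> powr (1 - c) - t powr (1 - c))"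
      by (simp add: algebra_simps)
    also have "\<dots> = (LBINT r:{t..\<tau>}. - C * ((1 - c) * r powr (1 - c - 1)))"
      using J(2) by (simp only: Re_complex_of_real
          set_integral_mult_right[of lborel _ "- C" "\<lambda>r. (1 - c) * r powr (1 - c - 1)"])
    also have "\<dots> = (LBINT r:{t..\<tau>}. a * r powr (- c))"
      using c by (intro set_lebesgue_integral_cong) (auto simp: C_def field_simps)
    also have "\<dots> \<le> (LBINT r:{t..\<tau>}. Re (cnj A * (of_real (r powr (- c)) * P r)))"
    proof (rule set_integral_mono)
      show "set_integrable lborel {t..\<tau>} (\<lambda>r. a * r powr (- c))"
        using t by (intro borel_integrable_atLeastAtMost' continuous_intros) auto
      show "set_integrable lborel {t..\<tau>} (\<lambda>r. Re (cnj A * (of_real (r powr (- c)) * P r)))"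
        by (rule I)
      fix r assume r: "r \<in> {t..\<tau>}"
      have "a * r powr (- c) \<le> Re (cnj A * P r) * r powr (- c)"
        using b(2)[of r] r t \<tau> by (intro mult_right_mono) auto
      also have "\<dots> = Re (cnj A * (of_real (r powr (- c)) * P r))"
        by (simp add: algebra_simps)
      finally show "a * r powr (- c) \<le> Re (cnj A * (of_real (r powr (- c)) * P r))" .
    qed
    also have "\<dots> = Re (cnj A * U \<tau>) - Re (cnj A * U t)"
      by (rule I(2)[symmetric])
    also have "\<dots> \<le> cmod (cnj A * U \<tau>) + cmod (cnj A * U t)"
      using abs_Re_le_cmod[of "cnj A * U \<tau>"] abs_Re_le_cmod[of "cnj A * U t"] by linarith
    also have "\<dots> = cmod A * cmod (U \<tau>) + cmod A * cmod (U t)"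
      by (simp add: norm_mult)
    finally show ?thesis by (simp add: D_def algebra_simps)
  qed
  have D: "0 \<le> D" using C by (simp add: D_def)
  \<comment> \<open>Below this point D \<le> C / (2 t), hence \<open>D\<close> is at most half of C
    t^(1-c) and half of the main term remains.\<close>
  define \<tau>' where "\<tau>' = min \<tau> (C / (2 * D + 1))"
  have \<tau>': "0 < \<tau>'" "\<tau>' \<le> \<tau>" "\<tau>' \<le> C / (2 * D + 1)"
    using \<tau> C D by (auto simp: \<tau>'_def)
  have "(C / 2)\<^sup>2 / (cmod A)\<^sup>2 / t \<le> t powr c * (cmod (U t))\<^sup>2" if t: "0 < t" "t \<le> \<tau>'" for t
  proof -
    have t1: "t \<le> 1" "t \<le> \<tau>" using t \<tau> \<tau>' by auto
    have inv: "t powr (- 1) \<le> t powr p" if "p \<le> - 1" for p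
      by (rule powr_mono') (use t t1 that in auto)
    have "t * (2 * D + 1) \<le> C"
    proof -
      have "t \<le> C / (2 * D + 1)" using t(2) \<tau>'(3) by (rule order_trans)
      then show ?thesis using D by (simp add: le_divide_eq)
    qed
    then have "D \<le> C / 2 * t powr (- 1)"
      using t D by (simp add: powr_minus field_simps)
    also have "\<dots> \<le> C / 2 * t powr (1 - c)"
      using inv[of "1 - c"] C c by (intro mult_left_mono) auto
    finally have "C / 2 * t powr (1 - c) \<le> cmod A * cmod (U t)"
      using low[OF t(1) t1(2)] by (simp add: field_simps)
    then have "(C / 2 * t powr (1 - c))\<^sup>2 \<le> (cmod A * cmod (U t))\<^sup>2"
      using C by (intro power_mono) auto
    then have "(C / 2)\<^sup>2 * (t powr (1 - c))\<^sup>2 \<le> (cmod A)\<^sup>2 * (cmod (U t))\<^sup>2"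
      by (simp only: power_mult_distrib)
    then have "t powr c * ((C / 2)\<^sup>2 * (t powr (1 - c))\<^sup>2) \<le> t powr c * ((cmod A)\<^sup>2 * (cmod (U t))\<^sup>2)"
      by (intro mult_left_mono) auto
    moreover have "t powr c * (t powr (1 - c))\<^sup>2 = t powr (2 - c)"
      by (simp add: power2_eq_square flip: powr_add)
    ultimately have "(C / 2)\<^sup>2 * t powr (2 - c) \<le> (cmod A)\<^sup>2 * (t powr c * (cmod (U t))\<^sup>2)"
      by (metis mult.left_commute)
    \<comment> \<open>The bound c \<ge> 3 is decisive here: 2 - c \<le> -1, so on (0, 1] the
      weighted square of t^(1-c) dominates 1/t.\<close>
    moreover have "(C / 2)\<^sup>2 * t powr (- 1) \<le> (C / 2)\<^sup>2 * t powr (2 - c)"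
      using inv[of "2 - c"] c by (intro mult_left_mono) auto
    moreover have "(C / 2)\<^sup>2 / t = (C / 2)\<^sup>2 * t powr (- 1)"
      using t by (simp only: powr_minus powr_one divide_inverse)
    ultimately have "(C / 2)\<^sup>2 / t \<le> (cmod A)\<^sup>2 * (t powr c * (cmod (U t))\<^sup>2)"
      by (simp only: order_trans)
    moreover have "0 < (cmod A)\<^sup>2" using \<open>A \<noteq> 0\<close> by simp
    ultimately have "(C / 2)\<^sup>2 / t / (cmod A)\<^sup>2 \<le> t powr c * (cmod (U t))\<^sup>2"
      by (simp only: pos_divide_le_eq mult.commute)
    then show ?thesis by (simp only: divide_divide_eq_left mult.commute)
  qed
  then show False
    using not_set_integrable_inverse_bound[of "\<lambda>t. t powr c * (cmod (U t))\<^sup>2"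
        "(C / 2)\<^sup>2 / (cmod A)\<^sup>2" \<tau>'] U C \<tau>' \<open>A \<noteq> 0\<close>
    by (auto simp: weighted_l2_def)
qed

text \<open>A Cauchy-Schwarz estimate of the integral of r^c |v| over (0, t), where the second
  factor is of order t^((c+1)/2). It is obtained from the arithmetic-geometric inequality with a
  parameter tuned to \<open>t\<close>.\<close>

lemma leaf_sol_flux_bound:
  assumes sol: "leaf_sol c U P v" and v: "weighted_l2 c v" and c: "0 < c"
    and P0: "(P \<longlongrightarrow> 0) (at_right 0)"
  obtains C where "0 \<le> C" "\<And>t. 0 < t \<Longrightarrow> cmod (P t) \<le> C * t powr ((c + 1) / 2)"
proof -
  define K where "K = (LBINT t:{0<..}. t powr c * (cmod (v t))\<^sup>2)"
  have K: "0 \<le> K" by (auto simp: K_def set_lebesgue_integral_def)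
  note P = leaf_solD(2)[OF sol]
  have "cmod (P t) \<le> (K + 1) * t powr ((c + 1) / 2)" if t: "0 < t" for t
  proof -
    \<comment> \<open>The balancing value: l^2 = t * t^c, so both halves of the split integrand
      integrate to multiples of \<open>l\<close>.\<close>
    define l where "l = t powr ((c + 1) / 2)"
    have l: "0 < l" using t by (simp add: l_def)
    have l2: "l * l = t * t powr c"
      using t powr_half_square[of t "c + 1"] by (simp add: l_def power2_eq_square powr_add mult.commute)
    have "cmod (P t) \<le> cmod (P s) + (K + 1) * l" if s: "0 < s" "s \<le> t" for s
    proof -
      have sub: "{s..t} \<in> sets borel" "{s..t} \<subseteq> {0<..}" using s by auto
      note vi = weighted_l2_integral_bound[OF v sub]
      have ci: "set_integrable lborel {s..t} (\<lambda>r. t powr c / l)"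
        by (intro borel_integrable_atLeastAtMost' continuous_intros)
      have "cmod (P t - P s) = cmod (LBINT r:{s..t}. of_real (r powr c) * v r)"
        by (simp only: ac_derivD(2)[OF P s])
      also have "\<dots> \<le> (LBINT r:{s..t}. norm (of_real (r powr c) * v r))"
        by (rule set_integral_norm_bound[OF ac_derivD(1)[OF P s]])
      also have "\<dots> \<le> (LBINT r:{s..t}. l * (r powr c * (cmod (v r))\<^sup>2) + t powr c / l)"
      proof (rule set_integral_mono)
        show "set_integrable lborel {s..t} (\<lambda>r. norm (of_real (r powr c) * v r))"
          by (rule set_integrable_norm[OF ac_derivD(1)[OF P s]])
        show "set_integrable lborel {s..t} (\<lambda>r. l * (r powr c * (cmod (v r))\<^sup>2) + t powr c / l)"
          by (rule set_integral_add(1)[OF set_integrable_mult_right[OF vi(1)] ci])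
        fix r assume r: "r \<in> {s..t}"
        \<comment> \<open>The weighted inequality is used with base \<open>l\<close> and exponent
          -1, which gives |v| \<le> 1/l + l |v|^2.\<close>
        have "1 * cmod (v r) \<le> l powr (- 1) * 1\<^sup>2 + l powr (- (- 1)) * (cmod (v r))\<^sup>2"
          by (rule mult_le_weighted_squares[OF l]) auto
        then have "cmod (v r) \<le> 1 / l + l * (cmod (v r))\<^sup>2"
          using l by (simp add: powr_minus divide_inverse)
        then have "r powr c * cmod (v r) \<le> r powr c * (1 / l + l * (cmod (v r))\<^sup>2)"
          by (intro mult_left_mono) auto
        also have "\<dots> = l * (r powr c * (cmod (v r))\<^sup>2) + r powr c / l"
          by (simp add: algebra_simps)
        also have "\<dots> \<le> l * (r powr c * (cmod (v r))\<^sup>2) + t powr c / l"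
          using r s c l by (intro add_left_mono divide_right_mono powr_mono2) auto
        finally show "norm (of_real (r powr c) * v r) \<le> l * (r powr c * (cmod (v r))\<^sup>2) + t powr c / l"
          by (simp add: norm_mult)
      qed
      also have "\<dots> = l * (LBINT r:{s..t}. r powr c * (cmod (v r))\<^sup>2) + (t - s) * (t powr c / l)"
        unfolding set_integral_add(2)[OF set_integrable_mult_right[OF vi(1)] ci]
          set_integral_mult_right using s by (simp add: set_lebesgue_integral_def)
      also have "\<dots> \<le> l * K + t * (t powr c / l)"
        using vi(2) l s unfolding K_def by (intro add_mono mult_left_mono mult_right_mono) auto
      also have "t * (t powr c / l) = l"
        using l l2 by (simp add: field_simps)
      finally have "cmod (P t - P s) \<le> (K + 1) * l" by (simp add: algebra_simps)
      moreover have "cmod (P t) \<le> cmod (P s) + cmod (P t - P s)"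
        by (rule norm_triangle_sub)
      ultimately show ?thesis by linarith
    qed
    then have "\<forall>\<^sub>F s in at_right 0. cmod (P t) \<le> cmod (P s) + (K + 1) * l"
      unfolding eventually_at_right_field using t by (auto intro!: exI[of _ t])
    moreover have "((\<lambda>s. cmod (P s) + (K + 1) * l) \<longlongrightarrow> cmod 0 + (K + 1) * l) (at_right 0)"
      by (intro tendsto_intros P0)
    ultimately have "cmod (P t) \<le> cmod 0 + (K + 1) * l"
      by (intro tendsto_lowerbound) auto
    then show ?thesis by (simp add: l_def)
  qed
  then show ?thesis using that[of "K + 1"] K by auto
qed

text \<open>Both fluxes are O(t^((c+1)/2)), so the Wronskian is at most a constant times t^((c+1)/2)
  (|U| + |U'|). If it stayed above \<open>d\<close> in modulus, squaring would make t^c (|U|^2 +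
  |U'|^2) at least a multiple of 1/t, against integrability.\<close>

lemma wronskian_tendsto_at_0_ge_3:
  assumes sol: "leaf_sol c U P v" "leaf_sol c U' P' v'"
    and l2: "weighted_l2 c U" "weighted_l2 c v" "weighted_l2 c U'" "weighted_l2 c v'" and c: "3 \<le> c"
  shows "(wronskian U P U' P' \<longlongrightarrow> 0) (at_right 0)"
proof -
  let ?W = "wronskian U P U' P'"
  let ?w = "\<lambda>t. of_real (t powr c) * (U t * cnj (v' t) - v t * cnj (U' t))"
  have c0: "0 < c" using c by simp
  note W = leaf_sol_wronskian[OF sol]
  have "set_integrable lborel {0<..1} ?w"
    by (rule set_integrable_subset[OF weighted_l2_wronskian_integrable(1)[OF l2(1,4,2,3)]]) auto
  then obtain L where L: "(?W \<longlongrightarrow> L) (at_right 0)"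
    using ac_deriv_tendsto_at_0[OF W] by blast
  have "(P \<longlongrightarrow> 0) (at_right 0)" "(P' \<longlongrightarrow> 0) (at_right 0)"
    using leaf_sol_flux_tendsto[OF sol(1) l2(2) c0] leaf_sol_flux_tendsto_0[OF sol(1) l2(1) c]
      leaf_sol_flux_tendsto[OF sol(2) l2(4) c0] leaf_sol_flux_tendsto_0[OF sol(2) l2(3) c] by metis+
  then obtain K K' where K: "0 \<le> K" "\<And>t. 0 < t \<Longrightarrow> cmod (P t) \<le> K * t powr ((c + 1) / 2)"
    and K': "0 \<le> K'" "\<And>t. 0 < t \<Longrightarrow> cmod (P' t) \<le> K' * t powr ((c + 1) / 2)"
    using leaf_sol_flux_bound[OF sol(1) l2(2) c0] leaf_sol_flux_bound[OF sol(2) l2(4) c0] by metis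
  have "L = 0"
  proof (rule ccontr)
    assume "L \<noteq> 0"
    define d where "d = cmod L / 2"
    have d: "0 < d" "d < cmod L" using \<open>L \<noteq> 0\<close> by (auto simp: d_def)
    have "\<forall>\<^sub>F t in at_right 0. d < cmod (?W t)"
      by (rule order_tendstoD(1)[OF tendsto_norm[OF L] d(2)])
    then obtain b where b: "0 < b" "\<And>t. 0 < t \<Longrightarrow> t < b \<Longrightarrow> d < cmod (?W t)"
      unfolding eventually_at_right_field by blast
    define B where "B = K + K' + 1"
    have B: "0 < B" "K \<le> B" "K' \<le> B" using K K' by (auto simp: B_def)
    let ?f = "\<lambda>t. t powr c * (cmod (U t))\<^sup>2 + t powr c * (cmod (U' t))\<^sup>2"
    have f: "set_integrable lborel {0<..} ?f"
      using l2 by (intro set_integral_add) (auto simp: weighted_l2_def)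
    have "d\<^sup>2 / (2 * B\<^sup>2) / t \<le> ?f t" if t: "0 < t" "t \<le> b / 2" for t
    proof -
      let ?p = "t powr ((c + 1) / 2)"
      have "d \<le> cmod (?W t)" using b t by (intro less_imp_le b(2)) auto
      also have "\<dots> \<le> cmod (U t * cnj (P' t)) + cmod (P t * cnj (U' t))"
        unfolding wronskian_def by (rule norm_triangle_ineq4)
      also have "\<dots> = cmod (U t) * cmod (P' t) + cmod (U' t) * cmod (P t)"
        by (simp add: norm_mult)
      also have "\<dots> \<le> cmod (U t) * (B * ?p) + cmod (U' t) * (B * ?p)"
        by (intro add_mono mult_left_mono order_trans[OF K(2)[OF t(1)]]
            order_trans[OF K'(2)[OF t(1)]] mult_right_mono B) auto
      also have "\<dots> = B * ?p * (cmod (U t) + cmod (U' t))"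
        by (simp add: algebra_simps)
      finally have "d\<^sup>2 \<le> (B * ?p * (cmod (U t) + cmod (U' t)))\<^sup>2"
        using d by (intro power_mono) auto
      also have "\<dots> = B\<^sup>2 * (t * t powr c) * (cmod (U t) + cmod (U' t))\<^sup>2"
        using t powr_half_square[of t "c + 1"] by (simp add: power_mult_distrib powr_add mult.commute)
      also have "\<dots> \<le> B\<^sup>2 * (t * t powr c) * (2 * ((cmod (U t))\<^sup>2 + (cmod (U' t))\<^sup>2))"
        using t sum_squares_bound[of "cmod (U t)" "cmod (U' t)"]
        by (intro mult_left_mono) (auto simp: power2_sum)
      also have "\<dots> = 2 * B\<^sup>2 * t * ?f t" by (simp add: algebra_simps)
      finally show ?thesis using t B by (simp add: field_simps)
    qed
    then show False
      using not_set_integrable_inverse_bound[OF f, of "d\<^sup>2 / (2 * B\<^sup>2)" "b / 2"] d b B by auto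
  qed
  then show ?thesis using L by simp
qed

text \<open>Multiplication by \<open>t powr (c - 1)\<close> intertwines the operators with parameters \<open>c\<close> and
  \<open>2 - c\<close>.\<close>

lemma leaf_sol_dual:
  assumes sol: "leaf_sol c U P v"
  shows "leaf_sol (2 - c) (\<lambda>t. of_real (t powr (c - 1)) * U t)
    (\<lambda>t. of_real (c - 1) * U t + of_real (t powr (1 - c)) * P t) (\<lambda>t. of_real (t powr (c - 1)) * v t)"
  unfolding leaf_sol_def
proof
  note S = leaf_solD[OF sol]
  \<comment> \<open>The new flux is t^(2-c) times the derivative of t^(c-1) U, which by the product
    rule is (c-1) U + t^(1-c) P.\<close>
  have "ac_deriv (\<lambda>t. of_real (t powr (c - 1)) * U t)
    (\<lambda>t. of_real (t powr (c - 1)) * (of_real (t powr (- c)) * P t) +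
      of_real ((c - 1) * t powr (c - 1 - 1)) * U t)"
    by (intro ac_deriv_mult ac_deriv_powr S)
  then show "ac_deriv (\<lambda>t. of_real (t powr (c - 1)) * U t)
    (\<lambda>t. of_real (t powr - (2 - c)) * (of_real (c - 1) * U t + of_real (t powr (1 - c)) * P t))"
  proof (rule ac_deriv_cong)
    fix t :: real assume t: "0 < t"
    have "t powr (c - 1) * t powr (- c) = t powr - (2 - c) * t powr (1 - c)"
      by (simp flip: powr_add)
    then have "complex_of_real (t powr (c - 1)) * of_real (t powr (- c)) =
        of_real (t powr - (2 - c)) * of_real (t powr (1 - c))"
      by (metis of_real_mult)
    moreover have "c - 1 - 1 = - (2 - c)" by simp
    ultimately show "of_real (t powr (c - 1)) * (of_real (t powr (- c)) * P t) +
      of_real ((c - 1) * t powr (c - 1 - 1)) * U t =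
      of_real (t powr - (2 - c)) * (of_real (c - 1) * U t + of_real (t powr (1 - c)) * P t)"
      by (simp only: distrib_left mult.assoc[symmetric] of_real_mult) (simp add: mult.commute)
  qed simp
  \<comment> \<open>The two terms in t^(-c) P carry the factors c - 1 and 1 - c and cancel, leaving
    only \<open>v\<close>.\<close>
  have "ac_deriv (\<lambda>t. of_real (c - 1) * U t + of_real (t powr (1 - c)) * P t)
    (\<lambda>t. of_real (c - 1) * (of_real (t powr (- c)) * P t) +
      (of_real (t powr (1 - c)) * (of_real (t powr c) * v t) +
       of_real ((1 - c) * t powr (1 - c - 1)) * P t))"
    by (intro ac_deriv_add ac_deriv_cmult ac_deriv_mult ac_deriv_powr S)
  then show "ac_deriv (\<lambda>t. of_real (c - 1) * U t + of_real (t powr (1 - c)) * P t)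
    (\<lambda>t. of_real (t powr (2 - c)) * (of_real (t powr (c - 1)) * v t))"
  proof (rule ac_deriv_cong)
    fix t :: real assume t: "0 < t"
    have "t powr (1 - c) * t powr c = t powr (2 - c) * t powr (c - 1)"
      by (simp flip: powr_add)
    then have "complex_of_real (t powr (1 - c)) * of_real (t powr c) =
        of_real (t powr (2 - c)) * of_real (t powr (c - 1))"
      by (metis of_real_mult)
    moreover have "1 - c - 1 = - c" by simp
    ultimately show "of_real (c - 1) * (of_real (t powr (- c)) * P t) +
      (of_real (t powr (1 - c)) * (of_real (t powr c) * v t) +
       of_real ((1 - c) * t powr (1 - c - 1)) * P t) =
      of_real (t powr (2 - c)) * (of_real (t powr (c - 1)) * v t)"
      by (simp only: mult.assoc[symmetric] of_real_mult) (simp add: algebra_simps)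
  qed simp
qed

text \<open>The exchange of c and 2 - c is isometric: t^(2-c) times the square of t^(c-1) is
  t^c.\<close>

lemma weighted_l2_dual:
  assumes "weighted_l2 c f"
  shows "weighted_l2 (2 - c) (\<lambda>t. of_real (t powr (c - 1)) * f t)"
proof -
  have "t powr (2 - c) * (cmod (of_real (t powr (c - 1)) * f t))\<^sup>2 = t powr c * (cmod (f t))\<^sup>2" for t
  proof -
    have "t powr (2 - c) * (t powr (c - 1))\<^sup>2 = t powr c"
      by (simp add: power2_eq_square flip: powr_add)
    then show ?thesis by (simp add: norm_mult power_mult_distrib flip: mult.assoc)
  qed
  moreover have "(\<lambda>t. of_real (t powr (c - 1)) * (indicator {0<..} t *\<^sub>R f t)) \<in> borel_measurable borel"
    using assms unfolding weighted_l2_def by (intro borel_measurable_times) auto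
  ultimately show ?thesis
    using assms by (simp add: weighted_l2_def)
qed

text \<open>The powers in the two factors multiply to 1, and the extra terms (c-1) U cnj U' cancel
  because c - 1 is real. Limits of Wronskians therefore transfer unchanged.\<close>

lemma wronskian_dual:
  assumes "0 < t"
  shows "wronskian (\<lambda>t. of_real (t powr (c - 1)) * U t)
    (\<lambda>t. of_real (c - 1) * U t + of_real (t powr (1 - c)) * P t)
    (\<lambda>t. of_real (t powr (c - 1)) * U' t)
    (\<lambda>t. of_real (c - 1) * U' t + of_real (t powr (1 - c)) * P' t) t = wronskian U P U' P' t"
proof -
  have "t powr (c - 1) * t powr (1 - c) = 1"
    using assms by (simp flip: powr_add)
  then have *: "complex_of_real (t powr (c - 1)) * of_real (t powr (1 - c)) = 1"
    by (metis of_real_1 of_real_mult)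
  have "wronskian (\<lambda>t. of_real (t powr (c - 1)) * U t)
    (\<lambda>t. of_real (c - 1) * U t + of_real (t powr (1 - c)) * P t)
    (\<lambda>t. of_real (t powr (c - 1)) * U' t)
    (\<lambda>t. of_real (c - 1) * U' t + of_real (t powr (1 - c)) * P' t) t =
    (complex_of_real (t powr (c - 1)) * of_real (t powr (1 - c))) * wronskian U P U' P' t"
    by (simp add: wronskian_def algebra_simps)
  then show ?thesis unfolding * by simp
qed

lemma wronskian_tendsto_at_top:
  assumes sol: "leaf_sol c U P v" "leaf_sol c U' P' v'"
    and l2: "weighted_l2 c U" "weighted_l2 c v" "weighted_l2 c U'" "weighted_l2 c v'"
  shows "(wronskian U P U' P' \<longlongrightarrow> 0) at_top"
proof (cases "0 \<le> c")
  case True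
  then show ?thesis by (rule wronskian_tendsto_at_top_nonneg[OF sol l2])
next
  case False
  then have "0 \<le> 2 - c" by simp
  from wronskian_tendsto_at_top_nonneg[OF sol[THEN leaf_sol_dual] l2[THEN weighted_l2_dual] this]
  show ?thesis
  proof (rule Lim_transform_eventually)
    show "\<forall>\<^sub>F t in at_top. wronskian (\<lambda>t. of_real (t powr (c - 1)) * U t)
      (\<lambda>t. of_real (c - 1) * U t + of_real (t powr (1 - c)) * P t)
      (\<lambda>t. of_real (t powr (c - 1)) * U' t)
      (\<lambda>t. of_real (c - 1) * U' t + of_real (t powr (1 - c)) * P' t) t = wronskian U P U' P' t"
      using eventually_gt_at_top[of 0] by eventually_elim (rule wronskian_dual)
  qed
qed

lemma wronskian_tendsto_at_0:
  assumes sol: "leaf_sol c U P v" "leaf_sol c U' P' v'"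
    and l2: "weighted_l2 c U" "weighted_l2 c v" "weighted_l2 c U'" "weighted_l2 c v'"
    and c: "c \<le> - 1 \<or> 3 \<le> c"
  shows "(wronskian U P U' P' \<longlongrightarrow> 0) (at_right 0)"
proof (cases "3 \<le> c")
  case True
  then show ?thesis by (rule wronskian_tendsto_at_0_ge_3[OF sol l2])
next
  case False
  then have "3 \<le> 2 - c" using c by simp
  from wronskian_tendsto_at_0_ge_3[OF sol[THEN leaf_sol_dual] l2[THEN weighted_l2_dual] this]
  show ?thesis
  proof (rule Lim_transform_eventually)
    show "\<forall>\<^sub>F t in at_right 0. wronskian (\<lambda>t. of_real (t powr (c - 1)) * U t)
      (\<lambda>t. of_real (c - 1) * U t + of_real (t powr (1 - c)) * P t)
      (\<lambda>t. of_real (t powr (c - 1)) * U' t)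
      (\<lambda>t. of_real (c - 1) * U' t + of_real (t powr (1 - c)) * P' t) t = wronskian U P U' P' t"
      using eventually_at_right_less[of 0] by eventually_elim (rule wronskian_dual)
  qed
qed


section \<open>The weighted measure\<close>

lemma borel_measurable_leaf_measure_iff:
  fixes f :: "real \<Rightarrow> 'a::real_normed_vector"
  shows "f \<in> borel_measurable (leaf_measure lam) \<longleftrightarrow>
    (\<lambda>t. indicator {0<..} t *\<^sub>R f t) \<in> borel_measurable borel"
proof -
  have "(borel_measurable (leaf_measure lam) :: (real \<Rightarrow> 'a) set) =
      borel_measurable (restrict_space lborel {0<..})"
    by (rule measurable_cong_sets) (simp_all add: leaf_measure_def)
  then show ?thesis
    by (simp add: borel_measurable_restrict_space_iff)
qed

lemma borel_measurable_powr_restrict: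
  "(\<lambda>t::real. t powr c) \<in> borel_measurable (restrict_space lborel {0<..})"
  by (simp add: measurable_restrict_space1)

lemma leaf_measure_integral_eq:
  fixes f :: "real \<Rightarrow> 'a::{banach, second_countable_topology}"
  assumes "f \<in> borel_measurable (leaf_measure lam)"
  shows "integrable (leaf_measure lam) f \<longleftrightarrow>
      set_integrable lborel {0<..} (\<lambda>t. t powr (1 / lam) *\<^sub>R f t)"
    and "(LINT t|leaf_measure lam. f t) = (LBINT t:{0<..}. t powr (1 / lam) *\<^sub>R f t)"
proof -
  have "f \<in> borel_measurable (restrict_space lborel {0<..})"
    using assms by (simp add: leaf_measure_def)
  note f = this borel_measurable_powr_restrict[of "1 / lam"]
  show "integrable (leaf_measure lam) f \<longleftrightarrow>
      set_integrable lborel {0<..} (\<lambda>t. t powr (1 / lam) *\<^sub>R f t)"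
    unfolding leaf_measure_def
    by (subst integrable_density[OF f]) (simp_all add: integrable_restrict_space set_integrable_def)
  show "(LINT t|leaf_measure lam. f t) = (LBINT t:{0<..}. t powr (1 / lam) *\<^sub>R f t)"
    unfolding leaf_measure_def
    by (subst integral_density[OF f]) (simp_all add: integral_restrict_space set_lebesgue_integral_def)
qed

text \<open>The density is strictly positive on the half-line, so its null sets there are the
  Lebesgue null sets.\<close>

lemma AE_leaf_measure: "(AE t in leaf_measure lam. Q t) \<longleftrightarrow> (AE t in lborel. 0 < t \<longrightarrow> Q t)"
proof -
  have "(AE t in leaf_measure lam. Q t) \<longleftrightarrow>
      (AE t in restrict_space lborel {0<..}. 0 < ennreal (t powr (1 / lam)) \<longrightarrow> Q t)"
    unfolding leaf_measure_def by (rule AE_density) (simp add: measurable_restrict_space1)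
  also have "\<dots> \<longleftrightarrow> (AE t in lborel. t \<in> {0<..} \<longrightarrow> 0 < ennreal (t powr (1 / lam)) \<longrightarrow> Q t)"
    by (rule AE_restrict_space_iff) simp
  also have "\<dots> \<longleftrightarrow> (AE t in lborel. 0 < t \<longrightarrow> Q t)"
    by (intro AE_cong) auto
  finally show ?thesis .
qed

lemma borel_measurable_indicator_cong:
  assumes "\<And>t. 0 < t \<Longrightarrow> f t = g t" "g \<in> borel_measurable borel"
  shows "(\<lambda>t::real. indicator {0<..} t *\<^sub>R (f t :: complex)) \<in> borel_measurable borel"
proof -
  have "(\<lambda>t. indicator {0<..} t *\<^sub>R g t) \<in> borel_measurable borel"
    by (rule borel_measurable_scaleR[OF borel_measurable_indicator assms(2)]) simp
  also have "(\<lambda>t. indicator {0<..} t *\<^sub>R g t) = (\<lambda>t. indicator {0<..} t *\<^sub>R f t)"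
    by (rule ext) (use assms(1) in \<open>auto simp: indicator_def\<close>)
  finally show ?thesis .
qed

lemma square_int_leaf_measure: "f \<in> square_int (leaf_measure lam) \<longleftrightarrow> weighted_l2 (1 / lam) f"
proof -
  have "integrable (leaf_measure lam) (\<lambda>t. (cmod (f t))\<^sup>2) \<longleftrightarrow>
      set_integrable lborel {0<..} (\<lambda>t. t powr (1 / lam) * (cmod (f t))\<^sup>2)"
    if "f \<in> borel_measurable (leaf_measure lam)"
    using that by (subst leaf_measure_integral_eq) auto
  then show ?thesis
    by (auto simp: square_int_def weighted_l2_def borel_measurable_leaf_measure_iff)
qed

lemma l2_inner_leaf_measure:
  assumes "f \<in> square_int (leaf_measure lam)" "g \<in> square_int (leaf_measure lam)"
  shows "l2_inner (leaf_measure lam) f g = (LBINT t:{0<..}. of_real (t powr (1 / lam)) * (f t * cnj (g t)))"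
proof -
  have "(\<lambda>t. f t * cnj (g t)) \<in> borel_measurable (leaf_measure lam)"
    using assms by (intro borel_measurable_times borel_measurable_cnj) (auto simp: square_int_def)
  then show ?thesis
    unfolding l2_inner_def by (subst leaf_measure_integral_eq) (auto simp: scaleR_conv_of_real)
qed

lemma integrable_mult_test_function:
  assumes k: "\<And>l u. 0 < l \<Longrightarrow> l < u \<Longrightarrow> set_integrable lborel {l..u} k"
    and m: "(\<lambda>t. indicator {0<..} t *\<^sub>R k t) \<in> borel_measurable borel"
    and \<phi>: "\<phi> \<in> test_functions"
  shows "integrable lborel (\<lambda>t. k t * \<phi> t)"
proof -
  obtain l u where lu: "0 < l" "l < u" "\<And>t. t \<notin> {l..u} \<Longrightarrow> \<phi> t = 0"
    using test_function_cases[OF \<phi>] by metis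
  have c: "continuous_on A \<phi>" for A
    by (rule smooth_continuous[OF test_functions_smooth[OF \<phi>]])
  obtain B where B: "\<And>t. t \<in> {l..u} \<Longrightarrow> cmod (\<phi> t) \<le> B"
    using continuous_on_Icc_bounded[OF c] by blast
  have "set_integrable lborel {l..u} (\<lambda>t. k t * \<phi> t)"
  proof (rule set_integrable_bound)
    show "set_integrable lborel {l..u} (\<lambda>t. of_real B * k t)"
      using k[OF lu(1,2)] by auto
    have "(\<lambda>t. (indicator {0<..} t *\<^sub>R k t) * \<phi> t) \<in> borel_measurable borel"
      by (intro borel_measurable_times m borel_measurable_continuous_onI c)
    then have "(\<lambda>t. indicator {0<..} t *\<^sub>R (k t * \<phi> t)) \<in> borel_measurable borel"
      by simp
    then show "set_borel_measurable lborel {l..u} (\<lambda>t. k t * \<phi> t)"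
      by (rule set_borel_measurable_restrict) (use lu in auto)
    show "AE t in lborel. t \<in> {l..u} \<longrightarrow> norm (k t * \<phi> t) \<le> norm (of_real B * k t)"
    proof (intro AE_I2 impI)
      fix t assume "t \<in> {l..u}"
      then have "cmod (\<phi> t) \<le> \<bar>B\<bar>" using B by fastforce
      then show "norm (k t * \<phi> t) \<le> norm (of_real B * k t)"
        by (simp add: norm_mult mult.commute mult_right_mono)
    qed
  qed
  moreover have "(\<lambda>t. indicator {l..u} t *\<^sub>R (k t * \<phi> t)) = (\<lambda>t. k t * \<phi> t)"
    using lu(3) by (auto simp: indicator_def)
  ultimately show ?thesis by (simp add: set_integrable_def)
qed

lemma weighted_l2_local:
  assumes f: "weighted_l2 c f" and s: "0 < s"
  shows "set_integrable lborel {s..t} (\<lambda>r. (cmod (f r))\<^sup>2)"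
    "set_integrable lborel {s..t} (\<lambda>r. of_real (r powr c) * f r)"
    "set_integrable lborel {s..t} f"
proof -
  have sub: "{s..t} \<in> sets borel" "{s..t} \<subseteq> {0<..}" using s by auto
  note fi = weighted_l2_integral_bound(1)[OF f sub]
  have fm: "(\<lambda>t. indicator {0<..} t *\<^sub>R f t) \<in> borel_measurable borel"
    using f by (simp add: weighted_l2_def)
  have "continuous_on {s..t} (\<lambda>r. r powr (- c))"
    using s by (intro continuous_intros) auto
  then obtain B where B: "\<And>r. r \<in> {s..t} \<Longrightarrow> norm (r powr (- c)) \<le> B"
    using continuous_on_Icc_bounded by blast
  have "(\<lambda>r. (cmod (indicator {0<..} r *\<^sub>R f r))\<^sup>2) \<in> borel_measurable borel"
    using fm by measurable
  then have m2: "(\<lambda>r. indicator {0<..} r *\<^sub>R (cmod (f r))\<^sup>2) \<in> borel_measurable borel"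
    by (rule measurable_cong[THEN iffD1, rotated]) (auto simp: indicator_def)
  show i2: "set_integrable lborel {s..t} (\<lambda>r. (cmod (f r))\<^sup>2)"
  proof (rule set_integrable_bound)
    show "set_integrable lborel {s..t} (\<lambda>r. B * (r powr c * (cmod (f r))\<^sup>2))"
      using fi by auto
    show "set_borel_measurable lborel {s..t} (\<lambda>r. (cmod (f r))\<^sup>2)"
      by (rule set_borel_measurable_restrict[OF m2 sub])
    show "AE r in lborel. r \<in> {s..t} \<longrightarrow> norm ((cmod (f r))\<^sup>2) \<le> norm (B * (r powr c * (cmod (f r))\<^sup>2))"
    proof (intro AE_I2 impI)
      fix r assume r: "r \<in> {s..t}"
      then have "r powr (- c) * r powr c = 1"
        using s by (simp flip: powr_add)
      then have "(cmod (f r))\<^sup>2 = r powr (- c) * (r powr c * (cmod (f r))\<^sup>2)"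
        by (simp flip: mult.assoc)
      also have "\<dots> \<le> B * (r powr c * (cmod (f r))\<^sup>2)"
        using B[OF r] by (intro mult_right_mono) auto
      finally show "norm ((cmod (f r))\<^sup>2) \<le> norm (B * (r powr c * (cmod (f r))\<^sup>2))" by simp
    qed
  qed
  show i1: "set_integrable lborel {s..t} f"
  proof (rule set_integrable_bound)
    show "set_integrable lborel {s..t} (\<lambda>r. 1 + (cmod (f r))\<^sup>2)"
      by (intro set_integral_add i2 borel_integrable_atLeastAtMost') auto
    show "set_borel_measurable lborel {s..t} f"
      by (rule set_borel_measurable_restrict[OF fm sub])
    show "AE r in lborel. r \<in> {s..t} \<longrightarrow> norm (f r) \<le> norm (1 + (cmod (f r))\<^sup>2)"
      using le_one_plus_square by (intro AE_I2 impI) simp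
  qed
  have "continuous_on {s..t} (\<lambda>r. r powr c)"
    using s by (intro continuous_intros) auto
  then obtain B' where B': "\<And>r. r \<in> {s..t} \<Longrightarrow> norm (r powr c) \<le> B'"
    using continuous_on_Icc_bounded by blast
  show "set_integrable lborel {s..t} (\<lambda>r. of_real (r powr c) * f r)"
  proof (rule set_integrable_bound)
    show "set_integrable lborel {s..t} (\<lambda>r. of_real B' * f r)"
      using i1 by auto
    have "(\<lambda>r. of_real (r powr c) * (indicator {0<..} r *\<^sub>R f r)) \<in> borel_measurable borel"
      using fm by (intro borel_measurable_times) auto
    then have "(\<lambda>r. indicator {0<..} r *\<^sub>R (of_real (r powr c) * f r)) \<in> borel_measurable borel"
      by simp
    then show "set_borel_measurable lborel {s..t} (\<lambda>r. of_real (r powr c) * f r)"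
      by (rule set_borel_measurable_restrict[OF _ sub])
    show "AE r in lborel. r \<in> {s..t} \<longrightarrow> norm (of_real (r powr c) * f r) \<le> norm (of_real B' * f r)"
      using B' by (intro AE_I2 impI) (fastforce simp: norm_mult intro!: mult_right_mono)
  qed
qed

text \<open>Subtracting from \<open>f\<close> a suitable multiple of one \<open>g\<close> with
  \<open>l g\<close> nonzero lands in the kernel of \<open>l\<close>. The forms live on a set of
  functions, not on a whole type, so linearity is stated through the single operation f + k
  g.\<close>

lemma functional_multiple:
  fixes L l :: "(real \<Rightarrow> complex) \<Rightarrow> complex"
  assumes V: "\<And>f g k. f \<in> V \<Longrightarrow> g \<in> V \<Longrightarrow> (\<lambda>t. f t + k * g t) \<in> V"
    and L: "\<And>f g k. f \<in> V \<Longrightarrow> g \<in> V \<Longrightarrow> L (\<lambda>t. f t + k * g t) = L f + k * L g"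
    and l: "\<And>f g k. f \<in> V \<Longrightarrow> g \<in> V \<Longrightarrow> l (\<lambda>t. f t + k * g t) = l f + k * l g"
    and ker: "\<And>f. f \<in> V \<Longrightarrow> l f = 0 \<Longrightarrow> L f = 0"
  shows "\<exists>A. \<forall>f\<in>V. L f = A * l f"
proof (cases "\<forall>f\<in>V. l f = 0")
  case True
  then show ?thesis using ker by (intro exI[of _ 0]) auto
next
  case False
  then obtain g where g: "g \<in> V" "l g \<noteq> 0" by blast
  have "L f = L g / l g * l f" if f: "f \<in> V" for f
  proof -
    let ?h = "\<lambda>t. f t + (- (l f / l g)) * g t"
    have "l ?h = 0" unfolding l[OF f g(1)] using g(2) by simp
    with V[OF f g(1)] have "L ?h = 0" by (intro ker)
    then have "L f + (- (l f / l g)) * L g = 0" unfolding L[OF f g(1)] .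
    then show ?thesis by (simp add: algebra_simps)
  qed
  then show ?thesis by blast
qed


section \<open>Regularity of the adjoint\<close>

lemma test_function_integral_deriv:
  assumes "\<phi> \<in> test_functions" "\<phi>' \<in> test_functions" "\<And>t. (\<phi> has_vector_derivative \<phi>' t) (at t)"
  shows "(LINT t|lborel. \<phi>' t) = 0"
proof -
  obtain l u where lu: "0 < l" "l < u" "\<And>t. t \<notin> {l..u} \<Longrightarrow> \<phi> t = 0"
    using test_function_cases[OF assms(1)] by metis
  obtain l' u' where lu': "0 < l'" "l' < u'" "\<And>t. t \<notin> {l'..u'} \<Longrightarrow> \<phi>' t = 0"
    using test_function_cases[OF assms(2)] by metis
  define a where "a = min l l' / 2"
  define b where "b = max u u' + 1"
  have ab: "0 < a" "a < l" "a < l'" "u < b" "u' < b" "a \<le> b"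
    using lu lu' by (auto simp: a_def b_def min_def)
  have "ac_deriv \<phi> \<phi>'"
    by (rule ac_deriv_C1[OF assms(3) smooth_continuous[OF test_functions_smooth[OF assms(2)]]])
  from ac_derivD(2)[OF this ab(1,6)] have "(LBINT t:{a..b}. \<phi>' t) = 0"
    using lu(3)[of a] lu(3)[of b] ab by simp
  moreover have "(\<lambda>t. indicator {a..b} t *\<^sub>R \<phi>' t) = \<phi>'"
  proof (rule ext)
    fix t
    show "indicator {a..b} t *\<^sub>R \<phi>' t = \<phi>' t"
      using lu'(3)[of t] ab by (cases "t \<in> {a..b}") auto
  qed
  ultimately show ?thesis by (simp add: set_lebesgue_integral_def)
qed

text \<open>Here \<open>\<phi>\<close> solves \<open>(t powr c \<phi>')' = \<psi>\<close>; the two moment conditions on \<open>\<psi>\<close> are exactly the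
  conditions for compact support of the flux \<open>\<Psi>\<close> and of \<open>\<phi>\<close>.\<close>

lemma test_function_solve:
  assumes \<psi>: "\<psi> \<in> test_functions" and c: "c \<noteq> 1"
    and m0: "(LINT t|lborel. \<psi> t) = 0" and m1: "(LINT t|lborel. of_real (t powr (1 - c)) * \<psi> t) = 0"
  obtains \<phi> \<Psi> where "\<phi> \<in> test_functions" "\<Psi> \<in> test_functions"
    "\<And>t. (\<Psi> has_vector_derivative \<psi> t) (at t)"
    "\<And>t. (\<phi> has_vector_derivative of_real (t powr (- c)) * \<Psi> t) (at t)"
proof -
  obtain \<Psi> where \<Psi>: "\<Psi> \<in> test_functions" "\<And>t. (\<Psi> has_vector_derivative \<psi> t) (at t)"
    using test_function_primitive[OF \<psi> m0] by blast
  let ?\<chi> = "\<lambda>t. of_real (t powr (- c)) * \<Psi> t"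
  have \<chi>: "?\<chi> \<in> test_functions" by (rule test_functions_powr[OF \<Psi>(1)])
  \<comment> \<open>An auxiliary function for integration by parts: its derivative has integral 0
    and equals (1-c) t^(-c) \<Psi> + t^(1-c) \<psi>. Thus \<open>m1\<close> and c \<noteq> 1 give
    t^(-c) \<Psi> mean zero, which is what its primitive \<open>\<phi>\<close> needs for compact
    support.\<close>
  let ?h = "\<lambda>t. of_real (t powr (1 - c)) * \<Psi> t"
  let ?h' = "\<lambda>t. of_real (1 - c) * ?\<chi> t + of_real (t powr (1 - c)) * \<psi> t"
  obtain l u where lu: "0 < l" "l < u" "\<And>t. t \<notin> {l..u} \<Longrightarrow> \<Psi> t = 0"
    using test_function_cases[OF \<Psi>(1)] by metis
  obtain l' u' where lu': "0 < l'" "l' < u'" "\<And>t. t \<notin> {l'..u'} \<Longrightarrow> \<psi> t = 0"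
    using test_function_cases[OF \<psi>] by metis
  have deriv: "(?h has_vector_derivative ?h' t) (at t)" for t
  proof (cases "t > 0")
    case True
    then have "((\<lambda>t. t powr (1 - c)) has_real_derivative (1 - c) * t powr (- c)) (at t)"
      by (auto intro!: derivative_eq_intros)
    then have "((\<lambda>t. of_real (t powr (1 - c))) has_vector_derivative
        complex_of_real ((1 - c) * t powr (- c))) (at t)"
      by (intro has_vector_derivative_of_real)
    from has_vector_derivative_mult[OF this \<Psi>(2)] show ?thesis
      by (simp add: algebra_simps)
  next
    case False
    have "\<Psi> t = 0" "\<psi> t = 0" using False lu(1) lu'(1) lu(3)[of t] lu'(3)[of t] by auto
    then have "((\<lambda>_. 0) has_vector_derivative ?h' t) (at t)" by simp
    then show ?thesis
    proof (rule has_vector_derivative_transform_within_open[of _ _ _ "{..<l}"])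
      show "t \<in> {..<l}" using False lu(1) by auto
      show "0 = ?h s" if "s \<in> {..<l}" for s using lu(3)[of s] that by auto
    qed simp
  qed
  have h: "?h \<in> test_functions" by (rule test_functions_powr[OF \<Psi>(1)])
  have \<psi>': "(\<lambda>t. of_real (t powr (1 - c)) * \<psi> t) \<in> test_functions"
    by (rule test_functions_powr[OF \<psi>])
  have c\<chi>: "(\<lambda>t. of_real (1 - c) * ?\<chi> t) \<in> test_functions"
    by (rule test_functions_cmult[OF \<chi>])
  have "(LINT t|lborel. ?h' t) = 0"
    by (rule test_function_integral_deriv[OF h test_functions_add[OF c\<chi> \<psi>'] deriv])
  also have "(LINT t|lborel. ?h' t) =
      (LINT t|lborel. of_real (1 - c) * ?\<chi> t) + (LINT t|lborel. of_real (t powr (1 - c)) * \<psi> t)"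
    by (rule Bochner_Integration.integral_add[OF integrable_test_function[OF c\<chi>]
          integrable_test_function[OF \<psi>']])
  also have "\<dots> = of_real (1 - c) * (LINT t|lborel. ?\<chi> t)"
    unfolding m1 integral_mult_right_zero by simp
  finally have "(LINT t|lborel. ?\<chi> t) = 0" using c by simp
  from test_function_primitive[OF \<chi> this]
  obtain \<phi> where "\<phi> \<in> test_functions" "\<And>t. (\<phi> has_vector_derivative ?\<chi> t) (at t)"
    by blast
  then show ?thesis using that \<Psi> by blast
qed

lemma leaf_laplacian_solve:
  assumes \<Psi>: "\<And>t. (\<Psi> has_vector_derivative \<psi> t) (at t)"
    and \<phi>: "\<And>t. (\<phi> has_vector_derivative of_real (t powr (- (1 / lam))) * \<Psi> t) (at t)"
    and t: "0 < t"
  shows "leaf_laplacian lam \<phi> t = of_real (t powr (- (1 / lam))) * \<psi> t"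
proof -
  let ?c = "1 / lam"
  have D: "(\<lambda>s. vector_derivative \<phi> (at s)) = (\<lambda>t. of_real (t powr (- ?c)) * \<Psi> t)"
    by (rule ext) (rule vector_derivative_at[OF \<phi>])
  have "((\<lambda>t. t powr (- ?c)) has_real_derivative (- ?c) * t powr (- ?c - 1)) (at t)"
    using t by (auto intro!: derivative_eq_intros)
  then have "((\<lambda>t. of_real (t powr (- ?c))) has_vector_derivative
      complex_of_real ((- ?c) * t powr (- ?c - 1))) (at t)"
    by (intro has_vector_derivative_of_real)
  from vector_derivative_at[OF has_vector_derivative_mult[OF this \<Psi>]]
  have D2: "vector_derivative (\<lambda>s. vector_derivative \<phi> (at s)) (at t) =
      of_real (t powr (- ?c)) * \<psi> t + of_real ((- ?c) * t powr (- ?c - 1)) * \<Psi> t"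
    unfolding D .
  have "leaf_laplacian lam \<phi> t = of_real (t powr (- ?c)) * \<psi> t +
      of_real ((- ?c) * t powr (- ?c - 1)) * \<Psi> t +
      of_real (1 / (lam * t)) * (of_real (t powr (- ?c)) * \<Psi> t)"
    unfolding leaf_laplacian_def D2 unfolding vector_derivative_at[OF \<phi>] ..
  moreover have "1 / (lam * t) * t powr (- ?c) = ?c * t powr (- ?c - 1)"
    using t by (simp add: powr_diff)
  then have "of_real (1 / (lam * t)) * (of_real (t powr (- ?c)) * \<Psi> t) =
      of_real (?c * t powr (- ?c - 1)) * \<Psi> t"
    by (metis mult.assoc of_real_mult)
  ultimately show ?thesis by simp
qed

lemma weighted_l2_test_function:
  assumes "\<phi> \<in> test_functions"
  shows "weighted_l2 c \<phi>"
proof -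
  obtain l u where lu: "0 < l" "l < u" "\<And>t. t \<notin> {l..u} \<Longrightarrow> \<phi> t = 0"
    using test_function_cases[OF assms] by metis
  have cont: "continuous_on A \<phi>" for A
    by (rule smooth_continuous[OF test_functions_smooth[OF assms]])
  have "set_integrable lborel {l..u} (\<lambda>t. t powr c * (cmod (\<phi> t))\<^sup>2)"
    using lu(1) by (intro borel_integrable_atLeastAtMost' continuous_intros cont) auto
  moreover have "(\<lambda>t. indicator {l..u} t *\<^sub>R (t powr c * (cmod (\<phi> t))\<^sup>2)) =
      (\<lambda>t. indicator {0<..} t *\<^sub>R (t powr c * (cmod (\<phi> t))\<^sup>2))"
  proof (rule ext)
    fix t
    show "indicator {l..u} t *\<^sub>R (t powr c * (cmod (\<phi> t))\<^sup>2) =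
        indicator {0<..} t *\<^sub>R (t powr c * (cmod (\<phi> t))\<^sup>2)"
      using lu(1) lu(3)[of t] by (cases "t \<in> {l..u}") (auto simp: indicator_def)
  qed
  ultimately have "set_integrable lborel {0<..} (\<lambda>t. t powr c * (cmod (\<phi> t))\<^sup>2)"
    unfolding set_integrable_def by (simp only:)
  then show ?thesis
    unfolding weighted_l2_def
    using borel_measurable_indicator_cong[OF refl borel_measurable_continuous_onI[OF cont]] by blast
qed

lemma leaf_operatorI:
  assumes "\<phi> \<in> test_functions" "g \<in> test_functions" "\<And>t. 0 < t \<Longrightarrow> leaf_laplacian lam \<phi> t = g t"
  shows "(\<phi>, g) \<in> leaf_operator lam"
  using assms by (auto simp: leaf_operator_def square_int_leaf_measure weighted_l2_test_function
      AE_leaf_measure)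

lemma integral_positive_test_function:
  assumes "\<phi> \<in> test_functions"
  shows "(LBINT t:{0<..}. f t * \<phi> t) = (LINT t|lborel. f t * \<phi> t)"
proof -
  obtain l u where lu: "0 < l" "l < u" "\<And>t. t \<notin> {l..u} \<Longrightarrow> \<phi> t = 0"
    using test_function_cases[OF assms] by metis
  have "indicator {0<..} t *\<^sub>R (f t * \<phi> t) = f t * \<phi> t" for t
    using lu(1) lu(3)[of t] by (cases "t > 0") auto
  then show ?thesis by (simp add: set_lebesgue_integral_def)
qed

lemma borel_measurable_indicator_continuous:
  fixes f :: "real \<Rightarrow> complex"
  assumes "continuous_on {0<..} f"
  shows "(\<lambda>t. indicator {0<..} t *\<^sub>R f t) \<in> borel_measurable borel"
  by (rule borel_measurable_continuous_on_indicator[OF _ assms]) simp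

text \<open>The moment conditions allow \<psi> = (t^c \<phi>')' with a test function
  \<open>\<phi>\<close>. The adjoint relation then turns the pairing of \<open>u\<close> with
  \<open>\<psi>\<close> into that of \<open>v\<close> with \<open>\<phi>\<close>; Green's formula on
  an interval containing all supports does the same for \<open>U0\<close>, without boundary
  terms.\<close>

lemma leaf_adjoint_green:
  assumes uv: "(u, v) \<in> l2_adjoint (leaf_measure lam) (leaf_operator lam)" and c1: "1 / lam \<noteq> 1"
    and sol0: "leaf_sol (1 / lam) U0 P0 v"
    and \<psi>: "\<psi> \<in> test_functions" and m0: "(LINT t|lborel. \<psi> t) = 0"
    and m1: "(LINT t|lborel. of_real (t powr (1 - 1 / lam)) * \<psi> t) = 0"
  shows "(LINT t|lborel. cnj (u t) * \<psi> t) = (LINT t|lborel. cnj (U0 t) * \<psi> t)"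
proof -
  define c where "c = 1 / lam"
  have sq: "u \<in> square_int (leaf_measure lam)" "v \<in> square_int (leaf_measure lam)"
    using uv by (auto simp: l2_adjoint_def)
  then have v: "weighted_l2 c v"
    by (auto simp: square_int_leaf_measure c_def)
  obtain \<phi> \<Psi> where \<phi>: "\<phi> \<in> test_functions" and \<Psi>: "\<Psi> \<in> test_functions"
    and D\<Psi>: "\<And>t. (\<Psi> has_vector_derivative \<psi> t) (at t)"
    and D\<phi>: "\<And>t. (\<phi> has_vector_derivative of_real (t powr (- (1 / lam))) * \<Psi> t) (at t)"
    using test_function_solve[OF \<psi> c1 m0 m1] by metis
  define g where "g t = of_real (t powr (- c)) * \<psi> t" for t
  have g: "g \<in> test_functions" unfolding g_def by (rule test_functions_powr[OF \<psi>])
  have cg: "complex_of_real (t powr c) * g t = \<psi> t" if "0 < t" for t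
  proof -
    have "t powr c * t powr (- c) = 1" using that by (simp flip: powr_add)
    then have "complex_of_real (t powr c) * of_real (t powr (- c)) = 1"
      by (metis of_real_1 of_real_mult)
    then show ?thesis unfolding g_def by (metis mult.assoc mult_1)
  qed
  have op: "(\<phi>, g) \<in> leaf_operator lam"
    by (rule leaf_operatorI[OF \<phi> g]) (simp add: leaf_laplacian_solve[OF D\<Psi> D\<phi>] g_def c_def)
  then have gsq: "\<phi> \<in> square_int (leaf_measure lam)" "g \<in> square_int (leaf_measure lam)"
    by (auto simp: leaf_operator_def)
  have "l2_inner (leaf_measure lam) g u = l2_inner (leaf_measure lam) \<phi> v"
    using uv op by (auto simp: l2_adjoint_def)
  then have "(LBINT t:{0<..}. of_real (t powr c) * (g t * cnj (u t))) =
      (LBINT t:{0<..}. of_real (t powr c) * (\<phi> t * cnj (v t)))"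
    by (simp add: l2_inner_leaf_measure gsq sq c_def)
  also have "(LBINT t:{0<..}. of_real (t powr c) * (g t * cnj (u t))) = (LBINT t:{0<..}. cnj (u t) * \<psi> t)"
    by (rule set_lebesgue_integral_cong) (auto simp: cg[symmetric] ac_simps)
  also have "\<dots> = (LINT t|lborel. cnj (u t) * \<psi> t)"
    by (rule integral_positive_test_function[OF \<psi>])
  also have "(LBINT t:{0<..}. of_real (t powr c) * (\<phi> t * cnj (v t))) =
      (LBINT t:{0<..}. (of_real (t powr c) * cnj (v t)) * \<phi> t)"
    by (rule set_lebesgue_integral_cong) (auto simp: ac_simps)
  also have "\<dots> = (LINT t|lborel. (of_real (t powr c) * cnj (v t)) * \<phi> t)"
    by (rule integral_positive_test_function[OF \<phi>])
  finally have 1: "(LINT t|lborel. cnj (u t) * \<psi> t) = (LINT t|lborel. (of_real (t powr c) * cnj (v t)) * \<phi> t)" .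
  have \<Psi>c: "continuous_on A \<Psi>" and \<psi>c: "continuous_on A \<psi>" for A
    by (rule smooth_continuous[OF test_functions_smooth[OF \<Psi>]] smooth_continuous[OF test_functions_smooth[OF \<psi>]])+
  have "ac_deriv \<phi> (\<lambda>t. of_real (t powr (- c)) * \<Psi> t)"
    by (rule ac_deriv_C1) (use D\<phi> in \<open>auto simp: c_def intro!: continuous_intros \<Psi>c\<close>)
  moreover have "ac_deriv \<Psi> (\<lambda>t. of_real (t powr c) * g t)"
    by (rule ac_deriv_cong[OF ac_deriv_C1[OF D\<Psi> \<psi>c] refl]) (simp add: cg)
  ultimately have "leaf_sol c \<phi> \<Psi> g" by (simp add: leaf_sol_def)
  note W = leaf_sol_wronskian[OF this sol0[folded c_def]]
  obtain l u1 where lu: "0 < l" "l < u1" "\<And>t. t \<notin> {l..u1} \<Longrightarrow> \<phi> t = 0"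
    using test_function_cases[OF \<phi>] by metis
  obtain l' u' where lu': "0 < l'" "l' < u'" "\<And>t. t \<notin> {l'..u'} \<Longrightarrow> \<Psi> t = 0"
    using test_function_cases[OF \<Psi>] by metis
  obtain l'' u'' where lu'': "0 < l''" "l'' < u''" "\<And>t. t \<notin> {l''..u''} \<Longrightarrow> \<psi> t = 0"
    using test_function_cases[OF \<psi>] by metis
  define a where "a = min l (min l' l'') / 2"
  define b where "b = max u1 (max u' u'') + 1"
  have ab: "0 < a" "a < l" "a < l'" "a < l''" "u1 < b" "u' < b" "u'' < b" "a \<le> b"
    using lu lu' lu'' by (auto simp: a_def b_def min_def)
  have z: "\<phi> t = 0" "\<Psi> t = 0" "\<psi> t = 0" if "t \<le> a \<or> b \<le> t" for t
    using that ab lu(3)[of t] lu'(3)[of t] lu''(3)[of t] by auto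
  have "(LBINT t:{a..b}. of_real (t powr c) * (\<phi> t * cnj (v t) - g t * cnj (U0 t))) = 0"
    using ac_derivD(2)[OF W ab(1,8)] by (simp add: wronskian_def z)
  also have "(LBINT t:{a..b}. of_real (t powr c) * (\<phi> t * cnj (v t) - g t * cnj (U0 t))) =
      (LINT t|lborel. (of_real (t powr c) * cnj (v t)) * \<phi> t - cnj (U0 t) * \<psi> t)"
    unfolding set_lebesgue_integral_def
  proof (rule Bochner_Integration.integral_cong[OF refl])
    fix t
    show "indicator {a..b} t *\<^sub>R (of_real (t powr c) * (\<phi> t * cnj (v t) - g t * cnj (U0 t))) =
      (of_real (t powr c) * cnj (v t)) * \<phi> t - cnj (U0 t) * \<psi> t"
    proof (cases "t \<in> {a..b}")
      case True
      then have "0 < t" using ab by auto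
      with True show ?thesis by (simp add: cg[symmetric] algebra_simps)
    next
      case False
      then have "\<phi> t = 0" "\<psi> t = 0" using z[of t] by auto
      with False show ?thesis by simp
    qed
  qed
  also have "\<dots> = (LINT t|lborel. (of_real (t powr c) * cnj (v t)) * \<phi> t) - (LINT t|lborel. cnj (U0 t) * \<psi> t)"
  proof (rule Bochner_Integration.integral_diff)
    show "integrable lborel (\<lambda>t. (of_real (t powr c) * cnj (v t)) * \<phi> t)"
    proof (rule integrable_mult_test_function[OF _ _ \<phi>])
      fix s t :: real assume "0 < s" "s < t"
      then show "set_integrable lborel {s..t} (\<lambda>t. of_real (t powr c) * cnj (v t))"
        using ac_derivD(1)[OF ac_deriv_cnj[OF leaf_solD(2)[OF sol0]], of s t] by (simp add: c_def)
    next
      have "(\<lambda>t. of_real (t powr c) * cnj (indicator {0<..} t *\<^sub>R v t)) \<in> borel_measurable borel"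
        using v unfolding weighted_l2_def by (intro borel_measurable_times borel_measurable_cnj) auto
      then show "(\<lambda>t. indicator {0<..} t *\<^sub>R (of_real (t powr c) * cnj (v t))) \<in> borel_measurable borel"
        by simp
    qed
    show "integrable lborel (\<lambda>t. cnj (U0 t) * \<psi> t)"
    proof (rule integrable_mult_test_function[OF _ _ \<psi>])
      have c: "continuous_on {0<..} (\<lambda>t. cnj (U0 t))"
        by (intro continuous_intros leaf_solD(3)[OF sol0])
      then show "(\<lambda>t. indicator {0<..} t *\<^sub>R cnj (U0 t)) \<in> borel_measurable borel"
        by (rule borel_measurable_indicator_continuous)
      fix s t :: real assume "0 < s" "s < t"
      then show "set_integrable lborel {s..t} (\<lambda>t. cnj (U0 t))"
        by (intro borel_integrable_atLeastAtMost' continuous_on_subset[OF c]) auto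
    qed
  qed
  finally show ?thesis using 1 by simp
qed

text \<open>The one-form case is applied twice: on the kernel of \<open>l1\<close> it yields the
  coefficient of \<open>l2\<close>, and then L - B l2 vanishes on that kernel.\<close>

lemma functional_in_span2:
  fixes L l1 l2 :: "(real \<Rightarrow> complex) \<Rightarrow> complex"
  assumes V: "\<And>f g k. f \<in> V \<Longrightarrow> g \<in> V \<Longrightarrow> (\<lambda>t. f t + k * g t) \<in> V"
    and L: "\<And>f g k. f \<in> V \<Longrightarrow> g \<in> V \<Longrightarrow> L (\<lambda>t. f t + k * g t) = L f + k * L g"
    and l1: "\<And>f g k. f \<in> V \<Longrightarrow> g \<in> V \<Longrightarrow> l1 (\<lambda>t. f t + k * g t) = l1 f + k * l1 g"
    and l2: "\<And>f g k. f \<in> V \<Longrightarrow> g \<in> V \<Longrightarrow> l2 (\<lambda>t. f t + k * g t) = l2 f + k * l2 g"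
    and ker: "\<And>f. f \<in> V \<Longrightarrow> l1 f = 0 \<Longrightarrow> l2 f = 0 \<Longrightarrow> L f = 0"
  shows "\<exists>A B. \<forall>f\<in>V. L f = A * l1 f + B * l2 f"
proof -
  have "\<exists>B. \<forall>f\<in>{f \<in> V. l1 f = 0}. L f = B * l2 f"
    by (rule functional_multiple) (simp_all add: V L l1 l2 ker)
  then obtain B where B: "\<And>f. f \<in> V \<Longrightarrow> l1 f = 0 \<Longrightarrow> L f = B * l2 f" by blast
  have "\<exists>A. \<forall>f\<in>V. L f - B * l2 f = A * l1 f"
    by (rule functional_multiple) (simp_all add: V L l1 l2 B algebra_simps)
  then obtain A where "\<And>f. f \<in> V \<Longrightarrow> L f - B * l2 f = A * l1 f" by blast
  then show ?thesis by (metis diff_eq_eq)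
qed

text \<open>A du Bois-Reymond argument. \<open>U0\<close> is any solution obtained by two
  integrations of \<open>v\<close>; the difference of \<open>u\<close> and \<open>U0\<close>, as a
  functional, vanishes on test functions with both moments zero, so it is a combination of the two
  moments and \<open>u\<close> is \<open>U0\<close> plus a homogeneous solution almost
  everywhere.\<close>

lemma leaf_adjoint_regular:
  assumes uv: "(u, v) \<in> l2_adjoint (leaf_measure lam) (leaf_operator lam)" and c1: "1 / lam \<noteq> 1"
  obtains U P where "leaf_sol (1 / lam) U P v" "AE t in lborel. 0 < t \<longrightarrow> u t = U t"
    "weighted_l2 (1 / lam) U"
proof -
  define c where "c = 1 / lam"
  have sq: "u \<in> square_int (leaf_measure lam)" "v \<in> square_int (leaf_measure lam)"
    using uv by (auto simp: l2_adjoint_def)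
  then have u: "weighted_l2 c u" and v: "weighted_l2 c v"
    by (auto simp: square_int_leaf_measure c_def)
  have um: "(\<lambda>t. indicator {0<..} t *\<^sub>R u t) \<in> borel_measurable borel"
    using u by (simp add: weighted_l2_def)
  obtain P0 where P0: "ac_deriv P0 (\<lambda>t. of_real (t powr c) * v t)"
    using ac_deriv_exists[OF weighted_l2_local(2)[OF v]] by blast
  have "set_integrable lborel {s..t} (\<lambda>t. of_real (t powr (- c)) * P0 t)" if "0 < s" for s t
    using that by (intro borel_integrable_atLeastAtMost' continuous_intros
        continuous_on_subset[OF ac_deriv_continuous[OF P0]]) auto
  then obtain U0 where U0: "ac_deriv U0 (\<lambda>t. of_real (t powr (- c)) * P0 t)"
    using ac_deriv_exists[of "\<lambda>t. of_real (t powr (- c)) * P0 t"] by blast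
  have sol0: "leaf_sol c U0 P0 v" using U0 P0 by (simp add: leaf_sol_def)
  have U0c: "continuous_on {0<..} (\<lambda>t. cnj (U0 t))"
    by (intro continuous_intros ac_deriv_continuous[OF U0])
  let ?h = "\<lambda>t. complex_of_real (t powr (1 - c))"
  have iu: "integrable lborel (\<lambda>t. cnj (u t) * \<psi> t)" if "\<psi> \<in> test_functions" for \<psi>
  proof (rule integrable_mult_test_function[OF _ _ that])
    have "(\<lambda>t. cnj (indicator {0<..} t *\<^sub>R u t)) \<in> borel_measurable borel"
      by (rule borel_measurable_cnj[OF um])
    then show "(\<lambda>t. indicator {0<..} t *\<^sub>R cnj (u t)) \<in> borel_measurable borel" by simp
    fix s t :: real assume "0 < s" "s < t"
    then show "set_integrable lborel {s..t} (\<lambda>t. cnj (u t))"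
      using weighted_l2_local(3)[OF u, of s t] complex_integrable_cnj
      unfolding set_integrable_def by (simp flip: complex_cnj_scaleR)
  qed
  have iU: "integrable lborel (\<lambda>t. cnj (U0 t) * \<psi> t)" if "\<psi> \<in> test_functions" for \<psi>
  proof (rule integrable_mult_test_function[OF _ _ that])
    show "(\<lambda>t. indicator {0<..} t *\<^sub>R cnj (U0 t)) \<in> borel_measurable borel"
      by (rule borel_measurable_indicator_continuous[OF U0c])
    fix s t :: real assume "0 < s" "s < t"
    then show "set_integrable lborel {s..t} (\<lambda>t. cnj (U0 t))"
      by (intro borel_integrable_atLeastAtMost' continuous_on_subset[OF U0c]) auto
  qed
  note i1 = integrable_test_function and i2 = integrable_test_function[OF test_functions_powr]
  define L where "L \<psi> = (LINT t|lborel. cnj (u t) * \<psi> t) - (LINT t|lborel. cnj (U0 t) * \<psi> t)" for \<psi>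
  have lin: "(LINT t|lborel. k t * (f t + z * g t)) = (LINT t|lborel. k t * f t) + z * (LINT t|lborel. k t * g t)"
    if "integrable lborel (\<lambda>t. k t * f t)" "integrable lborel (\<lambda>t. k t * g t)"
    for k f g :: "real \<Rightarrow> complex" and z
  proof -
    have "(LINT t|lborel. k t * (f t + z * g t)) = (LINT t|lborel. k t * f t + z * (k t * g t))"
      by (simp add: algebra_simps)
    also have "\<dots> = (LINT t|lborel. k t * f t) + (LINT t|lborel. z * (k t * g t))"
      using that by (intro Bochner_Integration.integral_add) auto
    finally show ?thesis by simp
  qed
  have "\<exists>A B. \<forall>\<psi>\<in>test_functions. L \<psi> = A * (LINT t|lborel. 1 * \<psi> t) + B * (LINT t|lborel. ?h t * \<psi> t)"
  proof (rule functional_in_span2)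
    fix f g :: "real \<Rightarrow> complex" and k
    assume fg: "f \<in> test_functions" "g \<in> test_functions"
    show "(\<lambda>t. f t + k * g t) \<in> test_functions"
      by (rule test_functions_add[OF fg(1) test_functions_cmult[OF fg(2)]])
    show "(LINT t|lborel. 1 * (f t + k * g t)) = (LINT t|lborel. 1 * f t) + k * (LINT t|lborel. 1 * g t)"
      by (rule lin) (simp_all add: i1 fg)
    show "(LINT t|lborel. ?h t * (f t + k * g t)) = (LINT t|lborel. ?h t * f t) + k * (LINT t|lborel. ?h t * g t)"
      by (rule lin) (rule i2 fg)+
    show "L (\<lambda>t. f t + k * g t) = L f + k * L g"
      unfolding L_def lin[OF iu[OF fg(1)] iu[OF fg(2)]] lin[OF iU[OF fg(1)] iU[OF fg(2)]]
      by (simp add: algebra_simps)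
  next
    fix \<psi> :: "real \<Rightarrow> complex"
    assume "\<psi> \<in> test_functions" "(LINT t|lborel. 1 * \<psi> t) = 0" "(LINT t|lborel. ?h t * \<psi> t) = 0"
    then show "L \<psi> = 0"
      using leaf_adjoint_green[OF uv c1 sol0[unfolded c_def], of \<psi>] by (simp add: L_def c_def)
  qed
  then obtain A B where AB: "\<And>\<psi>. \<psi> \<in> test_functions \<Longrightarrow>
      L \<psi> = A * (LINT t|lborel. \<psi> t) + B * (LINT t|lborel. ?h t * \<psi> t)"
    by auto
  \<comment> \<open>The coefficients are conjugated because \<open>L\<close> pairs test functions
    with cnj u. The constant has no flux, and t^(1-c) has the constant flux 1 - c, which is the
    correction in \<open>P\<close>.\<close>
  define U where "U t = U0 t + (cnj A + cnj B * ?h t)" for t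
  define P where "P t = P0 t + cnj B * of_real (1 - c)" for t
  have sol: "leaf_sol c U P v"
    unfolding leaf_sol_def
  proof
    have "ac_deriv U (\<lambda>t. of_real (t powr (- c)) * P0 t + (0 + cnj B * of_real ((1 - c) * t powr (1 - c - 1))))"
      unfolding U_def by (intro ac_deriv_add ac_deriv_const ac_deriv_cmult ac_deriv_powr U0)
    then show "ac_deriv U (\<lambda>t. of_real (t powr (- c)) * P t)"
      by (rule ac_deriv_cong) (simp_all add: P_def algebra_simps)
    have "ac_deriv P (\<lambda>t. of_real (t powr c) * v t + 0)"
      unfolding P_def by (intro ac_deriv_add ac_deriv_const P0)
    then show "ac_deriv P (\<lambda>t. of_real (t powr c) * v t)" by simp
  qed
  have Uc: "continuous_on {0<..} U" by (rule leaf_solD(3)[OF sol])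
  have Um: "(\<lambda>t. indicator {0<..} t *\<^sub>R U t) \<in> borel_measurable borel"
    by (rule borel_measurable_indicator_continuous[OF Uc])
  define k where "k t = cnj (indicator {0<..} t *\<^sub>R u t - indicator {0<..} t *\<^sub>R U t)" for t
  have km: "k \<in> borel_measurable borel"
    unfolding k_def by (intro borel_measurable_cnj borel_measurable_diff um Um)
  have "AE t in lborel. 0 < t \<longrightarrow> k t = 0"
  proof (rule AE_zero_if_orthogonal_test_functions[OF km])
    fix s t :: real assume s: "0 < s" "s < t"
    show "set_integrable lborel {s..t} (\<lambda>r. (cmod (k r))\<^sup>2)"
    proof (rule set_integrable_bound)
      have "set_integrable lborel {s..t} (\<lambda>r. (cmod (U r))\<^sup>2)"
        using s by (intro borel_integrable_atLeastAtMost' continuous_intros continuous_on_subset[OF Uc]) auto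
      then show "set_integrable lborel {s..t} (\<lambda>r. 2 * (cmod (u r))\<^sup>2 + 2 * (cmod (U r))\<^sup>2)"
        using weighted_l2_local(1)[OF u s(1)] by (intro set_integral_add) auto
      show "set_borel_measurable lborel {s..t} (\<lambda>r. (cmod (k r))\<^sup>2)"
        using km by (simp add: set_borel_measurable_def)
      have "(cmod (k r))\<^sup>2 \<le> 2 * (cmod (u r))\<^sup>2 + 2 * (cmod (U r))\<^sup>2" for r
        using cmod_add_power2_le[of "u r" "- U r"] by (cases "0 < r") (auto simp: k_def simp del: complex_cnj_diff)
      then show "AE r in lborel. r \<in> {s..t} \<longrightarrow> norm ((cmod (k r))\<^sup>2) \<le>
          norm (2 * (cmod (u r))\<^sup>2 + 2 * (cmod (U r))\<^sup>2)"
        by (intro AE_I2) simp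
    qed
  next
    fix \<psi> :: "real \<Rightarrow> complex" assume \<psi>: "\<psi> \<in> test_functions"
    obtain l r where lr: "0 < l" "l < r" "\<And>t. t \<notin> {l..r} \<Longrightarrow> \<psi> t = 0"
      using test_function_cases[OF \<psi>] by metis
    have "k t * \<psi> t = (cnj (u t) * \<psi> t - cnj (U0 t) * \<psi> t) - (A * \<psi> t + B * (?h t * \<psi> t))" for t
      using lr(1) lr(3)[of t] by (cases "0 < t") (auto simp: k_def U_def algebra_simps)
    then have "(LINT t|lborel. k t * \<psi> t) =
        (LINT t|lborel. (cnj (u t) * \<psi> t - cnj (U0 t) * \<psi> t) - (A * \<psi> t + B * (?h t * \<psi> t)))"
      by simp
    also have "\<dots> = ((LINT t|lborel. cnj (u t) * \<psi> t) - (LINT t|lborel. cnj (U0 t) * \<psi> t)) -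
        (A * (LINT t|lborel. \<psi> t) + B * (LINT t|lborel. ?h t * \<psi> t))"
      using iu[OF \<psi>] iU[OF \<psi>] i1[OF \<psi>] i2[OF \<psi>] by simp
    also have "\<dots> = 0" using AB[OF \<psi>] by (simp add: L_def)
    finally show "(LINT t|lborel. k t * \<psi> t) = 0" .
  qed
  then have ae: "AE t in lborel. 0 < t \<longrightarrow> u t = U t"
    by eventually_elim (auto simp: k_def)
  have "set_integrable lborel {0<..} (\<lambda>t. t powr c * (cmod (U t))\<^sup>2)"
  proof (rule set_integrable_bound)
    show "set_integrable lborel {0<..} (\<lambda>t. t powr c * (cmod (u t))\<^sup>2)"
      using u by (simp add: weighted_l2_def)
    have "(\<lambda>t. t powr c * (cmod (indicator {0<..} t *\<^sub>R U t))\<^sup>2) \<in> borel_measurable borel"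
      using Um by measurable
    also have "(\<lambda>t. t powr c * (cmod (indicator {0<..} t *\<^sub>R U t))\<^sup>2) =
        (\<lambda>t. indicator {0<..} t *\<^sub>R (t powr c * (cmod (U t))\<^sup>2))"
      by (auto simp: indicator_def)
    finally show "set_borel_measurable lborel {0<..} (\<lambda>t. t powr c * (cmod (U t))\<^sup>2)"
      by (simp add: set_borel_measurable_def)
    show "AE t in lborel. t \<in> {0<..} \<longrightarrow>
        norm (t powr c * (cmod (U t))\<^sup>2) \<le> norm (t powr c * (cmod (u t))\<^sup>2)"
      using ae by eventually_elim auto
  qed
  then have "weighted_l2 c U" using Um by (simp add: weighted_l2_def)
  then show ?thesis using that sol ae unfolding c_def by blast
qed


section \<open>Criteria for essential self-adjointness\<close>

lemma square_int_mult_integrable: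
  assumes "f \<in> square_int M" "g \<in> square_int M"
  shows "integrable M (\<lambda>x. f x * cnj (g x))"
proof (rule Bochner_Integration.integrable_bound)
  show "integrable M (\<lambda>x. (cmod (f x))\<^sup>2 + (cmod (g x))\<^sup>2)"
    using assms by (auto simp: square_int_def)
  show "(\<lambda>x. f x * cnj (g x)) \<in> borel_measurable M"
    using assms by (intro borel_measurable_times borel_measurable_cnj) (auto simp: square_int_def)
  have "cmod (f x) * cmod (g x) \<le> (cmod (f x))\<^sup>2 + (cmod (g x))\<^sup>2" for x
    using mult_le_weighted_squares[of 1 "cmod (f x)" "cmod (g x)" 0] by simp
  then show "AE x in M. norm (f x * cnj (g x)) \<le> norm ((cmod (f x))\<^sup>2 + (cmod (g x))\<^sup>2)"
    by (intro AE_I2) (simp add: norm_mult)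
qed

lemma square_int_add:
  assumes "f \<in> square_int M" "g \<in> square_int M"
  shows "(\<lambda>x. f x + g x) \<in> square_int M"
proof -
  have m: "(\<lambda>x. f x + g x) \<in> borel_measurable M"
    using assms by (intro borel_measurable_add) (auto simp: square_int_def)
  moreover have "integrable M (\<lambda>x. (cmod (f x + g x))\<^sup>2)"
  proof (rule Bochner_Integration.integrable_bound)
    show "integrable M (\<lambda>x. 2 * (cmod (f x))\<^sup>2 + 2 * (cmod (g x))\<^sup>2)"
      using assms by (auto simp: square_int_def)
    show "(\<lambda>x. (cmod (f x + g x))\<^sup>2) \<in> borel_measurable M"
      using m by measurable
    show "AE x in M. norm ((cmod (f x + g x))\<^sup>2) \<le> norm (2 * (cmod (f x))\<^sup>2 + 2 * (cmod (g x))\<^sup>2)"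
      by (intro AE_I2) (simp add: cmod_add_power2_le)
  qed
  ultimately show ?thesis by (simp add: square_int_def)
qed

lemma square_int_cmult: "f \<in> square_int M \<Longrightarrow> (\<lambda>x. k * f x) \<in> square_int M"
  by (simp add: square_int_def norm_mult power_mult_distrib borel_measurable_times)

lemma square_int_diff:
  assumes "f \<in> square_int M" "g \<in> square_int M"
  shows "(\<lambda>x. f x - g x) \<in> square_int M"
  using square_int_add[OF assms(1) square_int_cmult[OF assms(2), of "-1"]] by simp

lemma l2_inner_cnj: "cnj (l2_inner M f g) = l2_inner M g f"
proof -
  have "cnj (l2_inner M f g) = (LINT x|M. cnj (f x * cnj (g x)))"
    unfolding l2_inner_def by (rule Bochner_Integration.integral_cnj[symmetric])
  then show ?thesis by (simp add: l2_inner_def mult.commute)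
qed

lemma l2_inner_add_right:
  assumes "f \<in> square_int M" "g \<in> square_int M" "h \<in> square_int M"
  shows "l2_inner M f (\<lambda>x. g x + h x) = l2_inner M f g + l2_inner M f h"
  unfolding l2_inner_def
  using Bochner_Integration.integral_add[OF square_int_mult_integrable[OF assms(1,2)]
      square_int_mult_integrable[OF assms(1,3)]]
  by (simp add: distrib_left)

lemma l2_inner_cmult_right: "l2_inner M f (\<lambda>x. k * g x) = cnj k * l2_inner M f g"
  unfolding l2_inner_def by (simp add: mult.left_commute)

lemma l2_inner_diff_right:
  assumes "f \<in> square_int M" "g \<in> square_int M" "h \<in> square_int M"
  shows "l2_inner M f (\<lambda>x. g x - h x) = l2_inner M f g - l2_inner M f h"
  using l2_inner_add_right[OF assms(1,2) square_int_cmult[OF assms(3), of "-1"]]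
    l2_inner_cmult_right[of M f "-1" h] by simp

lemma l2_inner_cong_AE:
  assumes "f \<in> borel_measurable M" "f' \<in> borel_measurable M" "g \<in> borel_measurable M" "g' \<in> borel_measurable M"
    and "AE x in M. f x = f' x" "AE x in M. g x = g' x"
  shows "l2_inner M f g = l2_inner M f' g'"
  unfolding l2_inner_def
proof (rule integral_cong_AE)
  show "AE x in M. f x * cnj (g x) = f' x * cnj (g' x)"
    using assms(5,6) by eventually_elim simp
qed (intro borel_measurable_times borel_measurable_cnj assms)+

lemma square_intD: "f \<in> square_int M \<Longrightarrow> f \<in> borel_measurable M"
  by (simp add: square_int_def)

text \<open>If \<open>f\<close> is orthogonal to \<open>w\<close>, the squared distance is |w|^2 +
  |f|^2 in norm; density makes it arbitrarily small, hence the norm of \<open>w\<close> is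
  0.\<close>

lemma AE_zero_if_orthogonal_dense:
  assumes dense: "densely_defined M T" and T: "T \<subseteq> square_int M \<times> square_int M"
    and w: "w \<in> square_int M" and orth: "\<And>f g. (f, g) \<in> T \<Longrightarrow> l2_inner M f w = 0"
  shows "AE x in M. w x = 0"
proof -
  have wi: "integrable M (\<lambda>x. (cmod (w x))\<^sup>2)"
    using w by (simp add: square_int_def)
  have "(LINT x|M. (cmod (w x))\<^sup>2) < e" if "0 < e" for e
  proof -
    obtain f g where fg: "(f, g) \<in> T" "(LINT x|M. (cmod (w x - f x))\<^sup>2) < e"
      using dense w \<open>0 < e\<close> unfolding densely_defined_def by fast
    have f: "f \<in> square_int M" using fg(1) T by auto
    have fi: "integrable M (\<lambda>x. (cmod (f x))\<^sup>2)"
      using f by (simp add: square_int_def)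
    have Rei: "integrable M (\<lambda>x. Re (f x * cnj (w x)))"
      using square_int_mult_integrable[OF f w] by (rule integrable_Re)
    have "(LINT x|M. Re (f x * cnj (w x))) = Re (l2_inner M f w)"
      unfolding l2_inner_def using square_int_mult_integrable[OF f w] by (rule integral_Re)
    then have Re0: "(LINT x|M. 2 * Re (f x * cnj (w x))) = 0"
      unfolding integral_mult_right_zero orth[OF fg(1)] by simp
    have expand: "(cmod (w x - f x))\<^sup>2 = ((cmod (w x))\<^sup>2 + (cmod (f x))\<^sup>2) - 2 * Re (f x * cnj (w x))" for x
      unfolding cmod_power2 by (simp add: power2_eq_square algebra_simps)
    have "(LINT x|M. (cmod (w x - f x))\<^sup>2) =
        (LINT x|M. (cmod (w x))\<^sup>2 + (cmod (f x))\<^sup>2) - (LINT x|M. 2 * Re (f x * cnj (w x)))"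
      unfolding expand
      by (rule Bochner_Integration.integral_diff[OF Bochner_Integration.integrable_add[OF wi fi]
            integrable_mult_right[OF Rei]])
    also have "\<dots> = (LINT x|M. (cmod (w x))\<^sup>2) + (LINT x|M. (cmod (f x))\<^sup>2)"
      unfolding Re0 Bochner_Integration.integral_add[OF wi fi] by simp
    finally have "(LINT x|M. (cmod (w x))\<^sup>2) + (LINT x|M. (cmod (f x))\<^sup>2) < e"
      using fg(2) by simp
    moreover have "0 \<le> (LINT x|M. (cmod (f x))\<^sup>2)" by simp
    ultimately show ?thesis by linarith
  qed
  from this[of "LINT x|M. (cmod (w x))\<^sup>2"] have "\<not> 0 < (LINT x|M. (cmod (w x))\<^sup>2)"
    by blast
  moreover have "0 \<le> (LINT x|M. (cmod (w x))\<^sup>2)" by simp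
  ultimately have "(LINT x|M. (cmod (w x))\<^sup>2) = 0" by linarith
  then have "AE x in M. (cmod (w x))\<^sup>2 = 0"
    using integral_nonneg_eq_0_iff_AE[OF wi] by simp
  then show ?thesis by eventually_elim simp
qed

section \<open>Adjoint graphs and abstract boundary conditions\<close>

lemma l2_adjoint_square_int: "l2_adjoint M T \<subseteq> square_int M \<times> square_int M"
  by (auto simp: l2_adjoint_def)

lemma l2_adjoint_mono: "S \<subseteq> T \<Longrightarrow> l2_adjoint M T \<subseteq> l2_adjoint M S"
  by (auto simp: l2_adjoint_def)

lemma l2_adjoint_iff:
  "(u, v) \<in> l2_adjoint M T \<longleftrightarrow> u \<in> square_int M \<and> v \<in> square_int M \<and>
    (\<forall>f g. (f, g) \<in> T \<longrightarrow> l2_inner M g u = l2_inner M f v)"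
  by (auto simp: l2_adjoint_def)

lemma densely_defined_mono: "densely_defined M S \<Longrightarrow> S \<subseteq> T \<Longrightarrow> densely_defined M T"
  unfolding densely_defined_def by fast

text \<open>Density enters only in single-valuedness: two second components over the same first one
  differ by a function orthogonal to the domain. \<open>T\<close> is an arbitrary set of pairs, so
  that one boundary element may later be inserted without forming a linear span.\<close>

lemma l2_operator_adjoint:
  assumes T: "T \<subseteq> square_int M \<times> square_int M" and dense: "densely_defined M T"
  shows "l2_operator M (l2_adjoint M T)"
proof -
  have sqT: "f \<in> square_int M" "g \<in> square_int M" if "(f, g) \<in> T" for f g
    using that T by auto
  have zero: "(\<lambda>x. 0) \<in> square_int M" by (simp add: square_int_def)
  have uniq: "AE x in M. g x = g' x"
    if a: "(f, g) \<in> l2_adjoint M T" "(f', g') \<in> l2_adjoint M T" and eq: "AE x in M. f x = f' x" for f g f' g'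
  proof -
    note a' = a[unfolded l2_adjoint_iff]
    have sq: "f \<in> square_int M" "g \<in> square_int M" "f' \<in> square_int M" "g' \<in> square_int M"
      using a' by auto
    have "AE x in M. g x - g' x = 0"
    proof (rule AE_zero_if_orthogonal_dense[OF dense T square_int_diff[OF sq(2,4)]])
      fix h k assume hk: "(h, k) \<in> T"
      have "l2_inner M k f = l2_inner M k f'"
        by (rule l2_inner_cong_AE) (use sqT[OF hk] sq eq in \<open>auto dest: square_intD\<close>)
      then have "l2_inner M h g = l2_inner M h g'" using a' hk by metis
      then show "l2_inner M h (\<lambda>x. g x - g' x) = 0"
        by (simp add: l2_inner_diff_right sqT[OF hk] sq)
    qed
    then show ?thesis by eventually_elim simp
  qed
  have cong: "(f', g') \<in> l2_adjoint M T"
    if a: "(f, g) \<in> l2_adjoint M T" and sq': "f' \<in> square_int M" "g' \<in> square_int M"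
      and eq: "AE x in M. f' x = f x" "AE x in M. g' x = g x" for f g f' g'
    unfolding l2_adjoint_iff
  proof (intro conjI allI impI sq')
    note a' = a[unfolded l2_adjoint_iff]
    fix h k assume hk: "(h, k) \<in> T"
    have "l2_inner M k f' = l2_inner M k f" "l2_inner M h g' = l2_inner M h g"
      by (rule l2_inner_cong_AE; use sqT[OF hk] sq' a' eq in \<open>auto dest: square_intD\<close>)+
    then show "l2_inner M k f' = l2_inner M h g'" using a' hk by metis
  qed
  have add: "(\<lambda>x. f x + f' x, \<lambda>x. g x + g' x) \<in> l2_adjoint M T"
    if "(f, g) \<in> l2_adjoint M T" "(f', g') \<in> l2_adjoint M T" for f g f' g'
    using that by (simp add: l2_adjoint_iff square_int_add l2_inner_add_right sqT)
  have cmult: "(\<lambda>x. k * f x, \<lambda>x. k * g x) \<in> l2_adjoint M T" if "(f, g) \<in> l2_adjoint M T" for k f g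
    using that by (simp add: l2_adjoint_iff square_int_cmult l2_inner_cmult_right)
  have zero: "(\<lambda>x. 0, \<lambda>x. 0) \<in> l2_adjoint M T"
    by (simp add: l2_adjoint_iff zero) (simp add: l2_inner_def)
  show ?thesis
    unfolding l2_operator_def
  proof (intro conjI allI impI l2_adjoint_square_int zero; (elim conjE)?)
  qed (rule cong add cmult uniq; assumption)+
qed

text \<open>A symmetric adjoint H of \<open>T\<close> is its own adjoint. Any self-adjoint K above
  \<open>T\<close> equals its adjoint, hence lies in H; taking adjoints once more puts H inside
  K.\<close>

lemma essentially_self_adjointI:
  assumes T: "T \<subseteq> square_int M \<times> square_int M" and dense: "densely_defined M T"
    and sym: "T \<subseteq> l2_adjoint M T"
    and adj_sym: "\<And>u v u' v'. (u, v) \<in> l2_adjoint M T \<Longrightarrow> (u', v') \<in> l2_adjoint M T \<Longrightarrow>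
      l2_inner M v u' = l2_inner M u v'"
  shows "essentially_self_adjoint M T"
proof -
  let ?H = "l2_adjoint M T"
  have H: "l2_adjoint M ?H = ?H"
  proof
    show "l2_adjoint M ?H \<subseteq> ?H" by (rule l2_adjoint_mono[OF sym])
    show "?H \<subseteq> l2_adjoint M ?H"
      using adj_sym l2_adjoint_square_int[of M T] by (fastforce simp: l2_adjoint_iff[of _ _ M ?H])
  qed
  show ?thesis
    unfolding essentially_self_adjoint_def
  proof (rule ex1I[of _ ?H])
    show "self_adjoint M ?H \<and> T \<subseteq> ?H"
      unfolding self_adjoint_def
      using l2_operator_adjoint[OF T dense] densely_defined_mono[OF dense sym] H sym by blast
    fix K assume K: "self_adjoint M K \<and> T \<subseteq> K"
    then have "l2_adjoint M K = K" "l2_adjoint M K \<subseteq> ?H"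
      using l2_adjoint_mono[of T K M] by (auto simp: self_adjoint_def)
    moreover from this have "?H \<subseteq> l2_adjoint M K"
      using l2_adjoint_mono[of K ?H M] H by auto
    ultimately show "K = ?H" by blast
  qed
qed

text \<open>The arguments are graph elements. The order of the two terms is chosen so that the value
  is the limit of the Wronskian at 0 without a change of sign.\<close>

definition boundary_form where
  "boundary_form M x y = l2_inner M (snd x) (fst y) - l2_inner M (fst x) (snd y)"

lemma boundary_form_cnj: "cnj (boundary_form M x y) = - boundary_form M y x"
  by (simp add: boundary_form_def l2_inner_cnj)

text \<open>Inserting one element into the graph imposes one linear boundary condition on the
  adjoint; this is how self-adjoint restrictions of the adjoint are cut out.\<close>

lemma l2_adjoint_insert:
  "x \<in> l2_adjoint M (insert p T) \<longleftrightarrow> x \<in> l2_adjoint M T \<and> boundary_form M p x = 0"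
  by (cases x; cases p) (auto simp: l2_adjoint_iff boundary_form_def)

text \<open>With \<open>H p = l2_adjoint M (insert p T)\<close>, the Pluecker relation makes the boundary form vanish on
  \<open>H p\<close>, so \<open>H p\<close> and \<open>H q\<close> are self-adjoint extensions, and only the second contains \<open>q\<close>.\<close>

lemma not_essentially_self_adjointI:
  assumes T: "T \<subseteq> square_int M \<times> square_int M" and dense: "densely_defined M T"
    and sym: "T \<subseteq> l2_adjoint M T"
    and pq: "p \<in> l2_adjoint M T" "q \<in> l2_adjoint M T"
    and B: "boundary_form M p p = 0" "boundary_form M q q = 0" "boundary_form M p q \<noteq> 0"
    and pluecker: "\<And>x y. x \<in> l2_adjoint M T \<Longrightarrow> y \<in> l2_adjoint M T \<Longrightarrow>
      boundary_form M x y * boundary_form M p q =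
      boundary_form M x p * cnj (boundary_form M y q) - boundary_form M x q * cnj (boundary_form M y p)"
  shows "\<not> essentially_self_adjoint M T"
proof
  assume "essentially_self_adjoint M T"
  then have uniq: "\<And>H K. self_adjoint M H \<Longrightarrow> T \<subseteq> H \<Longrightarrow> self_adjoint M K \<Longrightarrow> T \<subseteq> K \<Longrightarrow> H = K"
    unfolding essentially_self_adjoint_def by blast
  have flip: "boundary_form M y x = 0" if "boundary_form M x y = 0" for x y
    using boundary_form_cnj[of M x y] that by simp
  have ext: "T \<subseteq> l2_adjoint M (insert r T)" if r: "r \<in> l2_adjoint M T" for r
  proof
    fix x assume x: "x \<in> T"
    have "boundary_form M x r = 0"
      using x r by (cases x; cases r) (auto simp: l2_adjoint_iff boundary_form_def)
    then show "x \<in> l2_adjoint M (insert r T)"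
      using x sym by (auto simp: l2_adjoint_insert intro: flip)
  qed
  have sa: "self_adjoint M (l2_adjoint M (insert r T))"
    if r: "r \<in> l2_adjoint M T" and rr: "boundary_form M r r = 0"
      and zero: "\<And>x y. x \<in> l2_adjoint M T \<Longrightarrow> y \<in> l2_adjoint M T \<Longrightarrow> boundary_form M x r = 0 \<Longrightarrow>
        boundary_form M y r = 0 \<Longrightarrow> boundary_form M x y = 0" for r
  proof -
    let ?H = "l2_adjoint M (insert r T)"
    have rT: "insert r T \<subseteq> square_int M \<times> square_int M"
      using T r l2_adjoint_square_int by blast
    have dense': "densely_defined M (insert r T)"
      by (rule densely_defined_mono[OF dense]) blast
    have "insert r T \<subseteq> ?H"
      using ext[OF r] r rr by (auto simp: l2_adjoint_insert)
    then have "l2_adjoint M ?H \<subseteq> ?H" by (rule l2_adjoint_mono)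
    moreover have "?H \<subseteq> l2_adjoint M ?H"
    proof
      fix x assume x: "x \<in> ?H"
      have *: "boundary_form M y x = 0" if "y \<in> ?H" for y
      proof (rule zero)
        show "y \<in> l2_adjoint M T" "x \<in> l2_adjoint M T"
          using x that by (simp_all add: l2_adjoint_insert)
        show "boundary_form M y r = 0" "boundary_form M x r = 0"
          using x that by (simp_all add: l2_adjoint_insert flip)
      qed
      obtain u v where uv: "x = (u, v)" by (cases x)
      have "u \<in> square_int M" "v \<in> square_int M"
        using x l2_adjoint_square_int unfolding uv by blast+
      moreover have "l2_inner M g u = l2_inner M f v" if "(f, g) \<in> ?H" for f g
        using *[OF that] by (simp add: boundary_form_def uv)
      ultimately show "x \<in> l2_adjoint M ?H"
        unfolding uv l2_adjoint_iff[of u v M ?H] by blast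
    qed
    ultimately show ?thesis
      unfolding self_adjoint_def
      using l2_operator_adjoint[OF rT dense'] densely_defined_mono[OF dense ext[OF r]] by blast
  qed
  \<comment> \<open>Each product in the Pluecker relation has one factor involving \<open>p\<close>
    and one involving \<open>q\<close>, so vanishing of both x and y against either of them
    annihilates the right-hand side; the form of \<open>p\<close> and \<open>q\<close> is nonzero
    and can be divided out.\<close>
  have zero: "boundary_form M x y = 0"
    if "x \<in> l2_adjoint M T" "y \<in> l2_adjoint M T" "boundary_form M x r = 0" "boundary_form M y r = 0" "r \<in> {p, q}"
    for x y r
    using pluecker[OF that(1,2)] that(3-5) B(3) by auto
  have "self_adjoint M (l2_adjoint M (insert p T))"
    by (rule sa[OF pq(1) B(1)]) (erule (3) zero, simp)
  moreover have "self_adjoint M (l2_adjoint M (insert q T))"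
    by (rule sa[OF pq(2) B(2)]) (erule (3) zero, simp)
  ultimately have "l2_adjoint M (insert p T) = l2_adjoint M (insert q T)"
    by (intro uniq ext pq)
  moreover have "q \<in> l2_adjoint M (insert q T)" "q \<notin> l2_adjoint M (insert p T)"
    using pq B by (auto simp: l2_adjoint_insert)
  ultimately show False by blast
qed


section \<open>The operators on the half-axes\<close>

text \<open>Makes the elements of the operator available as \<open>leaf_sol\<close> triples with
  test-function data, with flux t^c \<phi>', so that the Wronskian calculus applies to them
  too.\<close>

lemma leaf_laplacian_test_function:
  assumes "\<phi> \<in> test_functions"
  obtains g P where "g \<in> test_functions" "P \<in> test_functions"
    "\<And>t. 0 < t \<Longrightarrow> leaf_laplacian lam \<phi> t = g t" "leaf_sol (1 / lam) \<phi> P g"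
proof -
  obtain \<phi>' where \<phi>': "\<phi>' \<in> test_functions" "\<And>t. (\<phi> has_vector_derivative \<phi>' t) (at t)"
    using test_function_deriv_test[OF assms] by blast
  obtain \<phi>'' where \<phi>'': "\<phi>'' \<in> test_functions" "\<And>t. (\<phi>' has_vector_derivative \<phi>'' t) (at t)"
    using test_function_deriv_test[OF \<phi>'(1)] by blast
  let ?c = "1 / lam"
  let ?g = "\<lambda>t. \<phi>'' t + of_real ?c * (of_real (t powr (- 1)) * \<phi>' t)"
  let ?P = "\<lambda>t. of_real (t powr ?c) * \<phi>' t"
  have D: "(\<lambda>s. vector_derivative \<phi> (at s)) = \<phi>'"
    by (rule ext) (rule vector_derivative_at[OF \<phi>'(2)])
  have lap: "leaf_laplacian lam \<phi> t = ?g t" if "0 < t" for t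
    using that unfolding leaf_laplacian_def D vector_derivative_at[OF \<phi>'(2)] vector_derivative_at[OF \<phi>''(2)]
    by (simp add: powr_minus divide_inverse)
  have g: "?g \<in> test_functions"
    by (rule test_functions_add[OF \<phi>''(1) test_functions_cmult[OF test_functions_powr[OF \<phi>'(1)]]])
  have P: "?P \<in> test_functions" by (rule test_functions_powr[OF \<phi>'(1)])
  note c = smooth_continuous[OF test_functions_smooth]
  have ac: "ac_deriv \<phi> \<phi>'" "ac_deriv \<phi>' \<phi>''"
    by (rule ac_deriv_C1[OF \<phi>'(2) c[OF \<phi>'(1)]] ac_deriv_C1[OF \<phi>''(2) c[OF \<phi>''(1)]])+
  have "leaf_sol ?c \<phi> ?P ?g"
    unfolding leaf_sol_def
  proof
    show "ac_deriv \<phi> (\<lambda>t. of_real (t powr (- ?c)) * ?P t)"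
    proof (rule ac_deriv_cong[OF ac(1) refl])
      fix t :: real assume "0 < t"
      then have "t powr (- ?c) * t powr ?c = 1" by (simp flip: powr_add)
      then have "complex_of_real (t powr (- ?c)) * of_real (t powr ?c) = 1"
        by (metis of_real_1 of_real_mult)
      then show "\<phi>' t = of_real (t powr (- ?c)) * ?P t"
        by (metis mult.assoc mult_1)
    qed
    show "ac_deriv ?P (\<lambda>t. of_real (t powr ?c) * ?g t)"
    proof (rule ac_deriv_cong[OF ac_deriv_mult[OF ac_deriv_powr ac(2)] refl])
      fix t :: real
      have "t powr (?c - 1) = t powr ?c * t powr (- 1)"
        using powr_add[of t ?c "- 1"] by (simp only: diff_conv_add_uminus)
      then show "of_real (t powr ?c) * \<phi>'' t + of_real (?c * t powr (?c - 1)) * \<phi>' t =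
          of_real (t powr ?c) * ?g t"
        by (simp only: of_real_mult distrib_left ac_simps)
    qed
  qed
  then show ?thesis using that lap g P by blast
qed

lemma leaf_operator_square_int:
  "leaf_operator lam \<subseteq> square_int (leaf_measure lam) \<times> square_int (leaf_measure lam)"
  by (auto simp: leaf_operator_def)

lemma leaf_operator_symmetric:
  "leaf_operator lam \<subseteq> l2_adjoint (leaf_measure lam) (leaf_operator lam)"
proof
  let ?M = "leaf_measure lam"
  fix x assume "x \<in> leaf_operator lam"
  then obtain u v \<phi> where x: "x = (u, v)" and uv: "u \<in> square_int ?M" "v \<in> square_int ?M"
    and \<phi>: "\<phi> \<in> test_functions" "AE t in ?M. u t = \<phi> t" "AE t in ?M. v t = leaf_laplacian lam \<phi> t"
    unfolding leaf_operator_def by blast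
  have mt: "\<theta> \<in> borel_measurable ?M" "leaf_laplacian lam \<theta> \<in> borel_measurable ?M"
    if \<theta>: "\<theta> \<in> test_functions" for \<theta>
  proof -
    obtain g where g: "g \<in> test_functions" "\<And>t. 0 < t \<Longrightarrow> leaf_laplacian lam \<theta> t = g t"
      using leaf_laplacian_test_function[OF \<theta>] by blast
    have c: "h \<in> borel_measurable borel" if "h \<in> test_functions" for h
      by (rule borel_measurable_continuous_onI[OF smooth_continuous[OF test_functions_smooth[OF that]]])
    show "\<theta> \<in> borel_measurable ?M"
      unfolding borel_measurable_leaf_measure_iff
      by (rule borel_measurable_indicator_cong[OF refl c[OF \<theta>]])
    show "leaf_laplacian lam \<theta> \<in> borel_measurable ?M"
      unfolding borel_measurable_leaf_measure_iff
      by (rule borel_measurable_indicator_cong[OF g(2) c[OF g(1)]])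
  qed
  have "l2_inner ?M g u = l2_inner ?M f v" if fg: "(f, g) \<in> leaf_operator lam" for f g
  proof -
    obtain \<psi> where \<psi>: "f \<in> square_int ?M" "g \<in> square_int ?M" "\<psi> \<in> test_functions"
      "AE t in ?M. f t = \<psi> t" "AE t in ?M. g t = leaf_laplacian lam \<psi> t"
      using fg unfolding leaf_operator_def by blast
    have "l2_inner ?M g u = l2_inner ?M (leaf_laplacian lam \<psi>) \<phi>"
      by (rule l2_inner_cong_AE) (use \<psi> \<phi> uv mt in \<open>auto dest: square_intD\<close>)
    also have "\<dots> = l2_inner ?M \<psi> (leaf_laplacian lam \<phi>)"
      by (rule leaf_laplacian_symmetric[OF \<psi>(3) \<phi>(1)])
    also have "\<dots> = l2_inner ?M f v"
      by (rule l2_inner_cong_AE[symmetric]) (use \<psi> \<phi> uv mt in \<open>auto dest: square_intD\<close>)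
    finally show ?thesis .
  qed
  then show "x \<in> l2_adjoint ?M (leaf_operator lam)"
    unfolding x l2_adjoint_iff using uv by blast
qed

lemma weighted_l2_diff:
  assumes f: "weighted_l2 c f" and g: "weighted_l2 c g"
  shows "weighted_l2 c (\<lambda>t. f t - g t)"
proof -
  have "(\<lambda>t. indicator {0<..} t *\<^sub>R f t - indicator {0<..} t *\<^sub>R g t) \<in> borel_measurable borel"
    using f g unfolding weighted_l2_def by (intro borel_measurable_diff) auto
  then have m: "(\<lambda>t. indicator {0<..} t *\<^sub>R (f t - g t)) \<in> borel_measurable borel"
    by (simp only: scaleR_diff_right)
  have "set_integrable lborel {0<..} (\<lambda>t. t powr c * (cmod (f t - g t))\<^sup>2)"
  proof (rule set_integrable_bound)
    show "set_integrable lborel {0<..} (\<lambda>t. 2 * (t powr c * (cmod (f t))\<^sup>2) + 2 * (t powr c * (cmod (g t))\<^sup>2))"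
      using f g by (auto simp: weighted_l2_def)
    have "(\<lambda>t. t powr c * (cmod (indicator {0<..} t *\<^sub>R (f t - g t)))\<^sup>2) \<in> borel_measurable borel"
      using m by measurable
    also have "(\<lambda>t. t powr c * (cmod (indicator {0<..} t *\<^sub>R (f t - g t)))\<^sup>2) =
        (\<lambda>t. indicator {0<..} t *\<^sub>R (t powr c * (cmod (f t - g t))\<^sup>2))"
      by (auto simp: indicator_def)
    finally show "set_borel_measurable lborel {0<..} (\<lambda>t. t powr c * (cmod (f t - g t))\<^sup>2)"
      by (simp add: set_borel_measurable_def)
    have "t powr c * (cmod (f t - g t))\<^sup>2 \<le> t powr c * (2 * (cmod (f t))\<^sup>2 + 2 * (cmod (g t))\<^sup>2)" for t
      using cmod_add_power2_le[of "f t" "- g t"] by (intro mult_left_mono) auto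
    then show "AE t in lborel. t \<in> {0<..} \<longrightarrow> norm (t powr c * (cmod (f t - g t))\<^sup>2) \<le>
        norm (2 * (t powr c * (cmod (f t))\<^sup>2) + 2 * (t powr c * (cmod (g t))\<^sup>2))"
      by (intro AE_I2) (simp add: distrib_left mult.left_commute)
  qed
  with m show ?thesis by (simp add: weighted_l2_def)
qed

text \<open>Continuity from below leaves a tail of weighted mass below e/2 outside a compact
  interval. Inside, the weight is bounded and the unweighted density applies; \<open>\<phi>\<close>
  vanishes outside, so the tail costs no more than that of \<open>f\<close>.\<close>

lemma weighted_l2_approx:
  assumes f: "weighted_l2 c f" and e: "0 < e"
  obtains \<phi> where "\<phi> \<in> test_functions" "(LBINT t:{0<..}. t powr c * (cmod (f t - \<phi> t))\<^sup>2) < e"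
proof -
  let ?w = "\<lambda>t. t powr c * (cmod (f t))\<^sup>2"
  define A where "A n = {1 / real (n + 2)..real (n + 2)}" for n
  have fi: "set_integrable lborel {0<..} ?w" using f by (simp add: weighted_l2_def)
  have UA: "(\<Union>n. A n) = {0<..}"
  proof
    show "(\<Union>n. A n) \<subseteq> {0<..}"
      unfolding A_def by (auto intro: less_le_trans[rotated])
    show "{0<..} \<subseteq> (\<Union>n. A n)"
    proof
      fix t :: real assume t: "t \<in> {0<..}"
      obtain n where n: "max t (1 / t) \<le> real n" using real_arch_simple by blast
      then have "1 / t \<le> real (n + 2)" by simp
      then have "1 / real (n + 2) \<le> t"
        using t by (simp add: divide_le_eq mult.commute)
      moreover have "t \<le> real (n + 2)" using n by auto
      ultimately show "t \<in> (\<Union>n. A n)" by (auto simp: A_def)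
    qed
  qed
  have "incseq A"
    unfolding A_def by (intro monoI) (auto intro: order_trans[rotated] simp: field_simps)
  then have "(\<lambda>n. LBINT t:A n. ?w t) \<longlonglongrightarrow> (LBINT t:(\<Union>n. A n). ?w t)"
    by (rule set_integral_cont_up[rotated]) (simp_all only: UA fi, simp add: A_def)
  then have "eventually (\<lambda>n. (LBINT t:{0<..}. ?w t) - e / 2 < (LBINT t:A n. ?w t)) sequentially"
    unfolding UA using e by (intro order_tendstoD(1)) auto
  then obtain n where n: "(LBINT t:{0<..}. ?w t) - e / 2 < (LBINT t:A n. ?w t)"
    by (auto simp: eventually_sequentially)
  define l u where "l = 1 / real (n + 2)" and "u = real (n + 2)"
  have An: "A n = {l..u}" by (simp add: A_def l_def u_def)
  have "l \<le> 1" "1 < u" by (simp_all add: l_def u_def)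
  then have lu: "0 < l" "l < u" by (simp add: l_def, linarith)
  have "continuous_on {l..u} (\<lambda>t. t powr c)"
    using lu by (intro continuous_intros) auto
  then obtain B0 where B0: "\<And>t. t \<in> {l..u} \<Longrightarrow> norm (t powr c) \<le> B0"
    using continuous_on_Icc_bounded by blast
  \<comment> \<open>The maximum with 1 makes the bound positive, so that the accuracy e / (2 B)
    makes sense.\<close>
  define B where "B = max 1 B0"
  have B: "0 < B" "\<And>t. t \<in> {l..u} \<Longrightarrow> t powr c \<le> B"
    using B0 by (auto simp: B_def le_max_iff_disj)
  define f0 where "f0 t = indicator {0<..} t *\<^sub>R f t" for t
  have f0: "f0 \<in> borel_measurable borel" using f unfolding weighted_l2_def f0_def by blast
  have f0f: "f0 t = f t" if "0 < t" for t using that by (simp add: f0_def)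
  have f0i: "set_integrable lborel {l..u} (\<lambda>t. (cmod (f0 t))\<^sup>2)"
    using weighted_l2_local(1)[OF f lu(1)]
    by (rule set_integrable_cong[THEN iffD1, rotated -1]) (use lu f0f in auto)
  have e': "0 < e / (2 * B)" using e B by simp
  obtain \<phi> where \<phi>: "\<phi> \<in> test_functions" "\<And>t. t \<notin> {l..u} \<Longrightarrow> \<phi> t = 0"
    and \<phi>e: "(LBINT t:{l..u}. (cmod (f0 t - \<phi> t))\<^sup>2) < e / (2 * B)"
    using test_functions_dense_Icc[OF f0 f0i lu e'] by metis
  let ?d = "\<lambda>t. t powr c * (cmod (f t - \<phi> t))\<^sup>2"
  have di: "set_integrable lborel {0<..} ?d"
    using weighted_l2_diff[OF f weighted_l2_test_function[OF \<phi>(1)]] by (simp add: weighted_l2_def)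
  let ?R = "{0<..} - {l..u}"
  have sub: "{l..u} \<subseteq> {0<..}" using lu by auto
  have split: "{l..u} \<union> ?R = {0<..}" "{l..u} \<inter> ?R = {}" using sub by auto
  have int: "set_integrable lborel {l..u} h" "set_integrable lborel ?R h"
    if "set_integrable lborel {0<..} h" for h :: "real \<Rightarrow> real"
    by (rule set_integrable_subset[OF that]; use sub in auto)+
  have sum: "(LBINT t:{0<..}. h t) = (LBINT t:{l..u}. h t) + (LBINT t:?R. h t)"
    if "set_integrable lborel {0<..} h" for h :: "real \<Rightarrow> real"
    using set_integral_Un[OF split(2) int[OF that]] unfolding split(1) .
  have "(LBINT t:{l..u}. ?d t) \<le> (LBINT t:{l..u}. B * (cmod (f0 t - \<phi> t))\<^sup>2)"
  proof (rule set_integral_mono[OF int(1)[OF di]])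
    have "set_integrable lborel {l..u} (\<lambda>t. (cmod (f t - \<phi> t))\<^sup>2)"
      by (rule weighted_l2_local(1)[OF weighted_l2_diff[OF f weighted_l2_test_function[OF \<phi>(1)]] lu(1)])
    then have "set_integrable lborel {l..u} (\<lambda>t. (cmod (f0 t - \<phi> t))\<^sup>2)"
      by (rule set_integrable_cong[THEN iffD1, rotated -1]) (use lu f0f in auto)
    then show "set_integrable lborel {l..u} (\<lambda>t. B * (cmod (f0 t - \<phi> t))\<^sup>2)" by auto
    show "?d t \<le> B * (cmod (f0 t - \<phi> t))\<^sup>2" if "t \<in> {l..u}" for t
      using B(2)[OF that] f0f[of t] lu that by (auto intro: mult_right_mono)
  qed
  also have "\<dots> = B * (LBINT t:{l..u}. (cmod (f0 t - \<phi> t))\<^sup>2)" by (rule set_integral_mult_right)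
  also have "\<dots> < B * (e / (2 * B))" by (rule mult_strict_left_mono[OF \<phi>e B(1)])
  also have "\<dots> = e / 2" using B(1) by simp
  finally have in_le: "(LBINT t:{l..u}. ?d t) < e / 2" .
  have "(LBINT t:?R. ?d t) = (LBINT t:?R. ?w t)"
    by (rule set_lebesgue_integral_cong) (auto simp: \<phi>(2))
  also have "\<dots> < e / 2" using sum[OF fi] n unfolding An by linarith
  finally have "(LBINT t:{0<..}. ?d t) < e"
    using sum[OF di] in_le by linarith
  then show ?thesis using that \<phi>(1) by blast
qed

lemma leaf_operator_dense: "densely_defined (leaf_measure lam) (leaf_operator lam)"
  unfolding densely_defined_def
proof (intro ballI allI impI)
  let ?M = "leaf_measure lam"
  fix f and e :: real assume f: "f \<in> square_int ?M" and e: "0 < e"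
  then have "weighted_l2 (1 / lam) f" by (simp add: square_int_leaf_measure)
  then obtain \<phi> where \<phi>: "\<phi> \<in> test_functions"
    "(LBINT t:{0<..}. t powr (1 / lam) * (cmod (f t - \<phi> t))\<^sup>2) < e"
    using weighted_l2_approx e by blast
  obtain g where g: "g \<in> test_functions" "\<And>t. 0 < t \<Longrightarrow> leaf_laplacian lam \<phi> t = g t"
    using leaf_laplacian_test_function[OF \<phi>(1)] by blast
  have "\<phi> \<in> square_int ?M" by (simp add: square_int_leaf_measure weighted_l2_test_function \<phi>)
  then have "(\<lambda>t. f t - \<phi> t) \<in> borel_measurable ?M"
    using square_int_diff[OF f] square_intD by blast
  then have "(\<lambda>t. (cmod (f t - \<phi> t))\<^sup>2) \<in> borel_measurable ?M" by measurable
  then have "(LINT t|?M. (cmod (f t - \<phi> t))\<^sup>2) < e"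
    using \<phi>(2) by (simp add: leaf_measure_integral_eq)
  then show "\<exists>(h, k)\<in>leaf_operator lam. (LINT t|?M. (cmod (f t - h t))\<^sup>2) < e"
    using leaf_operatorI[OF \<phi>(1) g] by blast
qed

text \<open>Green's formula on the half-line, split at 1: decay at infinity determines the value of
  the Wronskian at 1 as minus the integral over [1, \<infinity>), and integrability near 0 continues
  it to the origin.\<close>

lemma leaf_sol_boundary:
  assumes sol: "leaf_sol c U P v" "leaf_sol c U' P' v'"
    and l2: "weighted_l2 c U" "weighted_l2 c v" "weighted_l2 c U'" "weighted_l2 c v'"
  shows "(wronskian U P U' P' \<longlongrightarrow>
    (LBINT t:{0<..}. of_real (t powr c) * (v t * cnj (U' t))) -
    (LBINT t:{0<..}. of_real (t powr c) * (U t * cnj (v' t)))) (at_right 0)"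
proof -
  let ?W = "wronskian U P U' P'"
  let ?w = "\<lambda>t. of_real (t powr c) * (U t * cnj (v' t) - v t * cnj (U' t))"
  note W = leaf_sol_wronskian[OF sol]
  note w = weighted_l2_wronskian_integrable[OF l2(1,4,2,3)]
  have w1: "set_integrable lborel {1..} ?w" and w0: "set_integrable lborel {0<..1} ?w"
    by (rule set_integrable_subset[OF w(1)]; auto)+
  have "?W 1 + (LBINT t:{1..}. ?w t) = 0"
    by (rule tendsto_unique[OF _ ac_deriv_tendsto_at_top[OF W w1] wronskian_tendsto_at_top[OF sol l2]]) simp
  moreover have "(LBINT t:{0<..}. ?w t) = (LBINT t:{0<..1}. ?w t) + (LBINT t:{1..}. ?w t)"
  proof -
    have "(LBINT t:{0<..1} \<union> {1..}. ?w t) = (LBINT t:{0<..1}. ?w t) + (LBINT t:{1..}. ?w t)"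
    proof (rule set_integral_Un_AE[OF _ _ _ w0 w1])
      show "AE t in lborel. \<not> (t \<in> {0<..1} \<and> t \<in> {1::real..})"
        using AE_lborel_singleton[of "1::real"] by eventually_elim auto
    qed auto
    moreover have "{0<..1} \<union> {1::real..} = {0<..}" by auto
    ultimately show ?thesis by simp
  qed
  ultimately have "?W 1 - (LBINT t:{0<..1}. ?w t) = - (LBINT t:{0<..}. ?w t)"
    by (simp add: algebra_simps add_eq_0_iff)
  then have "?W 1 - (LBINT t:{0<..1}. ?w t) =
    (LBINT t:{0<..}. of_real (t powr c) * (v t * cnj (U' t))) -
    (LBINT t:{0<..}. of_real (t powr c) * (U t * cnj (v' t)))"
    unfolding w(2) by simp
  then show ?thesis
    using ac_deriv_tendsto_at_0[OF W w0] by simp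
qed

lemma boundary_form_tendsto:
  assumes sol: "leaf_sol (1 / lam) U P v" "leaf_sol (1 / lam) U' P' v'"
    and l2: "weighted_l2 (1 / lam) U" "weighted_l2 (1 / lam) U'"
    and sq: "(u, v) \<in> square_int (leaf_measure lam) \<times> square_int (leaf_measure lam)"
      "(u', v') \<in> square_int (leaf_measure lam) \<times> square_int (leaf_measure lam)"
    and ae: "AE t in lborel. 0 < t \<longrightarrow> u t = U t" "AE t in lborel. 0 < t \<longrightarrow> u' t = U' t"
  shows "(wronskian U P U' P' \<longlongrightarrow> boundary_form (leaf_measure lam) (u, v) (u', v')) (at_right 0)"
proof -
  let ?M = "leaf_measure lam"
  have sqU: "U \<in> square_int ?M" "U' \<in> square_int ?M"
    using l2 by (simp_all add: square_int_leaf_measure)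
  have v: "weighted_l2 (1 / lam) v" "weighted_l2 (1 / lam) v'"
    using sq by (simp_all add: square_int_leaf_measure)
  have "l2_inner ?M v u' = l2_inner ?M v U'" "l2_inner ?M u v' = l2_inner ?M U v'"
    by (rule l2_inner_cong_AE; use sq sqU ae in \<open>auto simp: AE_leaf_measure dest: square_intD\<close>)+
  then have "boundary_form ?M (u, v) (u', v') =
      (LBINT t:{0<..}. of_real (t powr (1 / lam)) * (v t * cnj (U' t))) -
      (LBINT t:{0<..}. of_real (t powr (1 / lam)) * (U t * cnj (v' t)))"
    using sq sqU by (simp add: boundary_form_def l2_inner_leaf_measure)
  then show ?thesis
    using leaf_sol_boundary[OF sol l2(1) v(1) l2(2) v(2)] by simp
qed

section \<open>The two regimes of the exponent\<close>

theorem leaf_operator_essentially_self_adjoint: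
  assumes c: "1 / lam \<le> - 1 \<or> 3 \<le> 1 / lam"
  shows "essentially_self_adjoint (leaf_measure lam) (leaf_operator lam)"
proof (rule essentially_self_adjointI[OF leaf_operator_square_int leaf_operator_dense leaf_operator_symmetric])
  let ?M = "leaf_measure lam"
  fix u v u' v'
  assume x: "(u, v) \<in> l2_adjoint ?M (leaf_operator lam)" and y: "(u', v') \<in> l2_adjoint ?M (leaf_operator lam)"
  have c1: "1 / lam \<noteq> 1" using c by auto
  obtain U P where U: "leaf_sol (1 / lam) U P v" "AE t in lborel. 0 < t \<longrightarrow> u t = U t" "weighted_l2 (1 / lam) U"
    using leaf_adjoint_regular[OF x c1] by blast
  obtain U' P' where U': "leaf_sol (1 / lam) U' P' v'" "AE t in lborel. 0 < t \<longrightarrow> u' t = U' t" "weighted_l2 (1 / lam) U'"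
    using leaf_adjoint_regular[OF y c1] by blast
  have sq: "(u, v) \<in> square_int ?M \<times> square_int ?M" "(u', v') \<in> square_int ?M \<times> square_int ?M"
    using x y l2_adjoint_square_int by blast+
  then have v: "weighted_l2 (1 / lam) v" "weighted_l2 (1 / lam) v'"
    by (auto simp: square_int_leaf_measure)
  have "boundary_form ?M (u, v) (u', v') = 0"
    by (rule tendsto_unique[OF _ boundary_form_tendsto[OF U(1) U'(1) U(3) U'(3) sq U(2) U'(2)]
          wronskian_tendsto_at_0[OF U(1) U'(1) U(3) v(1) U'(3) v(2) c]]) simp
  then show "l2_inner ?M v u' = l2_inner ?M u v'" by (simp add: boundary_form_def)
qed


text \<open>Converse of the regularity of the adjoint: a test function and its flux vanish near 0,
  so the Wronskian against any square integrable solution has limit 0 there.\<close>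

lemma leaf_sol_in_adjoint:
  assumes sol: "leaf_sol (1 / lam) U P v" and l2: "weighted_l2 (1 / lam) U" "weighted_l2 (1 / lam) v"
  shows "(U, v) \<in> l2_adjoint (leaf_measure lam) (leaf_operator lam)"
proof -
  let ?M = "leaf_measure lam"
  have sq: "U \<in> square_int ?M" "v \<in> square_int ?M"
    using l2 by (simp_all add: square_int_leaf_measure)
  have "l2_inner ?M g U = l2_inner ?M f v" if fg: "(f, g) \<in> leaf_operator lam" for f g
  proof -
    obtain \<phi> where \<phi>: "f \<in> square_int ?M" "g \<in> square_int ?M" "\<phi> \<in> test_functions"
      "AE t in ?M. f t = \<phi> t" "AE t in ?M. g t = leaf_laplacian lam \<phi> t"
      using fg unfolding leaf_operator_def by blast
    obtain h Q where h: "h \<in> test_functions" "Q \<in> test_functions"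
      "\<And>t. 0 < t \<Longrightarrow> leaf_laplacian lam \<phi> t = h t" "leaf_sol (1 / lam) \<phi> Q h"
      using leaf_laplacian_test_function[OF \<phi>(3)] by blast
    have sq': "\<phi> \<in> square_int ?M" "h \<in> square_int ?M"
      by (simp_all add: square_int_leaf_measure weighted_l2_test_function \<phi> h)
    have gh: "AE t in ?M. g t = h t"
      using \<phi>(5) unfolding AE_leaf_measure by eventually_elim (simp add: h(3))
    have "(wronskian \<phi> Q U P \<longlongrightarrow> boundary_form ?M (\<phi>, h) (U, v)) (at_right 0)"
      by (rule boundary_form_tendsto[OF h(4) sol])
        (use l2 sq sq' \<phi>(3) in \<open>simp_all add: weighted_l2_test_function\<close>)
    moreover have "(wronskian \<phi> Q U P \<longlongrightarrow> 0) (at_right 0)"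
    proof (rule Lim_transform_eventually[OF tendsto_const])
      obtain l u where lu: "0 < l" "\<And>t. t \<le> l \<or> u \<le> t \<Longrightarrow> \<phi> t = 0"
        using test_function_support[OF \<phi>(3)] by metis
      obtain l' u' where lu': "0 < l'" "\<And>t. t \<le> l' \<or> u' \<le> t \<Longrightarrow> Q t = 0"
        using test_function_support[OF h(2)] by metis
      show "\<forall>\<^sub>F t in at_right 0. 0 = wronskian \<phi> Q U P t"
        unfolding eventually_at_right_field wronskian_def
        by (intro exI[of _ "min l l'"]) (simp add: lu lu')
    qed
    ultimately have "boundary_form ?M (\<phi>, h) (U, v) = 0"
      by (intro tendsto_unique[of "at_right 0"]) auto
    moreover have "l2_inner ?M g U = l2_inner ?M h U" "l2_inner ?M f v = l2_inner ?M \<phi> v"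
      by (rule l2_inner_cong_AE; use \<phi> sq sq' gh in \<open>simp add: square_intD\<close>)+
    ultimately show ?thesis by (simp add: boundary_form_def)
  qed
  then show ?thesis using sq by (simp add: l2_adjoint_iff)
qed

text \<open>The Pluecker relation for 2 by 2 determinants of four vectors in the plane. A Wronskian
  is the determinant of one pair with the conjugate of the other, so the two reference pairs have to
  be real for the conjugates to match.\<close>

lemma wronskian_pluecker:
  assumes "cnj (U1 t) = U1 t" "cnj (P1 t) = P1 t" "cnj (U2 t) = U2 t" "cnj (P2 t) = P2 t"
  shows "wronskian U P U' P' t * wronskian U1 P1 U2 P2 t =
    wronskian U P U1 P1 t * cnj (wronskian U' P' U2 P2 t) - wronskian U P U2 P2 t * cnj (wronskian U' P' U1 P1 t)"
  by (simp add: wronskian_def assms algebra_simps)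

section \<open>Explicit boundary conditions\<close>

definition cutoff :: "real poly \<Rightarrow> real \<Rightarrow> real" where
  "cutoff p t = flat_exp p (1 - t\<^sup>2)"

definition flat_exp_D :: "real poly \<Rightarrow> real poly" where
  "flat_exp_D p = [:0, 0, 1:] * (p - pderiv p)"

text \<open>Dependence on t^2 alone puts a factor t into the derivative. Hence a cutoff that is not
  constant near 0 still has a flux of order t^(c+1), and dividing its derivative by t creates no
  singularity.\<close>

lemma cutoff_deriv: "(cutoff p has_real_derivative - 2 * t * cutoff (flat_exp_D p) t) (at t)"
proof -
  have "((\<lambda>t. 1 - t\<^sup>2) has_real_derivative - 2 * t) (at t)"
    by (auto intro!: derivative_eq_intros)
  from DERIV_chain2[OF flat_exp_deriv this] show ?thesis
    unfolding cutoff_def flat_exp_D_def by (simp add: mult.commute)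
qed

lemma cutoff_continuous: "continuous_on A (cutoff p)"
  by (intro continuous_at_imp_continuous_on ballI DERIV_isCont[OF cutoff_deriv])

lemma cutoff_eq_0:
  assumes "1 \<le> t"
  shows "cutoff p t = 0"
proof -
  have "\<not> 0 < 1 - t\<^sup>2" using one_le_power[OF assms, of 2] by linarith
  then show ?thesis unfolding cutoff_def flat_exp_def by (rule if_not_P)
qed

lemma set_integrable_powr_at_0:
  assumes "- 1 < c"
  shows "set_integrable lborel {0<..1} (\<lambda>t::real. t powr c)"
proof -
  have "(\<lambda>t. t powr c) integrable_on {0<..1::real}"
    by (rule integrable_on_powr_from_0'[OF assms]) simp
  then have "(\<lambda>t. t powr c) absolutely_integrable_on {0<..1::real}"
    by (rule nonnegative_absolutely_integrable_1) simp
  then show ?thesis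
    unfolding set_integrable_def by (subst (asm) integrable_completion) auto
qed

lemma weighted_l2_compact_support:
  fixes f :: "real \<Rightarrow> real"
  assumes c: "- 1 < c" and f: "continuous_on UNIV f" and z: "\<And>t. 1 \<le> t \<Longrightarrow> f t = 0"
  shows "weighted_l2 c (\<lambda>t. of_real (f t))"
proof -
  have fm: "f \<in> borel_measurable borel" by (rule borel_measurable_continuous_onI[OF f])
  obtain B where B: "\<And>t. t \<in> {0..1} \<Longrightarrow> norm (f t) \<le> B"
    using continuous_on_Icc_bounded[OF continuous_on_subset[OF f subset_UNIV]] by blast
  have "set_integrable lborel {0<..1} (\<lambda>t. B\<^sup>2 * t powr c)"
    using set_integrable_powr_at_0[OF c] by auto
  then have int: "integrable lborel (\<lambda>t. indicator {0<..1} t *\<^sub>R (B\<^sup>2 * t powr c))"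
    by (simp add: set_integrable_def)
  have "integrable lborel (\<lambda>t. indicator {0<..} t *\<^sub>R (t powr c * (cmod (of_real (f t)))\<^sup>2))"
  proof (rule Bochner_Integration.integrable_bound[OF int])
    show "(\<lambda>t. indicator {0<..} t *\<^sub>R (t powr c * (cmod (of_real (f t)))\<^sup>2)) \<in> borel_measurable lborel"
      using fm by measurable
    show "AE t in lborel. norm (indicator {0<..} t *\<^sub>R (t powr c * (cmod (of_real (f t)))\<^sup>2)) \<le>
        norm (indicator {0<..1} t *\<^sub>R (B\<^sup>2 * t powr c))"
    proof (intro AE_I2)
      fix t :: real
      show "norm (indicator {0<..} t *\<^sub>R (t powr c * (cmod (of_real (f t)))\<^sup>2)) \<le>
        norm (indicator {0<..1} t *\<^sub>R (B\<^sup>2 * t powr c))"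
      proof (cases "t \<in> {0<..1}")
        case True
        then have "(f t)\<^sup>2 \<le> B\<^sup>2" using B[of t] power_mono[of "\<bar>f t\<bar>" B 2] by auto
        then have "t powr c * (f t)\<^sup>2 \<le> B\<^sup>2 * t powr c"
          by (subst mult.commute) (rule mult_right_mono; simp)
        then show ?thesis using True by simp
      next
        case False
        then show ?thesis using z[of t] by (cases "0 < t") auto
      qed
    qed
  qed
  moreover have "(\<lambda>t. complex_of_real (f t)) \<in> borel_measurable borel"
    using fm by measurable
  ultimately show ?thesis
    unfolding weighted_l2_def set_integrable_def
    using borel_measurable_indicator_cong[of "\<lambda>t. complex_of_real (f t)", OF refl] by blast
qed

definition cutoff_flux :: "real \<Rightarrow> real \<Rightarrow> real" where
  "cutoff_flux c t = - 2 * t powr (c + 1) * cutoff (flat_exp_D 1) t"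

text \<open>The value of u'' + (c/t) u' for u = \<open>cutoff 1\<close>: the quotient by t has been
  cancelled, so the formula is continuous across 0.\<close>

definition cutoff_laplacian :: "real \<Rightarrow> real \<Rightarrow> real" where
  "cutoff_laplacian c t =
    4 * t\<^sup>2 * cutoff (flat_exp_D (flat_exp_D 1)) t - 2 * (c + 1) * cutoff (flat_exp_D 1) t"

lemma leaf_sol_cutoff:
  "leaf_sol c (\<lambda>t. of_real (cutoff 1 t)) (\<lambda>t. of_real (cutoff_flux c t)) (\<lambda>t. of_real (cutoff_laplacian c t))"
  unfolding leaf_sol_def
proof
  let ?e1 = "cutoff (flat_exp_D 1)" and ?e2 = "cutoff (flat_exp_D (flat_exp_D 1))"
  have "ac_deriv (\<lambda>t. of_real (cutoff 1 t)) (\<lambda>t. of_real (- 2 * t * ?e1 t))"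
    by (rule ac_deriv_C1) (intro has_vector_derivative_of_real cutoff_deriv continuous_intros cutoff_continuous)+
  then show "ac_deriv (\<lambda>t. of_real (cutoff 1 t)) (\<lambda>t. of_real (t powr (- c)) * of_real (cutoff_flux c t))"
  proof (rule ac_deriv_cong)
    fix t :: real assume t: "0 < t"
    have "t powr (- c) * t powr (c + 1) = t" using t by (simp flip: powr_add)
    then have "- 2 * t * ?e1 t = t powr (- c) * cutoff_flux c t"
      by (simp add: cutoff_flux_def)
    then show "complex_of_real (- 2 * t * ?e1 t) = of_real (t powr (- c)) * of_real (cutoff_flux c t)"
      by (metis of_real_mult)
  qed simp
  have "ac_deriv (\<lambda>t. of_real (cutoff_flux c t)) (\<lambda>t. of_real (t powr c * cutoff_laplacian c t))"
  proof (rule ac_deriv_C1)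
    fix t :: real assume t: "0 < t"
    have "((\<lambda>t. t powr (c + 1)) has_real_derivative (c + 1) * t powr c) (at t)"
      using t by (auto intro!: derivative_eq_intros)
    from DERIV_mult[OF DERIV_cmult[OF this, of "- 2"] cutoff_deriv]
    have "(cutoff_flux c has_real_derivative
        - 2 * ((c + 1) * t powr c) * ?e1 t + - 2 * t * ?e2 t * (- 2 * t powr (c + 1))) (at t)"
      unfolding cutoff_flux_def by simp
    moreover have "t powr (c + 1) = t powr c * t" using t by (simp add: powr_add)
    ultimately have "(cutoff_flux c has_real_derivative t powr c * cutoff_laplacian c t) (at t)"
      by (simp add: cutoff_laplacian_def algebra_simps power2_eq_square)
    then show "((\<lambda>t. complex_of_real (cutoff_flux c t)) has_vector_derivative
        of_real (t powr c * cutoff_laplacian c t)) (at t)"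
      by (rule has_vector_derivative_of_real)
  next
    show "continuous_on {0<..} (\<lambda>t. complex_of_real (t powr c * cutoff_laplacian c t))"
      unfolding cutoff_laplacian_def by (intro continuous_intros cutoff_continuous) auto
  qed
  then show "ac_deriv (\<lambda>t. of_real (cutoff_flux c t)) (\<lambda>t. of_real (t powr c) * of_real (cutoff_laplacian c t))"
    by simp
qed

lemma weighted_l2_cutoff:
  assumes "- 1 < c"
  shows "weighted_l2 c (\<lambda>t. of_real (cutoff 1 t))" "weighted_l2 c (\<lambda>t. of_real (cutoff_laplacian d t))"
proof -
  show "weighted_l2 c (\<lambda>t. of_real (cutoff 1 t))"
    by (rule weighted_l2_compact_support[OF assms cutoff_continuous]) (rule cutoff_eq_0)
  have "continuous_on UNIV (cutoff_laplacian d)"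
    unfolding cutoff_laplacian_def by (intro continuous_intros cutoff_continuous)
  then show "weighted_l2 c (\<lambda>t. of_real (cutoff_laplacian d t))"
    by (rule weighted_l2_compact_support[OF assms]) (simp add: cutoff_laplacian_def cutoff_eq_0)
qed

theorem leaf_operator_not_essentially_self_adjoint:
  assumes c: "- 1 < 1 / lam" "1 / lam < 3" "1 / lam \<noteq> 1"
  shows "\<not> essentially_self_adjoint (leaf_measure lam) (leaf_operator lam)"
proof -
  let ?M = "leaf_measure lam" and ?T = "leaf_operator lam"
  define c where "c = 1 / lam"
  \<comment> \<open>The bounds -1 < c < 3 say that both t^c and t^(2-c) are integrable at 0, as
    needed for the cutoff itself and for its dual.\<close>
  have c': "- 1 < c" "- 1 < 2 - c" "c \<noteq> 1" using assms by (auto simp: c_def)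
  let ?k = "\<lambda>t. complex_of_real (cutoff 1 t)"
  define v1 where "v1 = (\<lambda>t. complex_of_real (cutoff_laplacian c t))"
  define P1 where "P1 = (\<lambda>t. complex_of_real (cutoff_flux c t))"
  \<comment> \<open>The second reference solution is the dual of the cutoff for the exponent 2 - c,
    and behaves like t^(1-c) at the origin; \<open>P2\<close> and \<open>v2\<close> come from
    \<open>leaf_sol_dual\<close>.\<close>
  define U2 where "U2 = (\<lambda>t. complex_of_real (t powr (1 - c)) * ?k t)"
  define P2 where "P2 = (\<lambda>t. of_real (1 - c) * ?k t + complex_of_real (t powr (c - 1)) * of_real (cutoff_flux (2 - c) t))"
  define v2 where "v2 = (\<lambda>t. complex_of_real (t powr (1 - c)) * of_real (cutoff_laplacian (2 - c) t))"
  have sol1: "leaf_sol c ?k P1 v1"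
    unfolding P1_def v1_def by (rule leaf_sol_cutoff)
  have sol2: "leaf_sol c U2 P2 v2"
    using leaf_sol_dual[OF leaf_sol_cutoff[of "2 - c"]] by (simp add: U2_def P2_def v2_def)
  have l1: "weighted_l2 c ?k" "weighted_l2 c v1"
    unfolding v1_def by (rule weighted_l2_cutoff[OF c'(1)])+
  have l2: "weighted_l2 c U2" "weighted_l2 c v2"
    using weighted_l2_dual[OF weighted_l2_cutoff(1)[OF c'(2)]] weighted_l2_dual[OF weighted_l2_cutoff(2)[OF c'(2)]]
    by (simp_all add: U2_def v2_def)
  note sol = sol1[unfolded c_def] sol2[unfolded c_def] and l = l1[unfolded c_def] l2[unfolded c_def]
  have adj: "(?k, v1) \<in> l2_adjoint ?M ?T" "(U2, v2) \<in> l2_adjoint ?M ?T"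
    by (rule leaf_sol_in_adjoint sol l)+
  have real: "cnj (?k t) = ?k t" "cnj (P1 t) = P1 t" "cnj (U2 t) = U2 t" "cnj (P2 t) = P2 t" for t
    by (simp_all add: P1_def U2_def P2_def)
  have sq: "(?k, v1) \<in> square_int ?M \<times> square_int ?M" "(U2, v2) \<in> square_int ?M \<times> square_int ?M"
    using adj l2_adjoint_square_int by blast+
  have lim: "(wronskian U P V Q \<longlongrightarrow> boundary_form ?M (u, v) (u', v')) (at_right 0)"
    if "leaf_sol (1 / lam) U P v" "leaf_sol (1 / lam) V Q v'" "weighted_l2 (1 / lam) U" "weighted_l2 (1 / lam) V"
      "(u, v) \<in> l2_adjoint ?M ?T" "(u', v') \<in> l2_adjoint ?M ?T"
      "AE t in lborel. 0 < t \<longrightarrow> u t = U t" "AE t in lborel. 0 < t \<longrightarrow> u' t = V t" for U P V Q u v u' v'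
    using that l2_adjoint_square_int by (intro boundary_form_tendsto) blast+
  note uniq = tendsto_unique[of "at_right (0::real)", OF trivial_limit_at_right_real]
  have B: "boundary_form ?M (?k, v1) (?k, v1) = 0" "boundary_form ?M (U2, v2) (U2, v2) = 0"
  proof -
    have "wronskian ?k P1 ?k P1 = (\<lambda>t. 0)" "wronskian U2 P2 U2 P2 = (\<lambda>t. 0)"
      by (simp_all add: fun_eq_iff wronskian_def real del: complex_cnj_complex_of_real)
    then show "boundary_form ?M (?k, v1) (?k, v1) = 0" "boundary_form ?M (U2, v2) (U2, v2) = 0"
      using lim[OF sol(1) sol(1) l(1) l(1) adj(1) adj(1)] lim[OF sol(2) sol(2) l(3) l(3) adj(2) adj(2)]
      by (auto dest!: uniq[OF _ tendsto_const])
  qed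
  have B12: "boundary_form ?M (?k, v1) (U2, v2) = of_real ((1 - c) * (cutoff 1 0)\<^sup>2)"
  proof (rule uniq)
    show "(wronskian ?k P1 U2 P2 \<longlongrightarrow> boundary_form ?M (?k, v1) (U2, v2)) (at_right 0)"
      by (rule lim[OF sol(1) sol(2) l(1) l(3) adj(1) adj(2)]) auto
    have "isCont (cutoff 1) 0" by (rule DERIV_isCont[OF cutoff_deriv])
    then have "(cutoff 1 \<longlongrightarrow> cutoff 1 0) (at_right 0)"
      by (simp add: isCont_def filterlim_at_split)
    then have "((\<lambda>t. complex_of_real ((1 - c) * (cutoff 1 t)\<^sup>2)) \<longlongrightarrow> of_real ((1 - c) * (cutoff 1 0)\<^sup>2)) (at_right 0)"
      by (intro tendsto_intros)
    then show "(wronskian ?k P1 U2 P2 \<longlongrightarrow> of_real ((1 - c) * (cutoff 1 0)\<^sup>2)) (at_right 0)"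
    proof (rule Lim_transform_eventually)
      have "complex_of_real ((1 - c) * (cutoff 1 t)\<^sup>2) = wronskian ?k P1 U2 P2 t" if t: "0 < t" for t
      proof -
        have p: "t powr (c - 1) * t powr (2 - c + 1) = t\<^sup>2" "t powr (c + 1) * t powr (1 - c) = t\<^sup>2"
          using t by (simp_all flip: powr_add)
        have "wronskian ?k P1 U2 P2 t = of_real (cutoff 1 t * ((1 - c) * cutoff 1 t + t powr (c - 1) * cutoff_flux (2 - c) t) -
            cutoff_flux c t * (t powr (1 - c) * cutoff 1 t))"
          by (simp add: wronskian_def P1_def P2_def U2_def)
        also have "cutoff 1 t * ((1 - c) * cutoff 1 t + t powr (c - 1) * cutoff_flux (2 - c) t) -
            cutoff_flux c t * (t powr (1 - c) * cutoff 1 t) = (1 - c) * (cutoff 1 t)\<^sup>2 +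
            2 * cutoff (flat_exp_D 1) t * cutoff 1 t * (t powr (c + 1) * t powr (1 - c) - t powr (c - 1) * t powr (2 - c + 1))"
          by (simp add: cutoff_flux_def algebra_simps power2_eq_square)
        finally show ?thesis unfolding p by simp
      qed
      then show "\<forall>\<^sub>F t in at_right 0. complex_of_real ((1 - c) * (cutoff 1 t)\<^sup>2) = wronskian ?k P1 U2 P2 t"
        using eventually_at_right_less[of 0] by (auto elim: eventually_mono)
    qed
  qed
  have B12': "boundary_form ?M (?k, v1) (U2, v2) \<noteq> 0"
    unfolding B12 using c'(3) by (simp add: cutoff_def flat_exp_def)
  show ?thesis
  proof (rule not_essentially_self_adjointI[OF leaf_operator_square_int leaf_operator_dense
        leaf_operator_symmetric adj B B12'])
    fix x y assume xy: "x \<in> l2_adjoint ?M ?T" "y \<in> l2_adjoint ?M ?T"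
    obtain u v u' v' where uv: "x = (u, v)" "y = (u', v')" by (cases x, cases y)
    obtain U P where U: "leaf_sol (1 / lam) U P v" "AE t in lborel. 0 < t \<longrightarrow> u t = U t" "weighted_l2 (1 / lam) U"
      using leaf_adjoint_regular[OF xy(1)[unfolded uv] c(3)] by blast
    obtain U' P' where U': "leaf_sol (1 / lam) U' P' v'" "AE t in lborel. 0 < t \<longrightarrow> u' t = U' t" "weighted_l2 (1 / lam) U'"
      using leaf_adjoint_regular[OF xy(2)[unfolded uv] c(3)] by blast
    let ?b = "boundary_form ?M"
    note L = lim[OF U(1) U'(1) U(3) U'(3) xy[unfolded uv] U(2) U'(2)]
      lim[OF sol(1) sol(2) l(1) l(3) adj AE_I2 AE_I2]
      lim[OF U(1) sol(1) U(3) l(1) xy(1)[unfolded uv] adj(1) U(2) AE_I2]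
      lim[OF U(1) sol(2) U(3) l(3) xy(1)[unfolded uv] adj(2) U(2) AE_I2]
      lim[OF U'(1) sol(1) U'(3) l(1) xy(2)[unfolded uv] adj(1) U'(2) AE_I2]
      lim[OF U'(1) sol(2) U'(3) l(3) xy(2)[unfolded uv] adj(2) U'(2) AE_I2]
    \<comment> \<open>The identity required of the boundary form is the limit at 0 of the pointwise
      Pluecker relation.\<close>
    have "((\<lambda>t. wronskian U P U' P' t * wronskian ?k P1 U2 P2 t) \<longlongrightarrow>
        ?b (u, v) (u', v') * ?b (?k, v1) (U2, v2)) (at_right 0)"
      by (intro tendsto_mult L) auto
    moreover have "((\<lambda>t. wronskian U P U' P' t * wronskian ?k P1 U2 P2 t) \<longlongrightarrow>
        ?b (u, v) (?k, v1) * cnj (?b (u', v') (U2, v2)) - ?b (u, v) (U2, v2) * cnj (?b (u', v') (?k, v1))) (at_right 0)"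
    proof -
      have "wronskian U P U' P' t * wronskian ?k P1 U2 P2 t =
          wronskian U P ?k P1 t * cnj (wronskian U' P' U2 P2 t) -
          wronskian U P U2 P2 t * cnj (wronskian U' P' ?k P1 t)" for t
        by (rule wronskian_pluecker) (rule real)+
      then show ?thesis
        by (simp only:) (intro tendsto_intros L; simp)
    qed
    ultimately show "?b x y * ?b (?k, v1) (U2, v2) =
        ?b x (?k, v1) * cnj (?b y (U2, v2)) - ?b x (U2, v2) * cnj (?b y (?k, v1))"
      unfolding uv by (rule uniq)
  qed
qed


section \<open>The characteristic foliation\<close>

text \<open>On an axis the linear field reduces to a scalar equation solved by exp(k t); as the
  eigenvalue k is nonzero, of either sign, the curve sweeps the whole open half-axis.\<close>

lemma characteristic_leaf_axes:
  assumes "0 \<le> a" "a \<noteq> 1/2"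
  shows "characteristic_leaf a positive_x_axis" "characteristic_leaf a positive_y_axis"
proof -
  have range_exp: "range (\<lambda>t. exp (k * t)) = {0<..}" if "k \<noteq> 0" for k :: real
  proof
    show "{0<..} \<subseteq> range (\<lambda>t. exp (k * t))"
    proof
      fix x :: real assume "x \<in> {0<..}"
      then have "x = exp (k * (ln x / k))" using that by simp
      then show "x \<in> range (\<lambda>t. exp (k * t))" by blast
    qed
  qed auto
  have ne: "lam_minus a \<noteq> 0" "lam_plus a \<noteq> 0"
    using assms by (auto simp: lam_minus_def lam_plus_def)
  have exp: "((\<lambda>t. exp (k * t)) has_vector_derivative k * exp (k * t)) (at t)" for k t :: real
    unfolding has_real_derivative_iff_has_vector_derivative[symmetric]
    by (auto intro!: derivative_eq_intros)
  show "characteristic_leaf a positive_x_axis"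
    unfolding characteristic_leaf_def
  proof (intro exI conjI allI)
    let ?g = "\<lambda>t. (exp (lam_minus a * t), 0, 0) :: R3"
    show "?g t \<in> paraboloid a - {0}" for t by (simp add: paraboloid_def zero_prod_def)
    show "(?g has_vector_derivative char_field a (?g t)) (at t)" for t
      using has_vector_derivative_Pair[OF exp[of "lam_minus a" t]
          has_vector_derivative_Pair[OF has_vector_derivative_const[of "0::real"]
            has_vector_derivative_const[of "0::real"]]]
      by simp
    show "positive_x_axis = range ?g"
      using range_exp[OF ne(1)] unfolding positive_x_axis_def by (auto simp: set_eq_iff image_iff)
  qed
  show "characteristic_leaf a positive_y_axis"
    unfolding characteristic_leaf_def
  proof (intro exI conjI allI)
    let ?g = "\<lambda>t. (0, exp (lam_plus a * t), 0) :: R3"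
    show "?g t \<in> paraboloid a - {0}" for t by (simp add: paraboloid_def zero_prod_def)
    show "(?g has_vector_derivative char_field a (?g t)) (at t)" for t
      using has_vector_derivative_Pair[OF has_vector_derivative_const[of "0::real"]
          has_vector_derivative_Pair[OF exp[of "lam_plus a" t] has_vector_derivative_const[of "0::real"]]]
      by simp
    show "positive_y_axis = range ?g"
      using range_exp[OF ne(2)] unfolding positive_y_axis_def by (auto simp: set_eq_iff image_iff)
  qed
qed

lemma char_field_xy_eigenvalues: "has_eigenvalues (char_field_xy a) (lam_minus a) (lam_plus a)"
  unfolding has_eigenvalues_def
proof
  show "linear (char_field_xy a)"
    by (rule linearI) (auto simp: char_field_xy_eq algebra_simps)
  have "independent {(1, 0), (0, 1 :: real) :: real \<times> real}"
    by (auto simp: dependent_def span_singleton zero_prod_def insert_Diff_if)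
  then show "\<exists>v w. v \<noteq> w \<and> independent {v, w} \<and> char_field_xy a v = lam_minus a *\<^sub>R v \<and>
      char_field_xy a w = lam_plus a *\<^sub>R w"
    by (intro exI[of _ "(1, 0)"] exI[of _ "(0, 1)"]) (simp add: char_field_xy_eq)
qed

text \<open>The thresholds in m = 1/2 - a are 1/3 and -1, where 1/m is 3 and -1. The cases separate
  the signs of m because inversion is monotone only on each side of 0.\<close>

lemma ess_sa_x_iff:
  assumes "0 \<le> a" "a \<noteq> 1/2"
  shows "ess_sa_x a \<longleftrightarrow> 1/6 \<le> a \<and> a \<le> 3/2"
proof -
  define m where "m = lam_minus a"
  have m: "m = 1/2 - a" "m \<noteq> 0" using assms by (auto simp: m_def lam_minus_def)
  consider "0 < m" "m \<le> 1/3" | "1/3 < m" | "- 1 \<le> m" "m < 0" | "m < - 1"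
    using m(2) by linarith
  then show ?thesis
  proof cases
    case 1
    then have "3 \<le> 1 / m" by (simp add: field_simps)
    with 1 show ?thesis
      using leaf_operator_essentially_self_adjoint[of m] m by (simp add: ess_sa_x_def flip: m_def)
  next
    case 2
    \<comment> \<open>The condition a \<ge> 0 gives m \<le> 1/2, so 1/m \<ge> 2 and the exceptional
      exponent 1 does not occur.\<close>
    then have "- 1 < 1 / m" "1 / m < 3" "1 / m \<noteq> 1"
      using m assms by (auto simp: field_simps)
    with 2 show ?thesis
      using leaf_operator_not_essentially_self_adjoint[of m] m by (simp add: ess_sa_x_def flip: m_def)
  next
    case 3
    then have "1 / m \<le> - 1" by (simp add: field_simps)
    with 3 show ?thesis
      using leaf_operator_essentially_self_adjoint[of m] m by (simp add: ess_sa_x_def flip: m_def)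
  next
    case 4
    then have "- 1 < 1 / m" "1 / m < 3" "1 / m \<noteq> 1" by (auto simp: field_simps)
    with 4 show ?thesis
      using leaf_operator_not_essentially_self_adjoint[of m] m by (simp add: ess_sa_x_def flip: m_def)
  qed
qed

theorem proposition2:
  fixes a :: real
  assumes "0 \<le> a" and "a \<noteq> 1/2"
  shows "characteristic_leaf a positive_x_axis \<and> characteristic_leaf a positive_y_axis \<and>
    \<not> ess_sa_y a \<and>
    (a = 0 \<longrightarrow> star_node (char_field_xy a) \<and> \<not> ess_sa_x a) \<and>
    (0 < a \<and> a < 1/6 \<longrightarrow> proper_node (char_field_xy a) \<and> \<not> ess_sa_x a) \<and>
    (1/6 \<le> a \<and> a < 1/2 \<longrightarrow> proper_node (char_field_xy a) \<and> ess_sa_x a) \<and>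
    (1/2 < a \<and> a \<le> 3/2 \<longrightarrow> saddle (char_field_xy a) \<and> ess_sa_x a) \<and>
    (3/2 < a \<longrightarrow> saddle (char_field_xy a) \<and> \<not> ess_sa_x a)"
proof -
  note eig = char_field_xy_eigenvalues[of a]
  \<comment> \<open>Here \<open>lam_plus a\<close> is at least 1/2, so the exponent lies in (0, 2],
    inside the range without uniqueness; it equals 1 only for a = 1/2.\<close>
  have y: "\<not> ess_sa_y a"
    unfolding ess_sa_y_def
    by (rule leaf_operator_not_essentially_self_adjoint)
      (use assms in \<open>simp_all add: lam_plus_def field_simps\<close>)
  have star: "star_node (char_field_xy a)" if "a = 0"
    unfolding star_node_def
    by (rule exI[of _ "1/2"]) (use eig that in \<open>simp add: lam_minus_def lam_plus_def\<close>)
  have node: "proper_node (char_field_xy a)" if "0 < a" "a < 1/2"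
    unfolding proper_node_def
    by (rule exI[of _ "lam_minus a"], rule exI[of _ "lam_plus a"])
      (use eig that in \<open>simp add: lam_minus_def lam_plus_def\<close>)
  have saddle: "saddle (char_field_xy a)" if "1/2 < a"
    unfolding saddle_def
    by (rule exI[of _ "lam_minus a"], rule exI[of _ "lam_plus a"])
      (use eig that in \<open>simp add: lam_minus_def lam_plus_def mult_neg_pos\<close>)
  show ?thesis
    using characteristic_leaf_axes[OF assms] y star node saddle ess_sa_x_iff[OF assms] assms
    by auto
qed

end
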